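(* Let $\mathcal{G}$ be an infinite quantum graph obtained from a finite, connected, compact, loop-free metric graph $\mathcal{G}_0=(\mathsf{V}_0,\mathsf{E}_0)$ by adding a countable set $\hat{\mathsf{V}}$ of vertices, with potential $q$ and vertex weights $\gamma=(\gamma_{\mathsf{v}})_{\mathsf{v}\in\mathsf{V}_0}$, as described in the context. Let $\mathcal{H}^{q,\gamma,\sigma}_{\mathcal{G}}$ be the associated Schrödinger operator, where $\sigma=(\sigma_{\hat{\mathsf{v}}})_{\hat{\mathsf{v}}\in\hat{\mathsf{V}}}\subset[0,\infty)$ and $(\sigma_{\hat{\mathsf{v}}})_{\hat{\mathsf{v}}\in\hat{\mathsf{V}}}\notin\ell^1(\hat{\mathsf{V}})$. Then $$\lim_{N\to\infty}\frac1N\sum_{n=1}^{N}\bigl(\lambda_n(q,\gamma,\sigma)-\lambda_n(q,\gamma,0)\bigr)=\infty,$$ and $$\lim_{N\to\infty}\frac1N\sum_{n=1}^{N}\bigl(\lambda_n(q,\gamma,\sigma)-\lambda_n(0,\gamma,0)\bigr)=\infty,$$ as well as $$\lim_{N\to\infty}\frac1N\sum_{n=1}^{N}\bigl(\lambda_n(q,\gamma,\sigma)-\lambda_n(0,0,0)\bigr)=\infty.$$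
   Context: Construction of $\mathcal{G}$. Let $\mathcal{G}_0=(\mathsf{V}_0,\mathsf{E}_0)$ be a finite, connected and compact loop-free metric graph of total length $\mathcal{L}>0$; each edge $\mathsf{e}\in\mathsf{E}_0$ is identified with an interval of length $\ell_{\mathsf{e}}>0$, so $L^2(\mathcal{G}_0)=\bigoplus_{\mathsf{e}\in\mathsf{E}_0}L^2(0,\ell_{\mathsf{e}})$. Let $C(\mathcal{G}_0)$ be the space of continuous functions on $\mathcal{G}_0$ (continuous across the vertices), and $H^1(\mathcal{G}_0)=\bigoplus_{\mathsf{e}\in\mathsf{E}_0}H^1(0,\ell_{\mathsf{e}})\cap C(\mathcal{G}_0)$. Let $q\in L^\infty(\mathcal{G}_0)\cap\bigoplus_{\mathsf{e}\in\mathsf{E}_0}C^\infty(0,\ell_{\mathsf{e}})$ be a non-negative real-valued potential, and $\gamma=(\gamma_{\mathsf{v}})_{\mathsf{v}\in\mathsf{V}_0}\in\mathbb{R}^{|\mathsf{V}_0|}$ with all $\gamma_{\mathsf{v}}\ge0$. The graph $\mathcal{G}$ arises from $\mathcal{G}_0$ by adding a countable set $\hat{\mathsf{V}}$ of new vertices contained in $\bigcup_{\mathsf{e}\in\mathsf{E}_0}(0,\ell_{\mathsf{e}})$ (the interiors of the edges of $\mathcal{G}_0$) such that $\hat{\mathsf{V}}$ is a collection of isolated points, $\mathcal{G}$ has infinitely many vertices and edges, and every cluster point of the vertex set $\mathsf{V}_{\mathcal{G}}=\mathsf{V}_0\cup\hat{\mathsf{V}}$ belongs to $\mathsf{V}_0$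 and is a vertex $\mathsf{v}\in\mathsf{V}_0$ with $\gamma_{\mathsf{v}}=0$. Operators. Given $\sigma=(\sigma_{\hat{\mathsf{v}}})_{\hat{\mathsf{v}}\in\hat{\mathsf{V}}}$ with $\sigma_{\hat{\mathsf{v}}}\ge0$, define $$h^{q,\gamma,\sigma}_{\mathcal{G}}[f]=\int_{\mathcal{G}_0}|f'|^2\,\mathrm{d}x+\int_{\mathcal{G}_0}q|f|^2\,\mathrm{d}x+\sum_{\mathsf{v}\in\mathsf{V}_0}\gamma_{\mathsf{v}}|f(\mathsf{v})|^2+\sum_{\mathsf{v}\in\hat{\mathsf{V}}}\sigma_{\mathsf{v}}|f(\mathsf{v})|^2$$ on the form domain $\{f\in H^1(\mathcal{G}_0): h^{q,\gamma,\sigma}_{\mathcal{G}}[f]<\infty\}$. This form is densely defined, closed and non-negative in $L^2(\mathcal{G}_0)$, and $\mathcal{H}^{q,\gamma,\sigma}_{\mathcal{G}}$ is the associated self-adjoint operator. It has purely discrete spectrum; $\lambda_n(q,\gamma,\sigma)$ denotes its $n$-th eigenvalue (in non-decreasing order, counted with multiplicity). The symbols $\lambda_n(q,\gamma,0)$, $\lambda_n(0,\gamma,0)$, $\lambda_n(0,0,0)$ denote the eigenvalues obtained when the data $q$, $\gamma$, $\sigma$ are replaced by zero where indicated (these are operators on the finite graph $\mathcal{G}_0$). *)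

theory Defs
  imports
    "HOL-Analysis.Analysis"
    "HOL-Library.Function_Algebras"
    "Graph_Theory.Digraph"
begin

text \<open>
  A metric graph is a finite multigraph together with edge lengths. The orientation of the arcs
  only fixes which endpoint of the edge \<open>e\<close> corresponds to \<open>0\<close> (the tail) and which to \<open>len e\<close>
  (the head). The points of the graph are its vertices and the pairs \<open>(e, x)\<close> with
  \<open>0 < x < len e\<close>; values at other elements of the type are meaningless.
\<close>

datatype ('v, 'e) point = Vertex 'v | Inner 'e real

definition points :: "('v, 'e) pre_digraph \<Rightarrow> ('e \<Rightarrow> real) \<Rightarrow> ('v, 'e) point set" where
  "points G len = Vertex ` verts G \<union> {Inner e x | e x. e \<in> arcs G \<and> 0 < x \<and> x < len e}"

definition edge_point :: "('v, 'e) pre_digraph \<Rightarrow> ('e \<Rightarrow> real) \<Rightarrow> 'e \<Rightarrow> real \<Rightarrow> ('v, 'e) point" where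
  "edge_point G len e x =
     (if x \<le> 0 then Vertex (tail G e) else if len e \<le> x then Vertex (head G e) else Inner e x)"

text \<open>
  The quotient topology obtained by gluing the compact intervals \<open>{0..len e}\<close> at the vertices.
  Since the graph is finite, this is the topology of the path metric.
\<close>

definition graph_topology :: "('v, 'e) pre_digraph \<Rightarrow> ('e \<Rightarrow> real) \<Rightarrow> ('v, 'e) point topology" where
  "graph_topology G len = topology (\<lambda>U. U \<subseteq> points G len \<and>
     (\<forall>e\<in>arcs G. openin (top_of_set {0..len e}) {x \<in> {0..len e}. edge_point G len e x \<in> U}))"

lemma openin_graph_topology:
  "openin (graph_topology G len) U \<longleftrightarrow> U \<subseteq> points G len \<and>
     (\<forall>e\<in>arcs G. openin (top_of_set {0..len e}) {x \<in> {0..len e}. edge_point G len e x \<in> U})"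
proof -
  let ?P = "\<lambda>U. U \<subseteq> points G len \<and>
     (\<forall>e\<in>arcs G. openin (top_of_set {0..len e}) {x \<in> {0..len e}. edge_point G len e x \<in> U})"
  have "istopology ?P"
    unfolding istopology_def
  proof (intro conjI allI impI)
    fix S T assume "?P S" "?P T"
    moreover have "{x \<in> {0..len e}. edge_point G len e x \<in> S \<inter> T} =
        {x \<in> {0..len e}. edge_point G len e x \<in> S} \<inter> {x \<in> {0..len e}. edge_point G len e x \<in> T}" for e
      by auto
    ultimately show "S \<inter> T \<subseteq> points G len"
      "\<forall>e\<in>arcs G. openin (top_of_set {0..len e}) {x \<in> {0..len e}. edge_point G len e x \<in> S \<inter> T}"
      by (auto intro: openin_Int)
  next
    fix K assume K: "\<forall>U\<in>K. ?P U"
    then show "\<Union>K \<subseteq> points G len"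
      by auto
    have "{x \<in> {0..len e}. edge_point G len e x \<in> \<Union>K} =
        \<Union>((\<lambda>U. {x \<in> {0..len e}. edge_point G len e x \<in> U}) ` K)" for e
      by auto
    then show "\<forall>e\<in>arcs G. openin (top_of_set {0..len e}) {x \<in> {0..len e}. edge_point G len e x \<in> \<Union>K}"
      using K by (auto intro!: openin_Union)
  qed
  then show ?thesis
    by (simp add: graph_topology_def topology_inverse')
qed

definition metric_graph :: "('v, 'e) pre_digraph \<Rightarrow> ('e \<Rightarrow> real) \<Rightarrow> bool" where
  "metric_graph G len \<longleftrightarrow> fin_digraph G \<and> loopfree_digraph G \<and> (\<forall>e\<in>arcs G. 0 < len e) \<and>
     connected_space (graph_topology G len) \<and> 0 < (\<Sum>e\<in>arcs G. len e)"

text \<open>Square-integrable functions and Sobolev functions on an interval \<open>I\<close>.\<close>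

definition L2_on :: "real set \<Rightarrow> (real \<Rightarrow> complex) set" where
  "L2_on I = {f. f \<in> borel_measurable (lebesgue_on I) \<and>
                 integrable (lebesgue_on I) (\<lambda>x. (cmod (f x))\<^sup>2)}"

definition test_functions :: "real set \<Rightarrow> (real \<Rightarrow> real) set" where
  "test_functions I = {\<phi>. \<phi> C1_differentiable_on UNIV \<and> compact (closure {x. \<phi> x \<noteq> 0}) \<and>
                          closure {x. \<phi> x \<noteq> 0} \<subseteq> I}"

definition weak_derivative :: "real set \<Rightarrow> (real \<Rightarrow> complex) \<Rightarrow> (real \<Rightarrow> complex) \<Rightarrow> bool" where
  "weak_derivative I f g \<longleftrightarrow> (\<forall>\<phi>\<in>test_functions I.
     (LINT x|lebesgue_on I. f x * of_real (deriv \<phi> x)) = - (LINT x|lebesgue_on I. g x * of_real (\<phi> x)))"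

definition H1_on :: "real set \<Rightarrow> (real \<Rightarrow> complex) set" where
  "H1_on I = {f \<in> L2_on I. \<exists>g\<in>L2_on I. weak_derivative I f g}"

text \<open>
  The weak derivative is unique only up to a null set; the choice made here is
  used under integrals only.
\<close>

definition weak_deriv :: "real set \<Rightarrow> (real \<Rightarrow> complex) \<Rightarrow> real \<Rightarrow> complex" where
  "weak_deriv I f = (SOME g. g \<in> L2_on I \<and> weak_derivative I f g)"

definition edge_deriv :: "('e \<Rightarrow> real) \<Rightarrow> (('v, 'e) point \<Rightarrow> complex) \<Rightarrow> 'e \<Rightarrow> real \<Rightarrow> complex" where
  "edge_deriv len f e = weak_deriv {0<..<len e} (\<lambda>x. f (Inner e x))"

definition L2_graph :: "('v, 'e) pre_digraph \<Rightarrow> ('e \<Rightarrow> real) \<Rightarrow> (('v, 'e) point \<Rightarrow> complex) set" where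
  "L2_graph G len = {f. \<forall>e\<in>arcs G. (\<lambda>x. f (Inner e x)) \<in> L2_on {0<..<len e}}"

definition L2_inner ::
  "('v, 'e) pre_digraph \<Rightarrow> ('e \<Rightarrow> real) \<Rightarrow> (('v, 'e) point \<Rightarrow> complex) \<Rightarrow> (('v, 'e) point \<Rightarrow> complex) \<Rightarrow> complex"
  where "L2_inner G len f g =
    (\<Sum>e\<in>arcs G. LINT x|lebesgue_on {0<..<len e}. f (Inner e x) * cnj (g (Inner e x)))"

text \<open>
  Elements of \<open>L2_graph\<close> are functions rather than almost-everywhere classes. An element of \<open>H\<^sup>1\<close> is
  represented by its continuous representative, normalised to vanish off the graph, so that
  two elements of \<open>H1_graph\<close> are equal as functions iff they agree almost everywhere, and
  \<open>H1_graph\<close> is a linear subspace of the space of all functions on \<open>('v, 'e) point\<close>.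
\<close>

definition H1_graph :: "('v, 'e) pre_digraph \<Rightarrow> ('e \<Rightarrow> real) \<Rightarrow> (('v, 'e) point \<Rightarrow> complex) set" where
  "H1_graph G len = {f. (\<forall>e\<in>arcs G. (\<lambda>x. f (Inner e x)) \<in> H1_on {0<..<len e}) \<and>
                      continuous_map (graph_topology G len) euclidean f \<and>
                      (\<forall>p. p \<notin> points G len \<longrightarrow> f p = 0)}"

text \<open>
  Admissible potentials: non-negative, essentially bounded, and smooth in the interior of each
  edge. Only the values of \<open>q\<close> at interior points of the edges matter.
\<close>

definition admissible_potential ::
  "('v, 'e) pre_digraph \<Rightarrow> ('e \<Rightarrow> real) \<Rightarrow> (('v, 'e) point \<Rightarrow> real) \<Rightarrow> bool" where
  "admissible_potential G len q \<longleftrightarrow> (\<forall>e\<in>arcs G.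
     (\<forall>x\<in>{0<..<len e}. 0 \<le> q (Inner e x)) \<and>
     (\<lambda>x. q (Inner e x)) \<in> borel_measurable (lebesgue_on {0<..<len e}) \<and>
     (\<exists>C. AE x in lebesgue_on {0<..<len e}. \<bar>q (Inner e x)\<bar> \<le> C) \<and>
     (\<forall>k. \<forall>x\<in>{0<..<len e}. ((deriv ^^ k) (\<lambda>x. q (Inner e x))) differentiable (at x)))"

text \<open>
  The set \<open>V\<close> of added vertices. The edges of the resulting infinite graph are the components of
  the complement of its vertex set \<open>Vertex ` verts G \<union> V\<close>.
\<close>

definition admissible_added_vertices ::
  "('v, 'e) pre_digraph \<Rightarrow> ('e \<Rightarrow> real) \<Rightarrow> ('v \<Rightarrow> real) \<Rightarrow> ('v, 'e) point set \<Rightarrow> bool" where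
  "admissible_added_vertices G len \<gamma> V \<longleftrightarrow>
     countable V \<and>
     V \<subseteq> {Inner e x | e x. e \<in> arcs G \<and> 0 < x \<and> x < len e} \<and>
     V \<inter> graph_topology G len derived_set_of V = {} \<and>
     infinite (Vertex ` verts G \<union> V) \<and>
     infinite (connected_components_of
       (subtopology (graph_topology G len) (points G len - (Vertex ` verts G \<union> V)))) \<and>
     graph_topology G len derived_set_of (Vertex ` verts G \<union> V) \<subseteq> Vertex ` {v \<in> verts G. \<gamma> v = 0}"

definition energy ::
  "('v, 'e) pre_digraph \<Rightarrow> ('e \<Rightarrow> real) \<Rightarrow> ('v, 'e) point set \<Rightarrow> (('v, 'e) point \<Rightarrow> real) \<Rightarrow>
   ('v \<Rightarrow> real) \<Rightarrow> (('v, 'e) point \<Rightarrow> real) \<Rightarrow> (('v, 'e) point \<Rightarrow> complex) \<Rightarrow> ennreal" where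
  "energy G len V q \<gamma> \<sigma> f =
     (\<Sum>e\<in>arcs G. \<integral>\<^sup>+x. ennreal ((cmod (edge_deriv len f e x))\<^sup>2) \<partial>lebesgue_on {0<..<len e}) +
     (\<Sum>e\<in>arcs G. \<integral>\<^sup>+x. ennreal (q (Inner e x) * (cmod (f (Inner e x)))\<^sup>2) \<partial>lebesgue_on {0<..<len e}) +
     (\<Sum>v\<in>verts G. ennreal (\<gamma> v * (cmod (f (Vertex v)))\<^sup>2)) +
     (\<Sum>\<^sub>\<infinity>p\<in>V. ennreal (\<sigma> p * (cmod (f p))\<^sup>2))"

definition form_domain ::
  "('v, 'e) pre_digraph \<Rightarrow> ('e \<Rightarrow> real) \<Rightarrow> ('v, 'e) point set \<Rightarrow> (('v, 'e) point \<Rightarrow> real) \<Rightarrow>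
   ('v \<Rightarrow> real) \<Rightarrow> (('v, 'e) point \<Rightarrow> real) \<Rightarrow> (('v, 'e) point \<Rightarrow> complex) set" where
  "form_domain G len V q \<gamma> \<sigma> = {f \<in> H1_graph G len. energy G len V q \<gamma> \<sigma> f < \<infinity>}"

text \<open>The sesquilinear form whose quadratic form is \<^const>\<open>energy\<close>.\<close>

definition energy_form ::
  "('v, 'e) pre_digraph \<Rightarrow> ('e \<Rightarrow> real) \<Rightarrow> ('v, 'e) point set \<Rightarrow> (('v, 'e) point \<Rightarrow> real) \<Rightarrow>
   ('v \<Rightarrow> real) \<Rightarrow> (('v, 'e) point \<Rightarrow> real) \<Rightarrow>
   (('v, 'e) point \<Rightarrow> complex) \<Rightarrow> (('v, 'e) point \<Rightarrow> complex) \<Rightarrow> complex" where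
  "energy_form G len V q \<gamma> \<sigma> f g =
     (\<Sum>e\<in>arcs G. LINT x|lebesgue_on {0<..<len e}. edge_deriv len f e x * cnj (edge_deriv len g e x)) +
     (\<Sum>e\<in>arcs G. LINT x|lebesgue_on {0<..<len e}.
        of_real (q (Inner e x)) * f (Inner e x) * cnj (g (Inner e x))) +
     (\<Sum>v\<in>verts G. of_real (\<gamma> v) * f (Vertex v) * cnj (g (Vertex v))) +
     (\<Sum>\<^sub>\<infinity>p\<in>V. of_real (\<sigma> p) * f p * cnj (g p))"

text \<open>
  The graph of the self-adjoint operator associated with the form: \<open>f\<close> is in the domain with
  image \<open>g\<close> iff the form applied to \<open>f\<close> is represented by \<open>g\<close>. The image \<open>g\<close> is determined up to
  equality almost everywhere.
\<close>

definition schroedinger_operator ::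
  "('v, 'e) pre_digraph \<Rightarrow> ('e \<Rightarrow> real) \<Rightarrow> ('v, 'e) point set \<Rightarrow> (('v, 'e) point \<Rightarrow> real) \<Rightarrow>
   ('v \<Rightarrow> real) \<Rightarrow> (('v, 'e) point \<Rightarrow> real) \<Rightarrow>
   ((('v, 'e) point \<Rightarrow> complex) \<times> (('v, 'e) point \<Rightarrow> complex)) set" where
  "schroedinger_operator G len V q \<gamma> \<sigma> =
     {(f, g). f \<in> form_domain G len V q \<gamma> \<sigma> \<and> g \<in> L2_graph G len \<and>
       (\<forall>\<phi>\<in>form_domain G len V q \<gamma> \<sigma>. energy_form G len V q \<gamma> \<sigma> f \<phi> = L2_inner G len g \<phi>)}"

definition eigenspace ::
  "('v, 'e) pre_digraph \<Rightarrow> ('e \<Rightarrow> real) \<Rightarrow> ('v, 'e) point set \<Rightarrow> (('v, 'e) point \<Rightarrow> real) \<Rightarrow>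
   ('v \<Rightarrow> real) \<Rightarrow> (('v, 'e) point \<Rightarrow> real) \<Rightarrow> real \<Rightarrow> (('v, 'e) point \<Rightarrow> complex) set" where
  "eigenspace G len V q \<gamma> \<sigma> \<mu> =
     {f. (f, \<lambda>p. of_real \<mu> * f p) \<in> schroedinger_operator G len V q \<gamma> \<sigma>}"

interpretation cfun: vector_space "\<lambda>(c::complex) (f :: 'a \<Rightarrow> complex) x. c * f x"
  by unfold_locales (auto simp: algebra_simps)

text \<open>
  \<open>has_dimension S k\<close>: the complex function space \<open>S\<close> is finite-dimensional, of dimension \<open>k\<close>. (The
  library function \<open>cfun.dim\<close> is \<open>0\<close> on infinite-dimensional spaces.)
\<close>

definition has_dimension :: "('a \<Rightarrow> complex) set \<Rightarrow> nat \<Rightarrow> bool" where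
  "has_dimension S k \<longleftrightarrow> (\<exists>B. finite B \<and> cfun.independent B \<and> cfun.span B = S \<and> card B = k)"

text \<open>
  \<open>lam 1, lam 2, \<dots>\<close> lists all eigenvalues in non-decreasing order, each as often as its
  multiplicity. There is at most one such sequence on \<open>{1..}\<close>.
\<close>

definition eigenvalue_enumeration ::
  "('v, 'e) pre_digraph \<Rightarrow> ('e \<Rightarrow> real) \<Rightarrow> ('v, 'e) point set \<Rightarrow> (('v, 'e) point \<Rightarrow> real) \<Rightarrow>
   ('v \<Rightarrow> real) \<Rightarrow> (('v, 'e) point \<Rightarrow> real) \<Rightarrow> (nat \<Rightarrow> real) \<Rightarrow> bool" where
  "eigenvalue_enumeration G len V q \<gamma> \<sigma> lam \<longleftrightarrow> mono_on {1..} lam \<and>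
     (\<forall>\<mu>. finite {n \<in> {1..}. lam n = \<mu>} \<and>
          has_dimension (eigenspace G len V q \<gamma> \<sigma> \<mu>) (card {n \<in> {1..}. lam n = \<mu>}))"

definition nth_eigenvalue ::
  "('v, 'e) pre_digraph \<Rightarrow> ('e \<Rightarrow> real) \<Rightarrow> ('v, 'e) point set \<Rightarrow> (('v, 'e) point \<Rightarrow> real) \<Rightarrow>
   ('v \<Rightarrow> real) \<Rightarrow> (('v, 'e) point \<Rightarrow> real) \<Rightarrow> nat \<Rightarrow> real" where
  "nth_eigenvalue G len V q \<gamma> \<sigma> n =
     (THE x. \<exists>lam. eigenvalue_enumeration G len V q \<gamma> \<sigma> lam \<and> lam n = x)"

end

theory Submission
  imports Defs "HOL-Complex_Analysis.Great_Picard"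
begin

text \<open>
  Let \<open>f\<^sub>1, f\<^sub>2, \<dots>\<close> be the orthonormal eigenfunctions of the operator with point interactions and \<open>h\<close> its
  form, and let \<open>h\<^sub>0\<close> be the form in which \<open>\<sigma>\<close>, and possibly \<open>q\<close> and \<open>\<gamma>\<close>, are replaced by zero. For every
  finite set \<open>F\<close> of added vertices,
  \<open>\<lambda>\<^sub>n = h[f\<^sub>n] \<ge> h\<^sub>0[f\<^sub>n] + (\<Sum>p\<in>F. \<sigma> p * |f\<^sub>n p|\<^sup>2)\<close>. By Ky Fan's inequality (\<open>Ky_Fan\<close>) the sum of \<open>h\<^sub>0[f\<^sub>n]\<close>
  over \<open>n \<le> N\<close> is at least the sum of the first \<open>N\<close> eigenvalues of the operator of \<open>h\<^sub>0\<close>. Hence the sum of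
  the first \<open>N\<close> differences is at least \<open>\<Sum>p\<in>F. \<sigma> p * (\<Sum>n\<le>N. |f\<^sub>n p|\<^sup>2)\<close>. It remains to see that the inner sum
  is at least \<open>c N\<close> for large \<open>N\<close>, with a constant \<open>c > 0\<close> that does not depend on \<open>p\<close>: then the mean of the
  differences eventually exceeds \<open>c * (\<Sum>p\<in>F. \<sigma> p)\<close>, and these sums are unbounded because \<open>\<sigma>\<close> is non-negative
  and not summable.

  That bound (\<open>local_weight\<close>) is the lower half of a local Weyl law. The asymptotics of heat kernels or
  resolvents can be avoided because a constant factor may be lost. Added vertices are isolated, so for
  large \<open>N\<close> there is a bump of height \<open>1\<close> at \<open>p\<close> and width of order \<open>1 / N\<close> that meets no other added vertex.
  The \<open>N\<close>th eigenvalue is at least a multiple of \<open>N\<^sup>2\<close> (\<open>eigval_growth\<close>), so the part of the bump that is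
  orthogonal to \<open>f\<^sub>1, \<dots>, f\<^sub>N\<close> has so little mass that a Sobolev inequality on a window of length \<open>1 / N\<close>
  (\<open>value_bound\<close>) makes it at most \<open>1 / 2\<close> at \<open>p\<close>. The projection of the bump is then at least \<open>1 / 2\<close> there,
  while the Cauchy--Schwarz inequality (\<open>proj_value_le\<close>) bounds its square by the mass of the bump, of order
  \<open>1 / N\<close>, times \<open>\<Sum>n\<le>N. |f\<^sub>n p|\<^sup>2\<close>.

  The eigenvalues are defined through an enumeration, whose existence and uniqueness is part of the proof
  (\<open>nth_eigenvalue_eq\<close>). Eigenvectors are obtained by minimizing the Rayleigh quotient successively on
  orthogonal complements, for any closed form with compact embedding (\<open>compact_form_pair\<close>). That the energy
  form on a graph is of this kind rests on two facts: the mass of a function is controlled by its energy,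
  with a small factor, and its values on a fine grid (\<open>grid_estimate\<close>), and sequences that converge in energy
  converge uniformly (\<open>form_complete\<close>). Both come from the fundamental theorem of calculus for weak
  derivatives (\<open>weak_derivative_FTC\<close>).
\<close>

section \<open>Hermitian forms on spaces of complex functions\<close>

text \<open>
  A form only has to be positive semidefinite, and only on \<open>D\<close>. The facts below are applied to the
  energy, to the inner product of \<open>L\<^sup>2\<close> on functions (where null functions are null vectors), and to
  \<open>a - \<lambda> b\<close> on the orthogonal complement of finitely many eigenvectors.
\<close>

locale hermitian_form =
  fixes D :: "('p \<Rightarrow> complex) set" and s :: "('p \<Rightarrow> complex) \<Rightarrow> ('p \<Rightarrow> complex) \<Rightarrow> complex"
  assumes subspace: "cfun.subspace D"
    and add_left: "f \<in> D \<Longrightarrow> g \<in> D \<Longrightarrow> h \<in> D \<Longrightarrow> s (f + g) h = s f h + s g h"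
    and scale_left: "f \<in> D \<Longrightarrow> h \<in> D \<Longrightarrow> s (\<lambda>x. c * f x) h = c * s f h"
    and hermitian: "f \<in> D \<Longrightarrow> g \<in> D \<Longrightarrow> s g f = cnj (s f g)"
    and nonneg: "f \<in> D \<Longrightarrow> 0 \<le> Re (s f f)"
begin

definition sq :: "('p \<Rightarrow> complex) \<Rightarrow> real" where "sq f = Re (s f f)"

lemma mem_add: "f \<in> D \<Longrightarrow> g \<in> D \<Longrightarrow> f + g \<in> D"
  using subspace by (auto simp: cfun.subspace_def)

lemma mem_scale: "f \<in> D \<Longrightarrow> (\<lambda>x. c * f x) \<in> D"
  using subspace by (auto simp: cfun.subspace_def)

lemma mem_diff: "f \<in> D \<Longrightarrow> g \<in> D \<Longrightarrow> f - g \<in> D"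
  by (rule cfun.subspace_diff[OF subspace])

lemma mem_zero: "0 \<in> D"
  by (rule cfun.subspace_0[OF subspace])

lemma mem_sum: "(\<And>i. i \<in> I \<Longrightarrow> f i \<in> D) \<Longrightarrow> (\<Sum>i\<in>I. f i) \<in> D"
  by (rule cfun.subspace_sum[OF subspace])

lemmas mem = mem_add mem_scale mem_diff mem_zero mem_sum

lemma zero_left: "h \<in> D \<Longrightarrow> s 0 h = 0"
  using add_left[of 0 0 h] mem_zero by simp

lemma zero_right: "h \<in> D \<Longrightarrow> s h 0 = 0"
  using hermitian[of 0 h] zero_left mem_zero by simp

lemma add_right: "f \<in> D \<Longrightarrow> g \<in> D \<Longrightarrow> h \<in> D \<Longrightarrow> s h (f + g) = s h f + s h g"
  using hermitian[of "f + g" h] hermitian[of f h] hermitian[of g h] add_left[of f g h] mem_add[of f g]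
  by simp

lemma scale_right: "f \<in> D \<Longrightarrow> h \<in> D \<Longrightarrow> s h (\<lambda>x. c * f x) = cnj c * s h f"
  using hermitian[of "\<lambda>x. c * f x" h] hermitian[of f h] scale_left[of f h c] mem_scale[of f c]
  by simp

lemma diff_left: "f \<in> D \<Longrightarrow> g \<in> D \<Longrightarrow> h \<in> D \<Longrightarrow> s (f - g) h = s f h - s g h"
  using add_left[of "f - g" g h] mem_diff by auto

lemma diff_right: "f \<in> D \<Longrightarrow> g \<in> D \<Longrightarrow> h \<in> D \<Longrightarrow> s h (f - g) = s h f - s h g"
  using add_right[of "f - g" g h] mem_diff by auto

lemma sum_left: "(\<And>i. i \<in> I \<Longrightarrow> f i \<in> D) \<Longrightarrow> h \<in> D \<Longrightarrow> s (\<Sum>i\<in>I. f i) h = (\<Sum>i\<in>I. s (f i) h)"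
  by (induction I rule: infinite_finite_induct) (auto simp: zero_left add_left mem)

lemma sum_right: "(\<And>i. i \<in> I \<Longrightarrow> f i \<in> D) \<Longrightarrow> h \<in> D \<Longrightarrow> s h (\<Sum>i\<in>I. f i) = (\<Sum>i\<in>I. s h (f i))"
  by (induction I rule: infinite_finite_induct) (auto simp: zero_right add_right mem)

lemma sq_nonneg: "f \<in> D \<Longrightarrow> 0 \<le> sq f"
  using nonneg by (simp add: sq_def)

lemma self_eq_sq: assumes "f \<in> D" shows "s f f = of_real (sq f)"
proof -
  have "Im (s f f) = 0"
    using arg_cong[OF hermitian[OF assms assms], of Im] by simp
  then show ?thesis by (simp add: complex_eq_iff sq_def)
qed

lemma sq_zero: "sq 0 = 0"
  using zero_left[OF mem_zero] by (simp add: sq_def)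

lemma sq_add: "f \<in> D \<Longrightarrow> g \<in> D \<Longrightarrow> sq (f + g) = sq f + 2 * Re (s f g) + sq g"
  using hermitian[of f g] by (simp add: sq_def add_left add_right mem)

lemma sq_diff: "f \<in> D \<Longrightarrow> g \<in> D \<Longrightarrow> sq (f - g) = sq f - 2 * Re (s f g) + sq g"
  using hermitian[of f g] by (simp add: sq_def diff_left diff_right mem)

lemma sq_scale:
  assumes "f \<in> D" shows "sq (\<lambda>x. c * f x) = (cmod c)\<^sup>2 * sq f"
proof -
  have "s (\<lambda>x. c * f x) (\<lambda>x. c * f x) = (c * cnj c) * of_real (sq f)"
    using assms by (simp add: scale_left scale_right mem self_eq_sq)
  also have "c * cnj c = of_real ((cmod c)\<^sup>2)"
    by (rule complex_norm_square[symmetric])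
  finally show ?thesis
    by (simp only: sq_def[of "\<lambda>x. c * f x"] of_real_mult[symmetric] Re_complex_of_real)
qed

lemma parallelogram: "f \<in> D \<Longrightarrow> g \<in> D \<Longrightarrow> sq (f + g) + sq (f - g) = 2 * sq f + 2 * sq g"
  by (simp add: sq_add sq_diff)

lemma Cauchy_Schwarz:
  assumes "f \<in> D" "g \<in> D"
  shows "(cmod (s f g))\<^sup>2 \<le> sq f * sq g"
proof -
  define Z where "Z = (cmod (s f g))\<^sup>2"
  have key: "0 \<le> sq f - 2 * t * Z + t\<^sup>2 * Z * sq g" for t :: real
  proof -
    \<comment> \<open>The phase of \<open>s f g\<close> makes the mixed term real.\<close>
    define c where "c = of_real t * s f g"
    have "0 \<le> sq (f - (\<lambda>x. c * g x))"
      by (intro sq_nonneg mem assms)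
    also have "\<dots> = sq f - 2 * Re (cnj c * s f g) + (cmod c)\<^sup>2 * sq g"
      using assms by (simp add: sq_diff mem scale_right sq_scale)
    also have "Re (cnj c * s f g) = t * Z"
      by (simp add: c_def Z_def cmod_power2 power2_eq_square[of "Re _"] power2_eq_square[of "Im _"] algebra_simps)
    also have "(cmod c)\<^sup>2 = t\<^sup>2 * Z"
      by (simp add: c_def Z_def norm_mult power_mult_distrib)
    finally show ?thesis by (simp add: algebra_simps)
  qed
  have Z: "Z \<ge> 0" by (simp add: Z_def)
  show ?thesis
  proof (cases "sq g = 0")
    case True
    have "Z \<le> 0"
    proof (rule ccontr)
      assume "\<not> Z \<le> 0"
      moreover have "0 \<le> sq f - 2 * ((sq f + 1) / Z) * Z"
        using key[of "(sq f + 1) / Z"] True by simp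
      ultimately show False
        using sq_nonneg[OF assms(1)] by simp
    qed
    then show ?thesis using True Z by (simp add: Z_def)
  next
    case False
    then have pos: "sq g > 0" using sq_nonneg[OF assms(2)] by simp
    have "0 \<le> sq f - Z / sq g"
      using key[of "1 / sq g"] pos by (simp add: power2_eq_square field_simps)
    then show ?thesis using pos by (simp add: Z_def field_simps)
  qed
qed

text \<open>
  This does the work of the Euler--Lagrange equation: a minimizer of a Rayleigh quotient \<open>a / b\<close> with
  minimum \<open>\<mu>\<close> is a null vector of the non-negative form \<open>a - \<mu> b\<close>.
\<close>

lemma null_vector_orthogonal: "f \<in> D \<Longrightarrow> g \<in> D \<Longrightarrow> sq f = 0 \<Longrightarrow> s f g = 0"
  using Cauchy_Schwarz[of f g] by simp

lemma sq_diff_le: "f \<in> D \<Longrightarrow> g \<in> D \<Longrightarrow> sq (f - g) \<le> 2 * sq f + 2 * sq g"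
  using parallelogram[of f g] sq_nonneg[OF mem_add, of f g] by simp

lemma continuous_left:
  assumes f: "\<And>n. f n \<in> D" and g: "g \<in> D" and h: "h \<in> D"
    and lim: "(\<lambda>n. sq (f n - g)) \<longlonglongrightarrow> 0"
  shows "(\<lambda>n. s (f n) h) \<longlonglongrightarrow> s g h"
proof -
  have "(\<lambda>n. (cmod (s (f n - g) h))\<^sup>2) \<longlonglongrightarrow> 0"
  proof (rule Lim_null_comparison)
    show "\<forall>\<^sub>F n in sequentially. norm ((cmod (s (f n - g) h))\<^sup>2) \<le> sq (f n - g) * sq h"
      using f g h by (auto intro!: always_eventually Cauchy_Schwarz mem)
    show "(\<lambda>n. sq (f n - g) * sq h) \<longlonglongrightarrow> 0"
      using tendsto_mult_right[OF lim, of "sq h"] by simp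
  qed
  then have "(\<lambda>n. s (f n - g) h) \<longlonglongrightarrow> 0"
    by (metis norm_power power_tendsto_0_iff tendsto_norm_zero_iff zero_less_numeral)
  then have "(\<lambda>n. s (f n) h - s g h) \<longlonglongrightarrow> 0"
    using f g h by (simp add: diff_left)
  then show ?thesis
    by (rule LIM_zero_cancel)
qed

lemma continuous_sq:
  assumes f: "\<And>n. f n \<in> D" and g: "g \<in> D"
    and lim: "(\<lambda>n. sq (f n - g)) \<longlonglongrightarrow> 0"
  shows "(\<lambda>n. sq (f n)) \<longlonglongrightarrow> sq g"
proof -
  have "(\<lambda>n. s (f n) g) \<longlonglongrightarrow> s g g"
    by (rule continuous_left[OF f g g lim])
  then have "(\<lambda>n. sq (f n - g) + 2 * Re (s (f n) g) - sq g) \<longlonglongrightarrow> 0 + 2 * Re (s g g) - sq g"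
    by (intro tendsto_intros lim)
  also have "(\<lambda>n. sq (f n - g) + 2 * Re (s (f n) g) - sq g) = (\<lambda>n. sq (f n))"
    using f g by (auto simp: sq_diff)
  finally show ?thesis by (simp add: sq_def)
qed

definition proj :: "(nat \<Rightarrow> 'p \<Rightarrow> complex) \<Rightarrow> nat \<Rightarrow> ('p \<Rightarrow> complex) \<Rightarrow> 'p \<Rightarrow> complex" where
  "proj u n f = (\<Sum>i<n. (\<lambda>x. s f (u i) * u i x))"

definition orthonormal :: "(nat \<Rightarrow> 'p \<Rightarrow> complex) \<Rightarrow> nat \<Rightarrow> bool" where
  "orthonormal u n \<longleftrightarrow> (\<forall>i<n. u i \<in> D) \<and> (\<forall>i<n. \<forall>j<n. s (u i) (u j) = (if i = j then 1 else 0))"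

lemma orthonormal_mem: "orthonormal u n \<Longrightarrow> i < n \<Longrightarrow> u i \<in> D"
  by (simp add: orthonormal_def)

lemma proj_mem: "orthonormal u n \<Longrightarrow> proj u n f \<in> D"
  unfolding proj_def by (intro mem_sum mem_scale) (simp add: orthonormal_def)

lemma form_comb_left:
  assumes "\<And>i. i < n \<Longrightarrow> u i \<in> D" "h \<in> D"
  shows "s (\<Sum>i<n. (\<lambda>x. c i * u i x)) h = (\<Sum>i<n. c i * s (u i) h)"
  using assms by (subst sum_left) (auto intro!: mem_scale sum.cong scale_left)

lemma orthogonal_remainder:
  assumes u: "orthonormal u n" and f: "f \<in> D" and j: "j < n"
  shows "s (f - proj u n f) (u j) = 0"
proof -
  have uD: "u i \<in> D" if "i < n" for i using u that by (rule orthonormal_mem)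
  have "s (proj u n f) (u j) = (\<Sum>i<n. s f (u i) * s (u i) (u j))"
    unfolding proj_def by (rule form_comb_left) (use uD j in auto)
  also have "\<dots> = (\<Sum>i<n. if i = j then s f (u i) else 0)"
    using u j by (intro sum.cong) (auto simp: orthonormal_def)
  also have "\<dots> = s f (u j)" using j by simp
  finally show ?thesis
    using diff_left[OF f proj_mem[OF u] uD[OF j]] by simp
qed

lemma sq_orthonormal_comb:
  assumes u: "orthonormal u n"
  shows "sq (\<Sum>i<n. (\<lambda>x. c i * u i x)) = (\<Sum>i<n. (cmod (c i))\<^sup>2)"
proof -
  have uD: "u i \<in> D" if "i < n" for i using u that by (rule orthonormal_mem)
  let ?f = "\<Sum>i<n. (\<lambda>x. c i * u i x)"
  have fD: "?f \<in> D" by (intro mem_sum mem_scale uD) simp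
  have "s ?f (u j) = c j" if "j < n" for j
  proof -
    have "s ?f (u j) = (\<Sum>i<n. c i * s (u i) (u j))"
      by (rule form_comb_left) (use uD that in auto)
    also have "\<dots> = (\<Sum>i<n. if i = j then c i else 0)"
      using u that by (intro sum.cong) (auto simp: orthonormal_def)
    finally show ?thesis using that by simp
  qed
  then have "s (u j) ?f = cnj (c j)" if "j < n" for j
    using that hermitian[OF fD uD[OF that]] by simp
  then have "s ?f ?f = (\<Sum>i<n. c i * cnj (c i))"
    by (subst form_comb_left[OF uD fD]) auto
  also have "\<dots> = of_real (\<Sum>i<n. (cmod (c i))\<^sup>2)"
    by (simp only: of_real_sum of_real_mult complex_norm_square)
  finally show ?thesis by (simp only: sq_def Re_complex_of_real)
qed

lemma Pythagoras:
  assumes u: "orthonormal u n" and f: "f \<in> D"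
  shows "sq f = (\<Sum>i<n. (cmod (s f (u i)))\<^sup>2) + sq (f - proj u n f)"
proof -
  have uD: "u i \<in> D" if "i < n" for i using u that by (rule orthonormal_mem)
  let ?p = "proj u n f" and ?q = "f - proj u n f"
  have p: "?p \<in> D" and q: "?q \<in> D" using u f by (auto intro: mem_diff proj_mem)
  have "s ?p ?q = (\<Sum>i<n. s f (u i) * s (u i) ?q)"
    unfolding proj_def[of u n f] by (rule form_comb_left) (use uD q in \<open>auto simp: proj_def\<close>)
  also have "\<dots> = 0"
    using orthogonal_remainder[OF u f] hermitian[OF q uD] by (intro sum.neutral) auto
  finally have "sq (?p + ?q) = sq ?p + sq ?q"
    using sq_add[OF p q] by simp
  moreover have "sq ?p = (\<Sum>i<n. (cmod (s f (u i)))\<^sup>2)"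
    unfolding proj_def by (rule sq_orthonormal_comb[OF u])
  ultimately show ?thesis by simp
qed

lemma Bessel:
  assumes "orthonormal u n" "f \<in> D"
  shows "(\<Sum>i<n. (cmod (s f (u i)))\<^sup>2) \<le> sq f"
  using Pythagoras[OF assms] sq_nonneg[OF mem_diff[OF assms(2) proj_mem[OF assms(1)]]] by simp

end

lemma hermitian_form_subset:
  assumes "hermitian_form D s" "cfun.subspace K" "K \<subseteq> D"
  shows "hermitian_form K s"
proof -
  interpret hermitian_form D s by fact
  show ?thesis
  proof
    show "s (f + g) h = s f h + s g h" if "f \<in> K" "g \<in> K" "h \<in> K" for f g h
      by (rule add_left) (use that assms(3) in auto)
    show "s (\<lambda>x. c * f x) h = c * s f h" if "f \<in> K" "h \<in> K" for f h c
      by (rule scale_left) (use that assms(3) in auto)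
    show "s g f = cnj (s f g)" if "f \<in> K" "g \<in> K" for f g
      by (rule hermitian) (use that assms(3) in auto)
    show "0 \<le> Re (s f f)" if "f \<in> K" for f
      by (rule nonneg) (use that assms(3) in auto)
  qed fact
qed

lemma hermitian_form_add:
  assumes "hermitian_form D s" "hermitian_form D t"
  shows "hermitian_form D (\<lambda>f g. s f g + t f g)"
proof -
  interpret s: hermitian_form D s by fact
  interpret t: hermitian_form D t by fact
  show ?thesis
  proof
    show "s g f + t g f = cnj (s f g + t f g)" if "f \<in> D" "g \<in> D" for f g
      by (simp add: s.hermitian[OF that] t.hermitian[OF that])
  qed (auto simp: s.add_left t.add_left s.scale_left t.scale_left algebra_simps
      intro: s.subspace add_nonneg_nonneg s.nonneg t.nonneg)
qed

lemma hermitian_form_zero: "cfun.subspace D \<Longrightarrow> hermitian_form D (\<lambda>f g. 0)"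
  by unfold_locales auto

lemma hermitian_form_sum:
  assumes "\<And>i. i \<in> I \<Longrightarrow> hermitian_form D (s i)" "cfun.subspace D"
  shows "hermitian_form D (\<lambda>f g. \<Sum>i\<in>I. s i f g)"
  using assms(1)
proof (induction I rule: infinite_finite_induct)
  case (insert i I)
  then show ?case
    using hermitian_form_add[of D "s i" "\<lambda>f g. \<Sum>i\<in>I. s i f g"] by simp
qed (use hermitian_form_zero[OF assms(2)] in auto)

lemma hermitian_form_pullback:
  assumes s: "hermitian_form D' s" and D: "cfun.subspace D"
    and T: "\<And>f. f \<in> D \<Longrightarrow> T f \<in> D'" "\<And>f g. T (f + g) = T f + T g" "\<And>c f. T (\<lambda>x. c * f x) = (\<lambda>x. c * T f x)"
  shows "hermitian_form D (\<lambda>f g. s (T f) (T g))"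
proof -
  interpret hermitian_form D' s by (rule s)
  show ?thesis
    by unfold_locales (auto simp: T add_left scale_left intro: D hermitian nonneg)
qed

lemma weight_mult_cnj_self: "of_real w * z * cnj z = complex_of_real (w * (cmod z)\<^sup>2)"
  by (simp only: of_real_mult complex_norm_square mult.assoc)

lemma hermitian_form_point:
  assumes "0 \<le> w" "cfun.subspace D"
  shows "hermitian_form D (\<lambda>f g. of_real w * f p * cnj (g p))"
proof
  fix f :: "'a \<Rightarrow> complex"
  show "0 \<le> Re (of_real w * f p * cnj (f p))"
    unfolding weight_mult_cnj_self Re_complex_of_real using assms(1) by simp
qed (use assms in \<open>auto simp: algebra_simps\<close>)

section \<open>Eigenvectors of a closed form with compact embedding\<close>

lemma sum_fun_apply: "(\<Sum>i\<in>I. f i) x = (\<Sum>i\<in>I. f i x :: complex)"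
  by (induction I rule: infinite_finite_induct) auto

lemma underdetermined_system:
  fixes u :: "nat \<Rightarrow> 'p \<Rightarrow> complex"
  assumes "finite P" "finite I" "card P < card I"
  shows "\<exists>c. (\<exists>i\<in>I. c i \<noteq> 0) \<and> (\<forall>p\<in>P. (\<Sum>i\<in>I. c i * u i p) = 0)"
  using assms
proof (induction P arbitrary: I u rule: finite_induct)
  case empty
  then show ?case by (intro exI[of _ "\<lambda>_. 1"]) (auto simp: card_gt_0_iff)
next
  case (insert q P)
  show ?case
  proof (cases "\<forall>i\<in>I. u i q = 0")
    case True
    then show ?thesis using insert.IH[of I u] insert.prems insert.hyps by auto
  next
    case False
    then obtain k where k: "k \<in> I" "u k q \<noteq> 0" by blast
    \<comment> \<open>Gaussian elimination: solve the equation at \<open>q\<close> for the coefficient \<open>k\<close>.\<close>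
    define u' where "u' i = (\<lambda>p. u i p - u i q / u k q * u k p)" for i
    have "card P < card (I - {k})" using insert.prems insert.hyps k by simp
    then obtain c where c: "\<exists>i\<in>I - {k}. c i \<noteq> 0" "\<And>p. p \<in> P \<Longrightarrow> (\<Sum>i\<in>I - {k}. c i * u' i p) = 0"
      using insert.IH[of "I - {k}" u'] insert.prems by auto
    define d where "d = c(k := - (\<Sum>i\<in>I - {k}. c i * u i q) / u k q)"
    have "(\<Sum>i\<in>I. d i * u i p) = (\<Sum>i\<in>I - {k}. c i * u' i p)" for p
    proof -
      have "(\<Sum>i\<in>I. d i * u i p) = d k * u k p + (\<Sum>i\<in>I - {k}. d i * u i p)"
        by (rule sum.remove) (use k insert.prems in auto)
      also have "(\<Sum>i\<in>I - {k}. d i * u i p) = (\<Sum>i\<in>I - {k}. c i * u i p)"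
        by (intro sum.cong) (auto simp: d_def)
      also have "d k * u k p = - (\<Sum>i\<in>I - {k}. c i * (u i q / u k q * u k p))"
        by (simp add: d_def sum_divide_distrib sum_distrib_right mult.assoc)
      finally show ?thesis by (simp add: u'_def right_diff_distrib sum_subtractf)
    qed
    moreover have "u' i q = 0" for i using k by (simp add: u'_def)
    ultimately have "\<forall>p\<in>insert q P. (\<Sum>i\<in>I. d i * u i p) = 0" using c(2) by auto
    moreover have "\<exists>i\<in>I. d i \<noteq> 0" using c(1) by (auto simp: d_def)
    ultimately show ?thesis by blast
  qed
qed

text \<open>
  The inner product \<open>b\<close> is given on the form domain \<open>D\<close> alone, so the Hilbert space in which \<open>a\<close> is
  closed never appears. Closedness says that \<open>D\<close> is complete for \<open>a + b\<close>, and the compact embedding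
  of \<open>D\<close> says that a sequence bounded for \<open>a + b\<close> has a Cauchy subsequence for \<open>b\<close>.
\<close>

locale compact_form_pair =
  a: hermitian_form D a + b: hermitian_form D b
  for D :: "('p \<Rightarrow> complex) set" and a b +
  assumes definite: "f \<in> D \<Longrightarrow> b.sq f = 0 \<Longrightarrow> f = 0"
    and compact: "(\<And>n. w n \<in> D) \<Longrightarrow> (\<And>n. a.sq (w n) + b.sq (w n) \<le> M) \<Longrightarrow>
      \<exists>r. strict_mono (r :: nat \<Rightarrow> nat) \<and>
          (\<forall>\<epsilon>>0. \<exists>N. \<forall>m\<ge>N. \<forall>n\<ge>N. b.sq (w (r m) - w (r n)) < \<epsilon>)"
    and complete: "(\<And>n :: nat. w n \<in> D) \<Longrightarrow>
      (\<forall>\<epsilon>>0. \<exists>N. \<forall>m\<ge>N. \<forall>n\<ge>N. a.sq (w m - w n) + b.sq (w m - w n) < \<epsilon>) \<Longrightarrow>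
      \<exists>g\<in>D. (\<lambda>n. a.sq (w n - g) + b.sq (w n - g)) \<longlonglongrightarrow> 0"
    and infinite_dimensional: "finite B \<Longrightarrow> \<not> D \<subseteq> cfun.span B"
begin

text \<open>
  A minimizing sequence has a \<open>b\<close>-Cauchy subsequence by compactness. The parallelogram law makes that
  subsequence \<open>a\<close>-Cauchy as well, so that it converges in \<open>D\<close>, and the limit is a minimizer.
\<close>

lemma Rayleigh_minimizer:
  assumes K: "cfun.subspace K" "K \<subseteq> D"
    and closed: "\<And>f g. (\<And>n :: nat. f n \<in> K) \<Longrightarrow> g \<in> D \<Longrightarrow> (\<lambda>n. b.sq (f n - g)) \<longlonglongrightarrow> 0 \<Longrightarrow> g \<in> K"
    and h: "h \<in> K" "h \<noteq> 0"
  shows "\<exists>u\<in>K. b.sq u = 1 \<and> (\<forall>g\<in>K. a.sq u * b.sq g \<le> a.sq g)"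
proof -
  interpret ak: hermitian_form K a by (rule hermitian_form_subset[OF a.hermitian_form_axioms K])
  define S where "S = {g\<in>K. b.sq g = 1}"
  define \<mu> where "\<mu> = Inf (a.sq ` S)"
  have normalize: "\<exists>f\<in>S. a.sq f * b.sq g = a.sq g" if "g \<in> K" "g \<noteq> 0" for g
  proof -
    define c where "c = complex_of_real (1 / sqrt (b.sq g))"
    have gD: "g \<in> D" using that K by auto
    then have pos: "b.sq g > 0" using b.sq_nonneg[of g] definite[of g] that by force
    then have "(cmod c)\<^sup>2 = 1 / b.sq g"
      by (simp add: c_def norm_divide power_divide)
    then have "b.sq (\<lambda>x. c * g x) = 1" "a.sq (\<lambda>x. c * g x) * b.sq g = a.sq g"
      using pos gD by (simp_all add: a.sq_scale b.sq_scale)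
    then show ?thesis
      using ak.mem_scale[OF that(1), of c] by (auto simp: S_def)
  qed
  have S: "S \<noteq> {}" using normalize[OF h] by auto
  have bdd: "bdd_below (a.sq ` S)"
    using K a.sq_nonneg by (auto simp: bdd_below_def S_def)
  have le: "\<mu> * b.sq g \<le> a.sq g" if "g \<in> K" for g
  proof (cases "g = 0")
    case True
    then show ?thesis by (simp add: b.sq_zero a.sq_zero)
  next
    case False
    obtain f where f: "f \<in> S" "a.sq f * b.sq g = a.sq g" using normalize[OF \<open>g \<in> K\<close> False] by blast
    then have "\<mu> \<le> a.sq f"
      unfolding \<mu>_def by (intro cInf_lower imageI bdd)
    moreover have "0 \<le> b.sq g" using b.sq_nonneg that K by auto
    ultimately show ?thesis
      unfolding f(2)[symmetric] by (rule mult_right_mono)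
  qed
  have \<mu>0: "\<mu> \<ge> 0"
    unfolding \<mu>_def using S K a.sq_nonneg by (intro cInf_greatest) (auto simp: S_def)
  have "\<exists>g\<in>S. a.sq g < \<mu> + 1 / real (Suc n)" for n
    using cInf_lessD[of "a.sq ` S" "\<mu> + 1 / real (Suc n)"] S by (auto simp: \<mu>_def)
  then obtain g where g: "\<And>n :: nat. g n \<in> S" "\<And>n. a.sq (g n) < \<mu> + 1 / real (Suc n)"
    by metis
  have gK: "g n \<in> K" and gD: "g n \<in> D" and g1: "b.sq (g n) = 1" for n
    using g(1)[of n] K by (auto simp: S_def)
  have "a.sq (g n) + b.sq (g n) \<le> \<mu> + 2" for n
    using g(2)[of n] g1[of n] divide_le_eq_1_pos[of "real (Suc n)" 1] by linarith
  from compact[of g, OF gD this] obtain r :: "nat \<Rightarrow> nat" where r: "strict_mono r"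
    and rb: "\<forall>\<epsilon>>0. \<exists>N. \<forall>m\<ge>N. \<forall>n\<ge>N. b.sq (g (r m) - g (r n)) < \<epsilon>"
    by blast
  define f where "f n = g (r n)" for n
  have f: "f n \<in> K" "f n \<in> D" "b.sq (f n) = 1" for n
    using gK gD g1 by (auto simp: f_def)
  have fa: "a.sq (f n) < \<mu> + 1 / real (Suc n)" for n
  proof -
    have "1 / real (Suc (r n)) \<le> 1 / real (Suc n)"
      using seq_suble[OF r, of n] by (intro divide_left_mono) auto
    then show ?thesis using g(2)[of "r n"] by (simp add: f_def)
  qed
  \<comment> \<open>By the parallelogram law a minimizing sequence that is Cauchy for \<open>b\<close> is Cauchy for \<open>a\<close>.\<close>
  have cauchy: "a.sq (f m - f n) \<le> 2 * (1 / real (Suc m)) + 2 * (1 / real (Suc n)) + \<mu> * b.sq (f m - f n)" for m n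
  proof -
    have "a.sq (f m - f n) = 2 * a.sq (f m) + 2 * a.sq (f n) - a.sq (f m + f n)"
      using a.parallelogram[OF f(2) f(2), of m n] by simp
    moreover have "b.sq (f m + f n) = 4 - b.sq (f m - f n)"
      using b.parallelogram[OF f(2) f(2), of m n] f(3) by simp
    moreover have "\<mu> * b.sq (f m + f n) \<le> a.sq (f m + f n)"
      by (intro le ak.mem f)
    moreover have "\<mu> * (4 - b.sq (f m - f n)) = 4 * \<mu> - \<mu> * b.sq (f m - f n)"
      by (simp only: right_diff_distrib mult.commute)
    ultimately show ?thesis
      using fa[of m] fa[of n] by simp
  qed
  have "\<forall>\<epsilon>>0. \<exists>N. \<forall>m\<ge>N. \<forall>n\<ge>N. a.sq (f m - f n) + b.sq (f m - f n) < \<epsilon>"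
  proof (intro allI impI)
    fix \<epsilon> :: real assume "\<epsilon> > 0"
    have "\<epsilon> / 2 / (1 + \<mu>) > 0" using \<open>\<epsilon> > 0\<close> \<mu>0 by simp
    from rb[rule_format, OF this] obtain N1
      where N1: "\<And>m n. m \<ge> N1 \<Longrightarrow> n \<ge> N1 \<Longrightarrow> b.sq (f m - f n) < \<epsilon> / 2 / (1 + \<mu>)"
      unfolding f_def by blast
    obtain N2 :: nat where N2: "8 / \<epsilon> < real N2" using reals_Archimedean2 by blast
    show "\<exists>N. \<forall>m\<ge>N. \<forall>n\<ge>N. a.sq (f m - f n) + b.sq (f m - f n) < \<epsilon>"
    proof (intro exI[of _ "max N1 N2"] allI impI)
      fix m n assume mn: "m \<ge> max N1 N2" "n \<ge> max N1 N2"
      have small: "2 * (1 / real (Suc k)) \<le> \<epsilon> / 4" if "k \<ge> max N1 N2" for k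
      proof -
        have "8 / \<epsilon> < real (Suc k)" using N2 that by simp
        then have "8 < real (Suc k) * \<epsilon>" using \<open>\<epsilon> > 0\<close> by (simp only: pos_divide_less_eq)
        then show ?thesis by (simp add: pos_divide_le_eq mult.commute)
      qed
      have "(1 + \<mu>) * b.sq (f m - f n) < \<epsilon> / 2"
        using N1[of m n] mn \<mu>0 pos_less_divide_eq[of "1 + \<mu>" "b.sq (f m - f n)" "\<epsilon> / 2"]
        by (simp add: mult.commute)
      moreover have "(1 + \<mu>) * b.sq (f m - f n) = b.sq (f m - f n) + \<mu> * b.sq (f m - f n)"
        by (simp only: distrib_right mult_1)
      ultimately show "a.sq (f m - f n) + b.sq (f m - f n) < \<epsilon>"
        using cauchy[of m n] small[OF mn(1)] small[OF mn(2)] by linarith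
    qed
  qed
  from complete[of f, OF f(2) this] obtain u where u: "u \<in> D"
    and lim: "(\<lambda>n. a.sq (f n - u) + b.sq (f n - u)) \<longlonglongrightarrow> 0" by blast
  have pos: "0 \<le> a.sq (f n - u)" "0 \<le> b.sq (f n - u)" for n
    by (intro a.sq_nonneg b.sq_nonneg a.mem_diff f u)+
  have lim_a: "(\<lambda>n. a.sq (f n - u)) \<longlonglongrightarrow> 0"
    by (rule tendsto_sandwich[OF _ _ tendsto_const lim]) (use pos in auto)
  have lim_b: "(\<lambda>n. b.sq (f n - u)) \<longlonglongrightarrow> 0"
    by (rule tendsto_sandwich[OF _ _ tendsto_const lim]) (use pos in auto)
  have "u \<in> K" by (rule closed[OF f(1) u lim_b])
  moreover have "b.sq u = 1"
    using b.continuous_sq[OF f(2) u lim_b] unfolding f(3) by (simp only: LIMSEQ_const_iff)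
  moreover have "a.sq u * b.sq g \<le> a.sq g" if "g \<in> K" for g
  proof -
    have "a.sq u \<le> \<mu>"
    proof (rule LIMSEQ_le)
      show "(\<lambda>n. a.sq (f n)) \<longlonglongrightarrow> a.sq u" by (rule a.continuous_sq[OF f(2) u lim_a])
      show "(\<lambda>n. \<mu> + 1 / real (Suc n)) \<longlonglongrightarrow> \<mu>"
        by (rule LIMSEQ_inverse_real_of_nat_add[unfolded inverse_eq_divide])
      show "\<exists>N. \<forall>n\<ge>N. a.sq (f n) \<le> \<mu> + 1 / real (Suc n)"
        using fa less_imp_le by blast
    qed
    moreover have "0 \<le> b.sq g" using that K by (intro b.sq_nonneg) auto
    ultimately have "a.sq u * b.sq g \<le> \<mu> * b.sq g" by (rule mult_right_mono)
    then show ?thesis using le[OF that] by linarith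
  qed
  ultimately show ?thesis by blast
qed

text \<open>
  The Rayleigh quotient is minimized over the orthogonal complement of the vectors found before. The
  complement is closed for \<open>b\<close>, and it is not zero because \<open>D\<close> has infinite dimension.
\<close>

lemma next_eigenvector:
  assumes u: "b.orthonormal u n"
  shows "\<exists>r\<in>D. b.sq r = 1 \<and> (\<forall>i<n. b r (u i) = 0) \<and>
    (\<forall>g\<in>D. (\<forall>i<n. b g (u i) = 0) \<longrightarrow> a.sq r * b.sq g \<le> a.sq g)"
proof -
  have uD: "u i \<in> D" if "i < n" for i using u that by (rule b.orthonormal_mem)
  define K where "K = {g\<in>D. \<forall>i<n. b g (u i) = 0}"
  have K: "cfun.subspace K" "K \<subseteq> D"
    unfolding cfun.subspace_def K_def
    by (auto simp: b.mem_zero b.zero_left b.mem_add b.add_left b.mem_scale b.scale_left uD)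
  have "\<not> D \<subseteq> cfun.span (u ` {..<n})" by (rule infinite_dimensional) simp
  then obtain f where f: "f \<in> D" "f \<notin> cfun.span (u ` {..<n})" by blast
  have "b.proj u n f \<in> cfun.span (u ` {..<n})"
    unfolding b.proj_def by (intro cfun.span_sum cfun.span_scale cfun.span_base) simp
  then have "f - b.proj u n f \<noteq> 0" using f(2) by auto
  moreover have "f - b.proj u n f \<in> K"
    using b.orthogonal_remainder[OF u f(1)] b.mem_diff[OF f(1) b.proj_mem[OF u]] by (auto simp: K_def)
  moreover have "g \<in> K" if "\<And>m :: nat. w m \<in> K" "g \<in> D" "(\<lambda>m. b.sq (w m - g)) \<longlonglongrightarrow> 0" for w g
  proof -
    have "b g (u i) = 0" if "i < n" for i
    proof (rule LIMSEQ_unique)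
      show "(\<lambda>m. b (w m) (u i)) \<longlonglongrightarrow> b g (u i)"
        by (rule b.continuous_left) (use \<open>\<And>m. w m \<in> K\<close> K \<open>g \<in> D\<close> uD that \<open>_ \<longlonglongrightarrow> 0\<close> in auto)
      show "(\<lambda>m. b (w m) (u i)) \<longlonglongrightarrow> 0"
        using \<open>\<And>m. w m \<in> K\<close> that by (simp add: K_def)
    qed
    then show ?thesis using that(2) by (simp add: K_def)
  qed
  ultimately have "\<exists>r\<in>K. b.sq r = 1 \<and> (\<forall>g\<in>K. a.sq r * b.sq g \<le> a.sq g)"
    using Rayleigh_minimizer[OF K] by blast
  then show ?thesis by (auto simp: K_def)
qed

lemma eigenbasis_exists:
  "\<exists>u. \<forall>n::nat. u n \<in> D \<and> b.sq (u n) = 1 \<and> (\<forall>i<n. b (u n) (u i) = 0) \<and>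
    (\<forall>g\<in>D. (\<forall>i<n. b g (u i) = 0) \<longrightarrow> a.sq (u n) * b.sq g \<le> a.sq g)"
proof (rule dependent_wellorder_choice)
  fix n :: nat and u :: "nat \<Rightarrow> 'p \<Rightarrow> complex"
  assume *: "\<And>m. m < n \<Longrightarrow> u m \<in> D \<and> b.sq (u m) = 1 \<and> (\<forall>i<m. b (u m) (u i) = 0) \<and>
    (\<forall>g\<in>D. (\<forall>i<m. b g (u i) = 0) \<longrightarrow> a.sq (u m) * b.sq g \<le> a.sq g)"
  have "b (u i) (u j) = (if i = j then 1 else 0)" if "i < n" "j < n" for i j
  proof -
    consider "i < j" | "i = j" | "j < i" by linarith
    then show ?thesis
    proof cases
      case 1
      then show ?thesis using *[OF that(1)] *[OF that(2)] b.hermitian[of "u j" "u i"] by auto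
    next
      case 2
      then show ?thesis using *[OF that(1)] b.self_eq_sq[of "u i"] by auto
    next
      case 3
      then show ?thesis using *[OF that(1)] by auto
    qed
  qed
  then have "b.orthonormal u n" using * by (simp add: b.orthonormal_def)
  from next_eigenvector[OF this]
  show "\<exists>r. r \<in> D \<and> b.sq r = 1 \<and> (\<forall>i<n. b r (u i) = 0) \<and>
    (\<forall>g\<in>D. (\<forall>i<n. b g (u i) = 0) \<longrightarrow> a.sq r * b.sq g \<le> a.sq g)" by blast
qed auto

definition eigvec :: "nat \<Rightarrow> 'p \<Rightarrow> complex" where
  "eigvec = (SOME u. \<forall>n::nat. u n \<in> D \<and> b.sq (u n) = 1 \<and> (\<forall>i<n. b (u n) (u i) = 0) \<and>
    (\<forall>g\<in>D. (\<forall>i<n. b g (u i) = 0) \<longrightarrow> a.sq (u n) * b.sq g \<le> a.sq g))"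

definition eigval :: "nat \<Rightarrow> real" where
  "eigval n = a.sq (eigvec n)"

lemma eigvec_mem: "eigvec n \<in> D"
  and eigvec_sq: "b.sq (eigvec n) = 1"
  and eigvec_orthogonal_less: "i < n \<Longrightarrow> b (eigvec n) (eigvec i) = 0"
  and eigval_le_Rayleigh: "g \<in> D \<Longrightarrow> (\<And>i. i < n \<Longrightarrow> b g (eigvec i) = 0) \<Longrightarrow> eigval n * b.sq g \<le> a.sq g"
  using someI_ex[OF eigenbasis_exists] unfolding eigvec_def[symmetric] eigval_def by auto

lemma eigvec_orthonormal: "b (eigvec m) (eigvec n) = (if m = n then 1 else 0)"
proof -
  consider "m < n" | "m = n" | "n < m" by linarith
  then show ?thesis
  proof cases
    case 1
    then show ?thesis
      using b.hermitian[OF eigvec_mem eigvec_mem, of n m] eigvec_orthogonal_less[OF 1] by simp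
  next
    case 2
    then show ?thesis using b.self_eq_sq[OF eigvec_mem] eigvec_sq by simp
  next
    case 3
    then show ?thesis using eigvec_orthogonal_less by simp
  qed
qed

lemma orthonormal_eigvec: "b.orthonormal eigvec n"
  by (simp add: b.orthonormal_def eigvec_mem eigvec_orthonormal)

lemma eigval_mono: "m \<le> n \<Longrightarrow> eigval m \<le> eigval n"
  using eigval_le_Rayleigh[OF eigvec_mem, of m n] by (simp add: eigvec_orthonormal eigvec_sq eigval_def)

lemma eigval_nonneg: "0 \<le> eigval n"
  unfolding eigval_def by (intro a.sq_nonneg eigvec_mem)

lemma eigvec_equation: "\<phi> \<in> D \<Longrightarrow> a (eigvec n) \<phi> = eigval n * b (eigvec n) \<phi>"
proof (induction n arbitrary: \<phi> rule: less_induct)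
  case (less n)
  let ?u = "eigvec"
  define K where "K = {g\<in>D. \<forall>i<n. b g (?u i) = 0}"
  have K: "cfun.subspace K" "K \<subseteq> D"
    unfolding cfun.subspace_def K_def
    by (auto simp: b.mem_zero b.zero_left b.mem_add b.add_left b.mem_scale b.scale_left eigvec_mem)
  \<comment> \<open>On the orthogonal complement of the earlier eigenvectors \<open>a - \<lambda> b\<close> is non-negative and
    vanishes at the \<open>n\<close>-th one.\<close>
  interpret t: hermitian_form K "\<lambda>f g. a f g - eigval n * b f g"
  proof
    show "0 \<le> Re (a f f - eigval n * b f f)" if "f \<in> K" for f
      using eigval_le_Rayleigh[of f n] that by (simp add: K_def a.sq_def b.sq_def)
    show "a g f - eigval n * b g f = cnj (a f g - eigval n * b f g)" if "f \<in> K" "g \<in> K" for f g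
    proof -
      have "f \<in> D" "g \<in> D" using that K by auto
      then show ?thesis by (simp add: a.hermitian[of f g] b.hermitian[of f g])
    qed
  qed (use K in \<open>auto simp: a.add_left b.add_left a.scale_left b.scale_left algebra_simps subset_eq\<close>)
  have un: "?u n \<in> K" using eigvec_mem by (simp add: K_def eigvec_orthonormal)
  have tn: "t.sq (?u n) = 0"
    using eigvec_sq[of n] unfolding t.sq_def by (simp add: eigval_def a.sq_def b.sq_def)
  let ?p = "b.proj ?u n \<phi>" and ?q = "\<phi> - b.proj ?u n \<phi>"
  have p: "?p \<in> D" by (intro b.proj_mem orthonormal_eigvec)
  have q: "?q \<in> K"
    using b.orthogonal_remainder[OF orthonormal_eigvec less.prems] b.mem_diff[OF less.prems p]
    by (simp add: K_def)
  have "a (?u n) ?q = eigval n * b (?u n) ?q"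
    using t.null_vector_orthogonal[OF un q tn] by simp
  moreover have "a (?u n) ?p = eigval n * b (?u n) ?p"
  proof -
    have "a (?u n) (?u i) = eigval n * b (?u n) (?u i)" if "i < n" for i
      using less.IH[OF that eigvec_mem[of n]] that a.hermitian[OF eigvec_mem eigvec_mem, of i n]
      by (simp add: eigvec_orthonormal)
    then show ?thesis
      unfolding b.proj_def
      by (simp add: a.sum_right b.sum_right a.mem_scale eigvec_mem a.scale_right b.scale_right sum_distrib_left
          eigvec_orthonormal)
  qed
  moreover have "\<phi> = ?p + ?q" by simp
  ultimately show ?case
    using a.add_right[OF p _ eigvec_mem, of ?q n] b.add_right[OF p _ eigvec_mem, of ?q n] q K
    by (auto simp: algebra_simps)
qed

lemma sq_eigvec_comb:
  "a.sq (\<Sum>i<n. (\<lambda>x. c i * eigvec i x)) = (\<Sum>i<n. eigval i * (cmod (c i))\<^sup>2)"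
proof -
  let ?f = "\<Sum>i<n. (\<lambda>x. c i * eigvec i x)"
  have fD: "?f \<in> D" by (intro a.mem_sum a.mem_scale eigvec_mem)
  have "b (eigvec j) ?f = cnj (c j)" if "j < n" for j
  proof -
    have "b ?f (eigvec j) = (\<Sum>i<n. c i * b (eigvec i) (eigvec j))"
      by (rule b.form_comb_left) (auto intro: eigvec_mem)
    also have "\<dots> = c j" using that by (simp add: eigvec_orthonormal mult_delta_right)
    finally show ?thesis using b.hermitian[OF fD eigvec_mem[of j]] by simp
  qed
  then have "a ?f ?f = (\<Sum>i<n. eigval i * (c i * cnj (c i)))"
    by (subst a.form_comb_left[OF eigvec_mem fD])
      (auto simp: eigvec_equation[OF fD] algebra_simps intro!: sum.cong)
  also have "\<dots> = of_real (\<Sum>i<n. eigval i * (cmod (c i))\<^sup>2)"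
    by (simp only: of_real_sum of_real_mult complex_norm_square)
  finally show ?thesis by (simp only: a.sq_def Re_complex_of_real)
qed

text \<open>
  By the eigenvalue equation the eigenvectors are orthogonal for \<open>a\<close> too, and so is the remainder of
  the projection.
\<close>

lemma Pythagoras_energy:
  assumes f: "f \<in> D"
  shows "a.sq f = (\<Sum>i<n. eigval i * (cmod (b f (eigvec i)))\<^sup>2) + a.sq (f - b.proj eigvec n f)"
proof -
  let ?p = "b.proj eigvec n f" and ?q = "f - b.proj eigvec n f"
  have p: "?p \<in> D" and q: "?q \<in> D"
    using f by (auto intro!: b.mem_diff b.proj_mem orthonormal_eigvec)
  have "a ?p ?q = (\<Sum>i<n. b f (eigvec i) * a (eigvec i) ?q)"
    unfolding b.proj_def[of eigvec n f] by (rule a.form_comb_left) (use q in \<open>auto simp: b.proj_def eigvec_mem\<close>)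
  also have "\<dots> = 0"
    using b.orthogonal_remainder[OF orthonormal_eigvec f] b.hermitian[OF q eigvec_mem]
    by (intro sum.neutral) (auto simp: eigvec_equation[OF q])
  finally have "a.sq (?p + ?q) = a.sq ?p + a.sq ?q"
    using a.sq_add[OF p q] by simp
  moreover have "a.sq ?p = (\<Sum>i<n. eigval i * (cmod (b f (eigvec i)))\<^sup>2)"
    unfolding b.proj_def by (rule sq_eigvec_comb)
  ultimately show ?thesis by simp
qed

lemma Rayleigh_remainder:
  assumes f: "f \<in> D"
  shows "eigval n * b.sq (f - b.proj eigvec n f) \<le> a.sq (f - b.proj eigvec n f)"
  by (rule eigval_le_Rayleigh)
    (use b.orthogonal_remainder[OF orthonormal_eigvec f] b.mem_diff[OF f b.proj_mem[OF orthonormal_eigvec]] in auto)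

lemma remainder_energy_le:
  assumes f: "f \<in> D"
  shows "a.sq (f - b.proj eigvec n f) \<le> a.sq f"
  using Pythagoras_energy[OF f, of n] by (simp add: sum_nonneg eigval_nonneg)

text \<open>
  If the eigenvalues were bounded, the eigenvectors would be a bounded sequence, but no two of them
  are closer than \<open>sqrt 2\<close>.
\<close>

lemma eigval_unbounded: "\<exists>n. M < eigval n"
proof (rule ccontr)
  assume "\<nexists>n. M < eigval n"
  then have "a.sq (eigvec n) + b.sq (eigvec n) \<le> M + 1" for n
    by (simp add: eigvec_sq eigval_def not_less)
  from compact[of eigvec, OF eigvec_mem this] obtain r :: "nat \<Rightarrow> nat" where r: "strict_mono r"
    and "\<forall>\<epsilon>>0. \<exists>N. \<forall>m\<ge>N. \<forall>n\<ge>N. b.sq (eigvec (r m) - eigvec (r n)) < \<epsilon>" by blast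
  then obtain N where N: "\<And>m n. m \<ge> N \<Longrightarrow> n \<ge> N \<Longrightarrow> b.sq (eigvec (r m) - eigvec (r n)) < 2"
    by (metis zero_less_numeral)
  have "r (Suc N) \<noteq> r N" using r by (metis n_not_Suc_n strict_mono_eq)
  then have "b.sq (eigvec (r (Suc N)) - eigvec (r N)) = 2"
    by (simp add: b.sq_diff eigvec_mem eigvec_sq eigvec_orthonormal)
  then show False using N[of "Suc N" N] by simp
qed

text \<open>
  The weight \<open>w i\<close> with which the orthonormal family meets the eigenvector \<open>i\<close> is at most \<open>1\<close> by
  Bessel's inequality, and what is missing from the total weight \<open>N\<close> lies in the remainders, where
  the Rayleigh quotient is at least \<open>eigval N\<close>. So the energy is smallest when the weights are all
  concentrated on the lowest \<open>N\<close> eigenvalues.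
\<close>

lemma Ky_Fan:
  assumes f: "b.orthonormal f N"
  shows "(\<Sum>i<N. eigval i) \<le> (\<Sum>j<N. a.sq (f j))"
proof -
  define c where "c j i = (cmod (b (f j) (eigvec i)))\<^sup>2" for j i
  define w where "w i = (\<Sum>j<N. c j i)" for i
  have fD: "f j \<in> D" if "j < N" for j using f that by (rule b.orthonormal_mem)
  have f1: "b.sq (f j) = 1" if "j < N" for j using f that by (simp add: b.orthonormal_def b.sq_def)
  have w: "w i \<le> 1" for i
  proof -
    have "w i = (\<Sum>j<N. (cmod (b (eigvec i) (f j)))\<^sup>2)"
      unfolding w_def c_def by (intro sum.cong) (auto simp: b.hermitian[OF eigvec_mem fD])
    also have "\<dots> \<le> 1"
      using b.Bessel[OF f eigvec_mem[of i]] by (simp add: eigvec_sq)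
    finally show ?thesis .
  qed
  have "(\<Sum>i<N. eigval i * c j i) + eigval N * (1 - (\<Sum>i<N. c j i)) \<le> a.sq (f j)" if "j < N" for j
  proof -
    have "b.sq (f j - b.proj eigvec N (f j)) = 1 - (\<Sum>i<N. c j i)"
      using b.Pythagoras[OF orthonormal_eigvec fD[OF that], of N] f1[OF that] by (simp add: c_def)
    then show ?thesis
      using Pythagoras_energy[OF fD[OF that], of N] Rayleigh_remainder[OF fD[OF that], of N] by (simp add: c_def)
  qed
  then have "(\<Sum>j<N. (\<Sum>i<N. eigval i * c j i) + eigval N * (1 - (\<Sum>i<N. c j i))) \<le> (\<Sum>j<N. a.sq (f j))"
    by (intro sum_mono) auto
  moreover have "(\<Sum>j<N. (\<Sum>i<N. eigval i * c j i) + eigval N * (1 - (\<Sum>i<N. c j i)))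
      = (\<Sum>i<N. eigval i * w i) + eigval N * (\<Sum>i<N. 1 - w i)"
  proof -
    have "(\<Sum>j<N. \<Sum>i<N. eigval i * c j i) = (\<Sum>i<N. eigval i * w i)"
      unfolding w_def sum_distrib_left by (rule sum.swap)
    moreover have "(\<Sum>j<N. \<Sum>i<N. c j i) = (\<Sum>i<N. w i)"
      unfolding w_def by (rule sum.swap)
    ultimately show ?thesis
      by (simp add: sum.distrib sum_distrib_left[symmetric] sum_subtractf)
  qed
  moreover have "(\<Sum>i<N. eigval i) \<le> (\<Sum>i<N. eigval i * w i) + eigval N * (\<Sum>i<N. 1 - w i)"
  proof -
    have "eigval i \<le> eigval i * w i + eigval N * (1 - w i)" if "i < N" for i
      using mult_right_mono[OF eigval_mono[of i N], of "1 - w i"] w[of i] that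
      by (simp add: algebra_simps)
    then have "(\<Sum>i<N. eigval i) \<le> (\<Sum>i<N. eigval i * w i + eigval N * (1 - w i))"
      by (intro sum_mono) auto
    then show ?thesis by (simp add: sum.distrib sum_distrib_left)
  qed
  ultimately show ?thesis by linarith
qed

text \<open>
  Some non-trivial combination of the first \<open>N + 1\<close> eigenvectors satisfies the \<open>card P\<close> linear conditions
  \<open>f p = 0\<close>, and its Rayleigh quotient is at most \<open>eigval N\<close>.
\<close>

lemma eigval_lower_bound:
  assumes P: "finite P" and \<epsilon>: "\<And>f. f \<in> D \<Longrightarrow> (\<And>p. p \<in> P \<Longrightarrow> f p = 0) \<Longrightarrow> b.sq f \<le> \<epsilon> * a.sq f"
    and "card P \<le> N" "0 \<le> \<epsilon>"
  shows "1 \<le> \<epsilon> * eigval N"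
proof -
  obtain c where c: "\<exists>i<Suc N. c i \<noteq> 0" "\<And>p. p \<in> P \<Longrightarrow> (\<Sum>i<Suc N. c i * eigvec i p) = 0"
    using underdetermined_system[OF P, of "{..<Suc N}" eigvec] \<open>card P \<le> N\<close> by auto
  let ?f = "\<Sum>i<Suc N. (\<lambda>x. c i * eigvec i x)"
  define S where "S = (\<Sum>i<Suc N. (cmod (c i))\<^sup>2)"
  have S: "S > 0"
  proof -
    obtain i where "i < Suc N" "c i \<noteq> 0" using c(1) by blast
    then show ?thesis unfolding S_def by (intro sum_pos2[of _ i]) auto
  qed
  have "?f p = (\<Sum>i<Suc N. c i * eigvec i p)" for p
    by (simp add: sum_fun_apply)
  then have "b.sq ?f \<le> \<epsilon> * a.sq ?f"
    using c(2) by (intro \<epsilon> a.mem_sum a.mem_scale eigvec_mem) simp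
  then have "S \<le> \<epsilon> * (\<Sum>i<Suc N. eigval i * (cmod (c i))\<^sup>2)"
    unfolding S_def b.sq_orthonormal_comb[OF orthonormal_eigvec] sq_eigvec_comb .
  also have "(\<Sum>i<Suc N. eigval i * (cmod (c i))\<^sup>2) \<le> (\<Sum>i<Suc N. eigval N * (cmod (c i))\<^sup>2)"
    by (intro sum_mono mult_right_mono eigval_mono) auto
  also have "\<dots> = eigval N * S" by (simp only: S_def sum_distrib_left)
  finally have "1 * S \<le> (\<epsilon> * eigval N) * S"
    using \<open>0 \<le> \<epsilon>\<close> by (simp add: mult_left_mono mult.assoc)
  then show ?thesis using S by (rule mult_right_le_imp_le)
qed

text \<open>
  An eigenvector for \<open>\<mu>\<close> is orthogonal to the eigenvectors for other eigenvalues. What is left of it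
  after projecting away the first \<open>N\<close> of them has Rayleigh quotient \<open>\<mu>\<close>, which is less than the
  minimum \<open>eigval N\<close> on the complement if \<open>N\<close> is large; so nothing is left.
\<close>

lemma eigenspace_eq_span:
  "{f \<in> D. \<forall>\<phi>\<in>D. a f \<phi> = of_real \<mu> * b f \<phi>} = cfun.span (eigvec ` {n. eigval n = \<mu>})" (is "?E = cfun.span ?B")
proof
  have "cfun.subspace ?E"
    unfolding cfun.subspace_def
    by (auto simp: a.mem a.zero_left b.zero_left a.add_left b.add_left a.scale_left b.scale_left algebra_simps)
  moreover have "?B \<subseteq> ?E" by (auto simp: eigvec_mem eigvec_equation)
  ultimately show "cfun.span ?B \<subseteq> ?E" by (intro cfun.span_minimal)
  show "?E \<subseteq> cfun.span ?B"
  proof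
    fix f assume "f \<in> ?E"
    then have f: "f \<in> D" and eq: "\<And>\<phi>. \<phi> \<in> D \<Longrightarrow> a f \<phi> = of_real \<mu> * b f \<phi>" by auto
    obtain N where N: "\<mu> < eigval N" using eigval_unbounded by blast
    have other: "b f (eigvec n) = 0" if "eigval n \<noteq> \<mu>" for n
    proof -
      have "of_real \<mu> * b f (eigvec n) = of_real (eigval n) * b f (eigvec n)"
        using eq[OF eigvec_mem[of n]] a.hermitian[OF eigvec_mem f, of n] b.hermitian[OF eigvec_mem f, of n]
        by (auto simp: eigvec_equation[OF f])
      then show ?thesis using that by auto
    qed
    have "eigval N * b.sq (f - b.proj eigvec N f) \<le> \<mu> * b.sq (f - b.proj eigvec N f)"
    proof -
      have "a.sq f = \<mu> * b.sq f" using eq[OF f] by (simp add: a.sq_def b.sq_def)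
      moreover have "(\<Sum>i<N. eigval i * (cmod (b f (eigvec i)))\<^sup>2) = \<mu> * (\<Sum>i<N. (cmod (b f (eigvec i)))\<^sup>2)"
        unfolding sum_distrib_left using other by (intro sum.cong refl) fastforce
      ultimately have "a.sq (f - b.proj eigvec N f) = \<mu> * b.sq (f - b.proj eigvec N f)"
        using Pythagoras_energy[OF f, of N] b.Pythagoras[OF orthonormal_eigvec f, of N]
        by (simp add: algebra_simps)
      then show ?thesis using Rayleigh_remainder[OF f, of N] by simp
    qed
    moreover have rD: "f - b.proj eigvec N f \<in> D" by (intro b.mem_diff f b.proj_mem orthonormal_eigvec)
    moreover have "0 \<le> b.sq (f - b.proj eigvec N f)" by (rule b.sq_nonneg[OF rD])
    ultimately have "b.sq (f - b.proj eigvec N f) = 0"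
      using N by (simp add: mult_le_cancel_right)
    then have "f = b.proj eigvec N f" using definite[OF rD] by simp
    also have "\<dots> \<in> cfun.span ?B"
      unfolding b.proj_def
    proof (rule cfun.span_sum)
      fix i
      show "(\<lambda>x. b f (eigvec i) * eigvec i x) \<in> cfun.span ?B"
      proof (cases "eigval i = \<mu>")
        case True
        then show ?thesis by (intro cfun.span_scale cfun.span_base) auto
      next
        case False
        have "(\<lambda>x. b f (eigvec i) * eigvec i x) = 0" using other[OF False] by auto
        then show ?thesis by (simp only: cfun.span_zero)
      qed
    qed
    finally show "f \<in> cfun.span ?B" .
  qed
qed

lemma inj_eigvec: "inj eigvec"
  by (rule injI) (metis eigvec_orthonormal zero_neq_one)

lemma independent_eigvec: "finite I \<Longrightarrow> cfun.independent (eigvec ` I)"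
proof -
  assume I: "finite I"
  have "\<not> cfun.dependent (eigvec ` I)"
    unfolding cfun.dependent_finite[OF finite_imageI[OF I]]
  proof safe
    fix c :: "('p \<Rightarrow> complex) \<Rightarrow> complex" and j
    assume j: "j \<in> I" "c (eigvec j) \<noteq> 0" and zero: "(\<Sum>v\<in>eigvec ` I. (\<lambda>x. c v * v x)) = 0"
    have "(\<Sum>v\<in>eigvec ` I. (\<lambda>x. c v * v x)) = (\<Sum>i\<in>I. (\<lambda>x. c (eigvec i) * eigvec i x))"
      by (rule sum.reindex_cong[OF inj_on_subset[OF inj_eigvec]]) auto
    then have "0 = b (\<Sum>i\<in>I. (\<lambda>x. c (eigvec i) * eigvec i x)) (eigvec j)"
      using zero by (simp add: b.zero_left eigvec_mem)
    also have "\<dots> = (\<Sum>i\<in>I. c (eigvec i) * b (eigvec i) (eigvec j))"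
      by (subst b.sum_left) (auto intro!: b.mem_scale eigvec_mem simp: b.scale_left eigvec_mem)
    also have "\<dots> = c (eigvec j)"
      using j(1) I by (simp add: eigvec_orthonormal mult_delta_right)
    finally show False using j(2) by simp
  qed
  then show ?thesis by simp
qed

lemma finite_eigval_le: "finite {n. eigval n \<le> \<mu>}"
proof -
  obtain N where N: "\<mu> < eigval N" using eigval_unbounded by blast
  have "{n. eigval n \<le> \<mu>} \<subseteq> {..<N}"
    using N eigval_mono by (force simp: not_less[symmetric])
  then show ?thesis by (rule finite_subset) simp
qed

lemma eigenspace_dimension:
  "has_dimension {f \<in> D. \<forall>\<phi>\<in>D. a f \<phi> = of_real \<mu> * b f \<phi>} (card {n. eigval n = \<mu>})"
proof -
  have fin: "finite {n. eigval n = \<mu>}" by (rule finite_subset[OF _ finite_eigval_le[of \<mu>]]) auto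
  show ?thesis
    unfolding has_dimension_def eigenspace_eq_span
    by (intro exI[of _ "eigvec ` {n. eigval n = \<mu>}"] conjI finite_imageI fin independent_eigvec refl
        card_image inj_on_subset[OF inj_eigvec]) auto
qed

text \<open>
  Expanding \<open>f\<close> and applying the Cauchy--Schwarz inequality to the sum bounds the spectral function
  \<open>\<Sum>i<n. |eigvec i p|\<^sup>2\<close> from below by trial functions \<open>f\<close>.
\<close>

lemma proj_value_le:
  assumes f: "f \<in> D"
  shows "(cmod (b.proj eigvec n f p))\<^sup>2 \<le> b.sq f * (\<Sum>i<n. (cmod (eigvec i p))\<^sup>2)"
proof -
  have "cmod (b.proj eigvec n f p) \<le> (\<Sum>i<n. cmod (b f (eigvec i)) * cmod (eigvec i p))"
    unfolding b.proj_def sum_fun_apply by (rule order_trans[OF norm_sum]) (simp add: norm_mult)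
  then have "(cmod (b.proj eigvec n f p))\<^sup>2 \<le> (\<Sum>i<n. cmod (b f (eigvec i)) * cmod (eigvec i p))\<^sup>2"
    by (rule power_mono) simp
  also have "\<dots> \<le> (\<Sum>i<n. (cmod (b f (eigvec i)))\<^sup>2) * (\<Sum>i<n. (cmod (eigvec i p))\<^sup>2)"
    by (rule Cauchy_Schwarz_ineq_sum)
  also have "\<dots> \<le> b.sq f * (\<Sum>i<n. (cmod (eigvec i p))\<^sup>2)"
    by (intro mult_right_mono b.Bessel orthonormal_eigvec f sum_nonneg) simp
  finally show ?thesis .
qed

end

lemma has_dimension_unique: "has_dimension S m \<Longrightarrow> has_dimension S n \<Longrightarrow> m = n"
  unfolding has_dimension_def by (metis cfun.dim_unique cfun.span_superset order_refl)

text \<open>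
  A non-decreasing sequence is determined by how often it takes each value, since these numbers give
  the sizes of its sublevel sets. Finiteness of the sublevel sets passes from \<open>x\<close> to \<open>y\<close>.
\<close>

lemma mono_nat_sequence_unique:
  fixes x y :: "nat \<Rightarrow> real"
  assumes x: "mono_on {1..} x" and y: "mono_on {1..} y"
    and fin: "\<And>\<mu>. finite {n \<in> {1..}. x n \<le> \<mu>}" "\<And>\<mu>. finite {n \<in> {1..}. y n = \<mu>}"
    and count: "\<And>\<mu>. card {n \<in> {1..}. x n = \<mu>} = card {n \<in> {1..}. y n = \<mu>}"
    and n: "1 \<le> n"
  shows "x n = y n"
proof -
  define X where "X \<mu> = {n \<in> {1..}. x n \<le> \<mu>}" for \<mu>
  define Y where "Y \<mu> = {n \<in> {1..}. y n \<le> \<mu>}" for \<mu>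
  have fx: "finite {n \<in> {1..}. x n = \<mu>}" for \<mu>
    by (rule finite_subset[OF _ fin(1)[of \<mu>]]) auto
  have XY: "finite (Y \<mu>) \<and> card (X \<mu>) = card (Y \<mu>)" for \<mu>
  proof -
    have fX: "finite (X \<mu>)" unfolding X_def by (rule fin)
    have X: "X \<mu> = (\<Union>\<nu>\<in>x ` X \<mu>. {n \<in> {1..}. x n = \<nu>})" by (auto simp: X_def)
    have Y: "Y \<mu> = (\<Union>\<nu>\<in>x ` X \<mu>. {n \<in> {1..}. y n = \<nu>})"
    proof -
      have "y n \<in> x ` X \<mu>" if "n \<ge> 1" "y n \<le> \<mu>" for n
      proof -
        have "{m \<in> {1..}. y m = y n} \<noteq> {}" using that by auto
        then have "{m \<in> {1..}. x m = y n} \<noteq> {}"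
          using count[of "y n"] fin(2)[of "y n"] by (metis card.empty card_0_eq)
        then show ?thesis using that by (force simp: X_def)
      qed
      then show ?thesis by (auto simp: Y_def X_def)
    qed
    have "card (X \<mu>) = (\<Sum>\<nu>\<in>x ` X \<mu>. card {n \<in> {1..}. x n = \<nu>})"
      by (subst X, rule card_UN_disjoint) (use fX fx in auto)
    also have "\<dots> = (\<Sum>\<nu>\<in>x ` X \<mu>. card {n \<in> {1..}. y n = \<nu>})" by (simp only: count)
    also have "\<dots> = card (Y \<mu>)"
      by (subst Y, rule card_UN_disjoint[symmetric]) (use fX fin in auto)
    moreover have "finite (Y \<mu>)" by (subst Y) (use fX fin in auto)
    ultimately show ?thesis by simp
  qed
  \<comment> \<open>Both sublevel sets are initial segments, and they have the same size.\<close>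
  have seg: "A = {1..card A}" if "finite A" "A \<subseteq> {1..}" "\<And>m k. m \<in> A \<Longrightarrow> 1 \<le> k \<Longrightarrow> k \<le> m \<Longrightarrow> k \<in> A"
    for A :: "nat set"
  proof (cases "A = {}")
    case False
    have "A = {1..Max A}"
    proof (intro equalityI subsetI)
      fix m assume "m \<in> A"
      then show "m \<in> {1..Max A}" using that(1,2) by (auto intro: Max_ge)
    next
      fix m assume "m \<in> {1..Max A}"
      then show "m \<in> A" using that(3)[OF Max_in[OF that(1) False], of m] by simp
    qed
    then have "card A = Max A" by (metis card_atLeastAtMost diff_Suc_1)
    then show ?thesis using \<open>A = {1..Max A}\<close> by simp
  qed simp
  have Xseg: "X \<mu> = {1..card (X \<mu>)}" for \<mu>
  proof (rule seg)
    show "finite (X \<mu>)" unfolding X_def by (rule fin)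
    show "k \<in> X \<mu>" if "m \<in> X \<mu>" "1 \<le> k" "k \<le> m" for m k
      using mono_onD[OF x, of k m] that by (simp add: X_def)
  qed (auto simp: X_def)
  have Yseg: "Y \<mu> = {1..card (Y \<mu>)}" for \<mu>
  proof (rule seg)
    show "finite (Y \<mu>)" using XY by blast
    show "k \<in> Y \<mu>" if "m \<in> Y \<mu>" "1 \<le> k" "k \<le> m" for m k
      using mono_onD[OF y, of k m] that by (simp add: Y_def)
  qed (auto simp: Y_def)
  have "X \<mu> = Y \<mu>" for \<mu>
    by (subst Xseg, subst Yseg) (simp add: XY)
  then have "x n \<le> \<mu> \<longleftrightarrow> y n \<le> \<mu>" for \<mu> using n by (auto simp: X_def Y_def set_eq_iff)
  from this[of "x n"] this[of "y n"] show ?thesis by simp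
qed

section \<open>Square-integrable functions on an interval\<close>

abbreviation leb :: "real \<Rightarrow> real measure" where
  "leb l \<equiv> lebesgue_on {0<..<l}"

abbreviation sqnorm :: "real \<Rightarrow> (real \<Rightarrow> complex) \<Rightarrow> real" where
  "sqnorm l h \<equiv> LINT x|leb l. (cmod (h x))\<^sup>2"

lemma borel_measurable_cnj [measurable (raw)]:
  "f \<in> borel_measurable M \<Longrightarrow> (\<lambda>x. cnj (f x)) \<in> borel_measurable M"
  by (rule measurable_compose[of f M borel cnj]) (auto intro!: borel_measurable_continuous_onI continuous_intros)

lemma cmod_add_square_le: "(cmod (z + w))\<^sup>2 \<le> 2 * (cmod z)\<^sup>2 + 2 * (cmod w)\<^sup>2"
proof -
  have "(cmod (z + w))\<^sup>2 \<le> (cmod z + cmod w)\<^sup>2"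
    by (intro power_mono norm_triangle_ineq) simp
  also have "\<dots> \<le> 2 * (cmod z)\<^sup>2 + 2 * (cmod w)\<^sup>2"
    using sum_squares_bound[of "cmod z" "cmod w"] by (simp add: power2_sum)
  finally show ?thesis .
qed

lemma L2_onI: "f \<in> borel_measurable (lebesgue_on I) \<Longrightarrow> integrable (lebesgue_on I) (\<lambda>x. (cmod (f x))\<^sup>2) \<Longrightarrow> f \<in> L2_on I"
  by (simp add: L2_on_def)

lemma L2_on_measurable: "f \<in> L2_on I \<Longrightarrow> f \<in> borel_measurable (lebesgue_on I)"
  by (simp add: L2_on_def)

lemma L2_on_square: "f \<in> L2_on I \<Longrightarrow> integrable (lebesgue_on I) (\<lambda>x. (cmod (f x))\<^sup>2)"
  by (simp add: L2_on_def)

lemma L2_on_mult_integrable: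
  assumes f: "f \<in> L2_on I" and g: "g \<in> L2_on I"
  shows "integrable (lebesgue_on I) (\<lambda>x. f x * cnj (g x))"
proof (rule Bochner_Integration.integrable_bound)
  show "integrable (lebesgue_on I) (\<lambda>x. (cmod (f x))\<^sup>2 + (cmod (g x))\<^sup>2)"
    by (intro Bochner_Integration.integrable_add L2_on_square f g)
  show "(\<lambda>x. f x * cnj (g x)) \<in> borel_measurable (lebesgue_on I)"
    using L2_on_measurable[OF f] L2_on_measurable[OF g] by measurable
  have "cmod (f x) * cmod (g x) \<le> (cmod (f x))\<^sup>2 + (cmod (g x))\<^sup>2" for x
    using sum_squares_bound[of "cmod (f x)" "cmod (g x)"] mult_nonneg_nonneg[OF norm_ge_zero[of "f x"] norm_ge_zero[of "g x"]]
    unfolding mult.assoc by linarith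
  then show "AE x in lebesgue_on I. norm (f x * cnj (g x)) \<le> norm ((cmod (f x))\<^sup>2 + (cmod (g x))\<^sup>2)"
    by (auto simp: norm_mult)
qed

lemma L2_on_add:
  assumes f: "f \<in> L2_on I" and g: "g \<in> L2_on I"
  shows "(\<lambda>x. f x + g x) \<in> L2_on I"
proof (rule L2_onI)
  show m: "(\<lambda>x. f x + g x) \<in> borel_measurable (lebesgue_on I)"
    using L2_on_measurable[OF f] L2_on_measurable[OF g] by measurable
  show "integrable (lebesgue_on I) (\<lambda>x. (cmod (f x + g x))\<^sup>2)"
  proof (rule Bochner_Integration.integrable_bound)
    show "integrable (lebesgue_on I) (\<lambda>x. 2 * (cmod (f x))\<^sup>2 + 2 * (cmod (g x))\<^sup>2)"
      using L2_on_square[OF f] L2_on_square[OF g] by simp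
    show "(\<lambda>x. (cmod (f x + g x))\<^sup>2) \<in> borel_measurable (lebesgue_on I)"
      using m by measurable
    have "(cmod (f x + g x))\<^sup>2 \<le> 2 * (cmod (f x))\<^sup>2 + 2 * (cmod (g x))\<^sup>2" for x
      by (rule cmod_add_square_le)
    then show "AE x in lebesgue_on I. norm ((cmod (f x + g x))\<^sup>2) \<le> norm (2 * (cmod (f x))\<^sup>2 + 2 * (cmod (g x))\<^sup>2)"
      by auto
  qed
qed

lemma L2_on_scale:
  assumes f: "f \<in> L2_on I"
  shows "(\<lambda>x. c * f x) \<in> L2_on I"
  using L2_on_measurable[OF f] L2_on_square[OF f]
  by (intro L2_onI) (auto simp: norm_mult power_mult_distrib)

lemma L2_on_diff: "f \<in> L2_on I \<Longrightarrow> g \<in> L2_on I \<Longrightarrow> (\<lambda>x. f x - g x) \<in> L2_on I"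
  using L2_on_add[OF _ L2_on_scale[of g I "-1"], of f] by simp

lemma finite_measure_lebesgue_on_interval: "finite_measure (lebesgue_on {0<..<l :: real})"
  by (rule finite_measure_lebesgue_on) simp

lemma L2_on_bounded:
  assumes "f \<in> borel_measurable (leb l)" and B: "\<And>x. x \<in> {0<..<l} \<Longrightarrow> cmod (f x) \<le> B"
  shows "f \<in> L2_on {0<..<l :: real}"
proof (rule L2_onI)
  interpret finite_measure "leb l" by (rule finite_measure_lebesgue_on_interval)
  show "integrable (leb l) (\<lambda>x. (cmod (f x))\<^sup>2)"
  proof (rule integrable_const_bound)
    have "(cmod (f x))\<^sup>2 \<le> B\<^sup>2" if "x \<in> {0<..<l}" for x
      using B[OF that] by (intro power_mono) auto
    then show "AE x in leb l. norm ((cmod (f x))\<^sup>2) \<le> B\<^sup>2"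
      by (intro AE_I2) (auto simp: space_restrict_space)
  qed (use assms(1) in measurable)
qed fact

lemma continuous_on_L2_on:
  assumes f: "continuous_on {0..l} f"
  shows "f \<in> L2_on {0<..<l :: real}"
proof -
  obtain B where "\<forall>x\<in>{0..l}. norm (f x) \<le> B"
    using compact_imp_bounded[OF compact_continuous_image[OF f compact_Icc]] by (auto simp: bounded_iff)
  moreover have "f \<in> borel_measurable (leb l)"
    by (rule continuous_imp_measurable_on_sets_lebesgue) (auto intro: continuous_on_subset[OF f])
  ultimately show ?thesis by (intro L2_on_bounded[of f l B]) auto
qed

lemma L2_on_integrable:
  assumes "f \<in> L2_on {0<..<l :: real}"
  shows "integrable (leb l) f"
proof -
  have "(\<lambda>x. 1) \<in> L2_on {0<..<l}" by (rule continuous_on_L2_on) (rule continuous_on_const)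
  from L2_on_mult_integrable[OF assms this] show ?thesis by simp
qed

lemma LINT_mult_cnj_self:
  "(LINT x|M. h x * cnj (h x)) = complex_of_real (LINT x|M. (cmod (h x))\<^sup>2)"
  unfolding complex_norm_square[symmetric] by (rule integral_complex_of_real)

lemma L2_on_cong:
  assumes "\<And>x. x \<in> {0<..<l} \<Longrightarrow> f x = f' x"
  shows "f \<in> L2_on {0<..<l :: real} \<longleftrightarrow> f' \<in> L2_on {0<..<l}"
proof -
  have "f \<in> borel_measurable (leb l) \<longleftrightarrow> f' \<in> borel_measurable (leb l)"
    by (rule measurable_cong) (use assms in \<open>auto simp: space_restrict_space\<close>)
  moreover have "integrable (leb l) (\<lambda>x. (cmod (f x))\<^sup>2) \<longleftrightarrow>
      integrable (leb l) (\<lambda>x. (cmod (f' x))\<^sup>2)"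
    by (rule Bochner_Integration.integrable_cong) (use assms in \<open>auto simp: space_restrict_space\<close>)
  ultimately show ?thesis by (simp add: L2_on_def)
qed

lemma hermitian_form_L2: "hermitian_form (L2_on I) (\<lambda>f g. LINT x|lebesgue_on I. f x * cnj (g x))"
proof
  show "cfun.subspace (L2_on I)"
    unfolding cfun.subspace_def
    by (auto simp: zero_fun_def plus_fun_def intro: L2_on_add L2_on_scale intro!: L2_onI[of "\<lambda>_. 0"])
next
  fix f g h :: "real \<Rightarrow> complex" and c :: complex
  assume f: "f \<in> L2_on I" and h: "h \<in> L2_on I"
  show "(LINT x|lebesgue_on I. c * f x * cnj (h x)) = c * (LINT x|lebesgue_on I. f x * cnj (h x))"
    by (simp add: mult.assoc)
  assume g: "g \<in> L2_on I"
  show "(LINT x|lebesgue_on I. (f + g) x * cnj (h x)) =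
      (LINT x|lebesgue_on I. f x * cnj (h x)) + (LINT x|lebesgue_on I. g x * cnj (h x))"
    using L2_on_mult_integrable[OF f h] L2_on_mult_integrable[OF g h] by (simp add: distrib_right)
next
  fix f g :: "real \<Rightarrow> complex"
  assume "f \<in> L2_on I" "g \<in> L2_on I"
  then have "integrable (lebesgue_on I) (\<lambda>x. f x * cnj (g x))" by (rule L2_on_mult_integrable)
  then have "(LINT x|lebesgue_on I. cnj (f x * cnj (g x))) = cnj (LINT x|lebesgue_on I. f x * cnj (g x))"
    by (rule Bochner_Integration.integral_bounded_linear[OF bounded_linear_cnj])
  then show "(LINT x|lebesgue_on I. g x * cnj (f x)) = cnj (LINT x|lebesgue_on I. f x * cnj (g x))"
    by (simp add: mult.commute)
next
  fix f :: "real \<Rightarrow> complex"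
  show "0 \<le> Re (LINT x|lebesgue_on I. f x * cnj (f x))"
    unfolding LINT_mult_cnj_self by simp
qed

interpretation L2: hermitian_form "L2_on I" "\<lambda>f g. LINT x|lebesgue_on I. f x * cnj (g x)" for I
  by (rule hermitian_form_L2)

lemma L2_sq: "L2.sq I f = (LINT x|lebesgue_on I. (cmod (f x))\<^sup>2)"
  unfolding L2.sq_def LINT_mult_cnj_self by simp

lemma L2_inner_cong_AE:
  assumes "f \<in> L2_on I" "f' \<in> L2_on I" "h \<in> L2_on I" and AE: "AE x in lebesgue_on I. f x = f' x"
  shows "(LINT x|lebesgue_on I. f x * cnj (h x)) = (LINT x|lebesgue_on I. f' x * cnj (h x))"
proof (rule integral_cong_AE)
  show "AE x in lebesgue_on I. f x * cnj (h x) = f' x * cnj (h x)" using AE by eventually_elim simp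
qed (auto intro!: borel_measurable_integrable L2_on_mult_integrable assms)

lemma uniform_limit_sqnorm:
  assumes l: "0 < l" and f: "\<And>n. continuous_on {0..l} (f n)" and lim: "uniform_limit {0..l} f F sequentially"
  shows "(\<lambda>n. sqnorm l (\<lambda>x. f n x - F x)) \<longlonglongrightarrow> 0"
  unfolding LIMSEQ_def
proof (intro allI impI)
  fix \<epsilon> :: real assume "\<epsilon> > 0"
  interpret finite_measure "leb l" by (rule finite_measure_lebesgue_on_interval)
  define \<eta> where "\<eta> = sqrt (\<epsilon> / (2 * l))"
  have \<eta>: "\<eta> > 0" "\<eta>\<^sup>2 * l = \<epsilon> / 2" using l \<open>\<epsilon> > 0\<close> by (simp_all add: \<eta>_def)
  have F: "continuous_on {0..l} F" by (rule uniform_limit_theorem[OF _ lim]) (use f in auto)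
  obtain N where N: "\<And>n x. n \<ge> N \<Longrightarrow> x \<in> {0..l} \<Longrightarrow> cmod (f n x - F x) < \<eta>"
    using lim \<eta>(1) unfolding uniform_limit_iff eventually_sequentially dist_norm by meson
  have "dist (sqnorm l (\<lambda>x. f n x - F x)) 0 < \<epsilon>" if "n \<ge> N" for n
  proof -
    have "sqnorm l (\<lambda>x. f n x - F x) \<le> (LINT x|leb l. \<eta>\<^sup>2)"
      using N[OF that] f F
      by (intro integral_mono L2_on_square continuous_on_L2_on continuous_on_diff integrable_const power_mono)
        (auto simp: space_restrict_space less_imp_le)
    also have "\<dots> = \<eta>\<^sup>2 * l" using l by (simp add: measure_restrict_space)
    finally have up: "sqnorm l (\<lambda>x. f n x - F x) \<le> \<epsilon> / 2" unfolding \<eta>(2) .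
    have "0 \<le> sqnorm l (\<lambda>x. f n x - F x)" by (simp add: integral_nonneg_AE)
    then show ?thesis using up \<open>\<epsilon> > 0\<close> by simp
  qed
  then show "\<exists>N. \<forall>n\<ge>N. dist (sqnorm l (\<lambda>x. f n x - F x)) 0 < \<epsilon>" by blast
qed

text \<open>
  A rapidly Cauchy subsequence converges almost everywhere because its increments are summable in
  \<open>L\<^sup>1\<close>. Fatou's lemma then bounds the distance to the limit.
\<close>

lemma Riesz_Fischer:
  fixes f :: "nat \<Rightarrow> real \<Rightarrow> complex"
  assumes f: "\<And>n. f n \<in> L2_on {0<..<l}"
    and cauchy: "\<And>\<epsilon>. \<epsilon> > 0 \<Longrightarrow> \<exists>N. \<forall>m\<ge>N. \<forall>n\<ge>N. L2.sq {0<..<l} (f m - f n) < \<epsilon>"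
  shows "\<exists>g\<in>L2_on {0<..<l}. (\<lambda>n. L2.sq {0<..<l} (f n - g)) \<longlonglongrightarrow> 0"
proof -
  define M where "M = leb l"
  interpret finite_measure M unfolding M_def by (rule finite_measure_lebesgue_on_interval)
  \<comment> \<open>Adding \<open>1\<close> keeps \<open>c\<close> positive for an empty interval.\<close>
  define c where "c = measure M (space M) + 1"
  have c: "c > 0" by (simp add: c_def add_nonneg_pos)
  have fm[measurable]: "f n \<in> borel_measurable M" for n
    using L2_on_measurable[OF f] by (simp add: M_def)
  have dL2: "f m - f n \<in> L2_on {0<..<l}" for m n by (intro L2.mem_diff f)
  have L1: "(LINT x|M. cmod (f m x - f n x))\<^sup>2 \<le> L2.sq {0<..<l} (f m - f n) * c" for m n
  proof -
    let ?d = "\<lambda>x. complex_of_real (cmod (f m x - f n x))"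
    have d: "?d \<in> L2_on {0<..<l}"
    proof (rule L2_onI)
      show "?d \<in> borel_measurable (leb l)" unfolding M_def[symmetric] by measurable
      show "integrable (leb l) (\<lambda>x. (cmod (?d x))\<^sup>2)"
        using L2_on_square[OF dL2[of m n]] by simp
    qed
    have one: "(\<lambda>x. 1) \<in> L2_on {0<..<l}" by (rule continuous_on_L2_on) (rule continuous_on_const)
    have "(cmod (LINT x|M. ?d x * cnj 1))\<^sup>2 \<le> L2.sq {0<..<l} ?d * L2.sq {0<..<l} (\<lambda>x. 1)"
      unfolding M_def by (rule L2.Cauchy_Schwarz[OF d one])
    also have "L2.sq {0<..<l} ?d = L2.sq {0<..<l} (f m - f n)" by (simp add: L2_sq)
    also have "L2.sq {0<..<l} (f m - f n) * L2.sq {0<..<l} (\<lambda>x. 1) \<le> L2.sq {0<..<l} (f m - f n) * c"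
      by (intro mult_left_mono L2.sq_nonneg dL2) (simp add: L2_sq c_def M_def)
    also have "cmod (LINT x|M. ?d x * cnj 1) = (LINT x|M. cmod (f m x - f n x))"
      by (simp add: integral_nonneg_AE)
    finally show ?thesis .
  qed
  have "\<forall>k. \<exists>N. \<forall>m\<ge>N. \<forall>n\<ge>N. L2.sq {0<..<l} (f m - f n) < (1/4)^k"
    by (intro allI cauchy) simp
  from choice[OF this] obtain N
    where N: "\<And>k m n. m \<ge> N k \<Longrightarrow> n \<ge> N k \<Longrightarrow> L2.sq {0<..<l} (f m - f n) < (1/4)^k" by blast
  \<comment> \<open>The indices \<open>r k\<close> dominate both \<open>N k\<close> and \<open>k\<close>, and increase.\<close>
  define r where "r k = (\<Sum>i\<le>k. N i) + k" for k
  have rN: "N k \<le> r k" for k unfolding r_def by (meson atMost_iff finite_atMost member_le_sum order_refl trans_le_add1 zero_le)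
  have rmono: "r k \<le> r (Suc k)" for k by (simp add: r_def)
  have rk: "k \<le> r k" for k by (simp add: r_def)
  define d where "d k x = cmod (f (r (Suc k)) x - f (r k) x)" for k x
  have dm[measurable]: "d k \<in> borel_measurable M" for k unfolding d_def[abs_def] by measurable
  have dint: "integrable M (d k)" for k
    unfolding d_def[abs_def] M_def using integrable_norm[OF L2_on_integrable[OF dL2[of "r (Suc k)" "r k"]]] by (simp add: fun_diff_def)
  have dbound: "(LINT x|M. d k x) \<le> sqrt c * (1/2)^k" for k
  proof -
    have "L2.sq {0<..<l} (f (r (Suc k)) - f (r k)) < (1/4)^k"
      by (rule N) (use rN[of k] rmono[of k] in auto)
    then have "(LINT x|M. d k x)\<^sup>2 \<le> (1/4)^k * c"
      using L1[of "r (Suc k)" "r k"] c unfolding d_def by (meson less_imp_le mult_right_mono order_trans)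
    also have "\<dots> = (sqrt c * (1/2)^k)\<^sup>2"
    proof -
      have "((1/2 :: real)^k)\<^sup>2 = (1/4)^k" by (simp add: power2_eq_square flip: power_mult_distrib)
      then show ?thesis using c by (simp add: power_mult_distrib)
    qed
    finally show ?thesis by (rule power2_le_imp_le) (use c in simp)
  qed
  have AE_conv: "AE x in M. summable (\<lambda>k. d k x)"
  proof -
    have "(\<integral>\<^sup>+x. (\<Sum>k. ennreal (d k x)) \<partial>M) = (\<Sum>k. \<integral>\<^sup>+x. ennreal (d k x) \<partial>M)"
      by (rule nn_integral_suminf) measurable
    also have "\<dots> = (\<Sum>k. ennreal (LINT x|M. d k x))"
      by (intro suminf_cong nn_integral_eq_integral dint) (simp add: d_def)
    also have "\<dots> \<le> (\<Sum>k. ennreal (sqrt c * (1/2)^k))"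
      by (intro suminf_le ennreal_leI dbound) auto
    also have "\<dots> = ennreal (\<Sum>k. sqrt c * (1/2)^k)"
      by (rule suminf_ennreal2) (use c in \<open>auto intro!: summable_mult summable_geometric\<close>)
    also have "\<dots> < \<infinity>" by simp
    finally have "AE x in M. (\<Sum>k. ennreal (d k x)) \<noteq> \<infinity>"
      by (intro nn_integral_PInf_AE) (auto simp: top.not_eq_extremum)
    then show ?thesis
      by eventually_elim (auto intro!: summable_suminf_not_top simp: d_def)
  qed
  define g where "g x = lim (\<lambda>k. f (r k) x)" for x
  have gm[measurable]: "g \<in> borel_measurable M"
    unfolding g_def[abs_def] by (rule borel_measurable_lim_metric) (rule fm)
  have AE_lim: "AE x in M. (\<lambda>k. f (r k) x) \<longlonglongrightarrow> g x"
    using AE_conv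
  proof eventually_elim
    case (elim x)
    have "summable (\<lambda>k. f (r (Suc k)) x - f (r k) x)"
      by (rule summable_norm_cancel) (use elim in \<open>simp add: d_def\<close>)
    then have "convergent (\<lambda>n. \<Sum>k<n. f (r (Suc k)) x - f (r k) x)"
      by (simp add: summable_iff_convergent)
    then have "convergent (\<lambda>n. f (r n) x - f (r 0) x)"
      using sum_lessThan_telescope[of "\<lambda>k. f (r k) x"] by simp
    then have "convergent (\<lambda>n. (f (r n) x - f (r 0) x) + f (r 0) x)"
      by (intro convergent_add convergent_const)
    then show ?case by (simp add: convergent_LIMSEQ_iff g_def)
  qed
  have Fatou: "(\<integral>\<^sup>+x. ennreal ((cmod (f n x - g x))\<^sup>2) \<partial>M) \<le> ennreal \<epsilon>"
    if n: "\<And>m. m \<ge> n0 \<Longrightarrow> L2.sq {0<..<l} (f n - f m) \<le> \<epsilon>" for n n0 \<epsilon>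
  proof -
    have "(\<integral>\<^sup>+x. ennreal ((cmod (f n x - g x))\<^sup>2) \<partial>M)
        = (\<integral>\<^sup>+x. liminf (\<lambda>k. ennreal ((cmod (f n x - f (r k) x))\<^sup>2)) \<partial>M)"
    proof (rule nn_integral_cong_AE)
      show "AE x in M. ennreal ((cmod (f n x - g x))\<^sup>2) = liminf (\<lambda>k. ennreal ((cmod (f n x - f (r k) x))\<^sup>2))"
        using AE_lim
      proof eventually_elim
        case (elim x)
        have "(\<lambda>k. ennreal ((cmod (f n x - f (r k) x))\<^sup>2)) \<longlonglongrightarrow> ennreal ((cmod (f n x - g x))\<^sup>2)"
          by (intro tendsto_intros elim)
        then show ?case by (rule lim_imp_Liminf[OF trivial_limit_sequentially, symmetric])
      qed
    qed
    also have "\<dots> \<le> liminf (\<lambda>k. \<integral>\<^sup>+x. ennreal ((cmod (f n x - f (r k) x))\<^sup>2) \<partial>M)"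
      by (rule nn_integral_liminf) measurable
    also have "\<dots> = liminf (\<lambda>k. ennreal (L2.sq {0<..<l} (f n - f (r k))))"
      using L2_on_square[OF dL2] by (simp add: nn_integral_eq_integral L2_sq M_def)
    also have "\<dots> \<le> ennreal \<epsilon>"
    proof (rule Liminf_le)
      show "\<forall>\<^sub>F k in sequentially. ennreal (L2.sq {0<..<l} (f n - f (r k))) \<le> ennreal \<epsilon>"
        using eventually_ge_at_top[of n0]
        by eventually_elim (intro ennreal_leI n, use rk order_trans in blast)
    qed simp
    finally show ?thesis .
  qed
  have diffL2: "(\<lambda>x. f n x - g x) \<in> L2_on {0<..<l} \<and> L2.sq {0<..<l} (f n - g) \<le> \<epsilon>"
    if n: "\<And>m. m \<ge> n0 \<Longrightarrow> L2.sq {0<..<l} (f n - f m) \<le> \<epsilon>" for n n0 \<epsilon>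
  proof -
    have "0 \<le> \<epsilon>" using n[of n0] L2.sq_nonneg[OF dL2, of n n0] by simp
    have le: "(\<integral>\<^sup>+x. ennreal ((cmod (f n x - g x))\<^sup>2) \<partial>M) \<le> ennreal \<epsilon>"
      using n by (rule Fatou)
    then have int: "integrable M (\<lambda>x. (cmod (f n x - g x))\<^sup>2)"
      by (intro integrableI_bounded) (auto intro: le_less_trans)
    then have "ennreal (LINT x|M. (cmod (f n x - g x))\<^sup>2) \<le> ennreal \<epsilon>"
      using le by (simp add: nn_integral_eq_integral)
    then have "(LINT x|M. (cmod (f n x - g x))\<^sup>2) \<le> \<epsilon>"
      using \<open>0 \<le> \<epsilon>\<close> by simp
    moreover have "(LINT x|M. (cmod (f n x - g x))\<^sup>2) = L2.sq {0<..<l} (f n - g)"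
      by (simp add: L2_sq M_def)
    moreover have "(\<lambda>x. f n x - g x) \<in> L2_on {0<..<l}"
      by (rule L2_onI) (use int in \<open>simp_all add: M_def[symmetric]\<close>)
    ultimately show ?thesis by simp
  qed
  obtain n0 where "\<And>m n. m \<ge> n0 \<Longrightarrow> n \<ge> n0 \<Longrightarrow> L2.sq {0<..<l} (f m - f n) < 1"
    using cauchy[of 1] by auto
  then have "(\<lambda>x. f n0 x - g x) \<in> L2_on {0<..<l}"
    using diffL2[of n0 n0 1] by (simp add: less_imp_le)
  from L2_on_diff[OF f[of n0] this] have g: "g \<in> L2_on {0<..<l}" by simp
  moreover have "(\<lambda>n. L2.sq {0<..<l} (f n - g)) \<longlonglongrightarrow> 0"
    unfolding LIMSEQ_def
  proof (intro allI impI)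
    fix \<epsilon> :: real assume "\<epsilon> > 0"
    then obtain N where N: "\<And>m n. m \<ge> N \<Longrightarrow> n \<ge> N \<Longrightarrow> L2.sq {0<..<l} (f m - f n) < \<epsilon> / 2"
      using cauchy[of "\<epsilon> / 2"] by auto
    have "dist (L2.sq {0<..<l} (f n - g)) 0 < \<epsilon>" if "n \<ge> N" for n
    proof -
      have "L2.sq {0<..<l} (f n - g) \<le> \<epsilon> / 2"
        using diffL2[of N n "\<epsilon> / 2"] N[OF that] by (simp add: less_imp_le)
      then show ?thesis using \<open>\<epsilon> > 0\<close> L2.sq_nonneg[OF L2.mem_diff[OF f g], of n] by simp
    qed
    then show "\<exists>N. \<forall>n\<ge>N. dist (L2.sq {0<..<l} (f n - g)) 0 < \<epsilon>" by blast
  qed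
  ultimately show ?thesis by blast
qed

section \<open>Continuously differentiable steps and plateaus\<close>

text \<open>
  Squares of positive parts are continuously differentiable, so a quadratic spline is a step from \<open>0\<close>
  to \<open>1\<close> on \<open>[0, 1]\<close> whose derivative is an explicit tent.
\<close>

definition step :: "real \<Rightarrow> real" where
  "step t = 2 * (max 0 t)\<^sup>2 - 4 * (max 0 (t - 1/2))\<^sup>2 + 2 * (max 0 (t - 1))\<^sup>2"

definition step' :: "real \<Rightarrow> real" where
  "step' t = 4 * max 0 t - 8 * max 0 (t - 1/2) + 4 * max 0 (t - 1)"

lemma max0_square_derivative: "((\<lambda>t. (max 0 t)\<^sup>2) has_real_derivative 2 * max 0 t) (at t)"
proof -
  consider "t < 0" | "t = 0" | "t > 0" by linarith
  then show ?thesis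
  proof cases
    case 1
    have "((\<lambda>t. 0) has_real_derivative 2 * max 0 t) (at t)" using 1 by simp
    then show ?thesis
      by (rule has_field_derivative_transform_within_open[of _ _ _ "{..<0}"]) (use 1 in auto)
  next
    case 3
    have "((\<lambda>t. t\<^sup>2) has_real_derivative 2 * max 0 t) (at t)"
      using 3 by (auto intro!: derivative_eq_intros)
    then show ?thesis
      by (rule has_field_derivative_transform_within_open[of _ _ _ "{0<..}"]) (use 3 in auto)
  next
    case 2
    have "(\<lambda>h :: real. (max 0 h)\<^sup>2 / h) \<midarrow>0\<rightarrow> 0"
    proof (rule Lim_null_comparison)
      have "norm ((max 0 h)\<^sup>2 / h) \<le> \<bar>h\<bar>" for h :: real
        by (cases "h \<le> 0") (auto simp: power2_eq_square)
      then show "\<forall>\<^sub>F h in at 0. norm ((max 0 h)\<^sup>2 / h) \<le> \<bar>h :: real\<bar>" by (intro always_eventually) auto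
      show "((\<lambda>h :: real. \<bar>h\<bar>) \<longlongrightarrow> 0) (at 0)" by (rule tendsto_rabs_zero) (rule tendsto_ident_at)
    qed
    then show ?thesis using 2 by (simp add: DERIV_def)
  qed
qed

lemma max0_square_derivative_shift:
  "((\<lambda>t. (max 0 (t - c))\<^sup>2) has_real_derivative 2 * max 0 (t - c)) (at t)"
proof -
  have "((\<lambda>t. t - c) has_real_derivative 1) (at t)"
    by (auto intro!: derivative_eq_intros)
  from DERIV_chain2[where g = "\<lambda>t. t - c" and x = t, OF max0_square_derivative this] show ?thesis by simp
qed

lemma step_has_derivative: "(step has_real_derivative step' t) (at t)"
  using DERIV_add[OF DERIV_diff[OF DERIV_cmult[OF max0_square_derivative[of t], of 2]
      DERIV_cmult[OF max0_square_derivative_shift[of "1/2" t], of 4]]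
      DERIV_cmult[OF max0_square_derivative_shift[of 1 t], of 2]]
  unfolding step_def[abs_def] step'_def by simp

lemma step_le_0: "t \<le> 0 \<Longrightarrow> step t = 0"
  by (simp add: step_def)

lemma step_ge_1: "1 \<le> t \<Longrightarrow> step t = 1"
  by (simp add: step_def power2_eq_square algebra_simps)

lemma step'_nonneg: "0 \<le> step' t"
  by (simp add: step'_def max_def)

lemma step'_le: "step' t \<le> 2"
  by (simp add: step'_def max_def)

lemma step'_eq_0: "t \<le> 0 \<or> 1 \<le> t \<Longrightarrow> step' t = 0"
  by (auto simp: step'_def)

lemma continuous_step' [continuous_intros]: "continuous_on A step'"
  unfolding step'_def[abs_def] by (intro continuous_intros)

lemma step_mono: "s \<le> t \<Longrightarrow> step s \<le> step t"
  by (rule DERIV_nonneg_imp_nondecreasing) (use step_has_derivative step'_nonneg in blast)+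

lemma step_bounds: "0 \<le> step t" "step t \<le> 1"
  using step_mono[of "min t 0" t] step_le_0[of "min t 0"] step_mono[of t "max t 1"] step_ge_1[of "max t 1"]
  by auto

text \<open>
  This function rises from \<open>0\<close> to \<open>1\<close> on \<open>[\<alpha>, \<alpha> + \<epsilon>]\<close> and falls back on \<open>[\<beta>, \<beta> + \<epsilon>]\<close>. It serves
  as test function in the lemma of du Bois-Reymond, and with \<open>\<alpha> = \<beta> - \<epsilon>\<close> as bump around \<open>\<beta>\<close>.
\<close>

definition plateau :: "real \<Rightarrow> real \<Rightarrow> real \<Rightarrow> real \<Rightarrow> real" where
  "plateau \<alpha> \<beta> \<epsilon> t = step ((t - \<alpha>) / \<epsilon>) - step ((t - \<beta>) / \<epsilon>)"

definition plateau' :: "real \<Rightarrow> real \<Rightarrow> real \<Rightarrow> real \<Rightarrow> real" where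
  "plateau' \<alpha> \<beta> \<epsilon> t = step' ((t - \<alpha>) / \<epsilon>) / \<epsilon> - step' ((t - \<beta>) / \<epsilon>) / \<epsilon>"

lemma scaled_step_derivative:
  "((\<lambda>t. step ((t - \<alpha>) / \<epsilon>)) has_real_derivative step' ((t - \<alpha>) / \<epsilon>) / \<epsilon>) (at t)"
proof -
  have "((\<lambda>t. (t - \<alpha>) / \<epsilon>) has_real_derivative 1 / \<epsilon>) (at t)"
    by (cases "\<epsilon> = 0") (auto intro!: derivative_eq_intros)
  from DERIV_chain2[OF step_has_derivative this] show ?thesis by simp
qed

lemma plateau_has_derivative: "(plateau \<alpha> \<beta> \<epsilon> has_real_derivative plateau' \<alpha> \<beta> \<epsilon> t) (at t)"
  unfolding plateau_def[abs_def] plateau'_def by (intro DERIV_diff scaled_step_derivative)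

lemma continuous_scaled_step': "continuous_on A (\<lambda>t. step' ((t - \<alpha>) / \<epsilon>) / \<epsilon>)"
  unfolding divide_inverse
  by (intro continuous_intros continuous_on_compose2[OF continuous_step'[of UNIV]]) auto

lemma continuous_plateau': "continuous_on A (plateau' \<alpha> \<beta> \<epsilon>)"
  unfolding plateau'_def[abs_def] by (intro continuous_intros continuous_scaled_step')

lemma continuous_plateau: "continuous_on A (plateau \<alpha> \<beta> \<epsilon>)"
  using plateau_has_derivative by (meson DERIV_isCont continuous_at_imp_continuous_on)

lemma plateau_C1: "plateau \<alpha> \<beta> \<epsilon> C1_differentiable_on UNIV"
  unfolding C1_differentiable_on_def has_real_derivative_iff_has_vector_derivative[symmetric]
  by (intro exI[of _ "plateau' \<alpha> \<beta> \<epsilon>"] conjI ballI plateau_has_derivative continuous_plateau')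

lemma plateau_outside:
  assumes "0 < \<epsilon>" "\<alpha> \<le> \<beta>" "t \<le> \<alpha> \<or> \<beta> + \<epsilon> \<le> t"
  shows "plateau \<alpha> \<beta> \<epsilon> t = 0"
proof (cases "t \<le> \<alpha>")
  case True
  then show ?thesis using assms by (simp add: plateau_def step_le_0 divide_le_0_iff)
next
  case False
  then have "1 \<le> (t - \<alpha>) / \<epsilon>" "1 \<le> (t - \<beta>) / \<epsilon>" using assms by (simp_all add: le_divide_eq)
  then show ?thesis by (simp add: plateau_def step_ge_1)
qed

lemma plateau_bounds:
  assumes "0 < \<epsilon>" "\<alpha> \<le> \<beta>"
  shows "0 \<le> plateau \<alpha> \<beta> \<epsilon> t" "plateau \<alpha> \<beta> \<epsilon> t \<le> 1"
proof -
  have "step ((t - \<beta>) / \<epsilon>) \<le> step ((t - \<alpha>) / \<epsilon>)"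
    by (intro step_mono divide_right_mono) (use assms in auto)
  then show "0 \<le> plateau \<alpha> \<beta> \<epsilon> t" by (simp add: plateau_def)
  show "plateau \<alpha> \<beta> \<epsilon> t \<le> 1"
    using step_bounds[of "(t - \<alpha>) / \<epsilon>"] step_bounds[of "(t - \<beta>) / \<epsilon>"] by (simp add: plateau_def)
qed

lemma plateau_eq_1: "0 < \<epsilon> \<Longrightarrow> \<alpha> + \<epsilon> \<le> t \<Longrightarrow> t \<le> \<beta> \<Longrightarrow> plateau \<alpha> \<beta> \<epsilon> t = 1"
  by (simp add: plateau_def step_ge_1 step_le_0 divide_le_0_iff le_divide_eq)

lemma plateau'_bound:
  assumes "0 < \<epsilon>"
  shows "\<bar>plateau' \<alpha> \<beta> \<epsilon> t\<bar> \<le> 2 / \<epsilon>"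
proof -
  have "0 \<le> step' s / \<epsilon>" "step' s / \<epsilon> \<le> 2 / \<epsilon>" for s
    using assms step'_nonneg step'_le by (auto intro: divide_right_mono)
  from this[of "(t - \<alpha>) / \<epsilon>"] this[of "(t - \<beta>) / \<epsilon>"] show ?thesis
    unfolding plateau'_def by linarith
qed

lemma plateau_test_function:
  assumes "0 < \<epsilon>" "\<alpha> \<le> \<beta>" "0 < \<alpha>" "\<beta> + \<epsilon> < l"
  shows "plateau \<alpha> \<beta> \<epsilon> \<in> test_functions {0<..<l}"
proof -
  have "{t. plateau \<alpha> \<beta> \<epsilon> t \<noteq> 0} \<subseteq> {\<alpha>..\<beta> + \<epsilon>}"
    using plateau_outside[OF assms(1,2)] by (auto simp flip: not_less)
  then have sub: "closure {t. plateau \<alpha> \<beta> \<epsilon> t \<noteq> 0} \<subseteq> {\<alpha>..\<beta> + \<epsilon>}"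
    by (rule closure_minimal) simp
  then have "compact (closure {t. plateau \<alpha> \<beta> \<epsilon> t \<noteq> 0})"
    by (metis closed_closure compact_Icc compact_Int_closed inf.absorb_iff2)
  then show ?thesis
    using sub assms by (auto simp: test_functions_def plateau_C1)
qed

lemma deriv_plateau: "deriv (plateau \<alpha> \<beta> \<epsilon>) = plateau' \<alpha> \<beta> \<epsilon>"
  by (intro ext DERIV_imp_deriv plateau_has_derivative)

section \<open>Weak derivatives on an interval\<close>

lemma integrable_lebesgue_on_subinterval:
  fixes f :: "real \<Rightarrow> 'a :: euclidean_space"
  assumes f: "integrable (leb l) f" and "0 \<le> x" "y \<le> l"
  shows "f absolutely_integrable_on {x..y}"
proof -
  have "h integrable_on {x..y}" if "integrable (leb l) h" for h :: "real \<Rightarrow> 'b :: euclidean_space"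
  proof -
    have "h integrable_on {0..l}"
      using integrable_on_lebesgue_on[OF that] by (simp add: integrable_on_open_interval_real)
    then show ?thesis by (rule integrable_on_subinterval) (use assms in auto)
  qed
  from this[OF f] this[OF integrable_norm[OF f]] show ?thesis by (simp add: absolutely_integrable_on_def)
qed

lemma LINT_interval_eq_integral:
  fixes f :: "real \<Rightarrow> 'a :: euclidean_space"
  assumes f: "integrable (leb l) f"
  shows "(LINT x|leb l. f x) = integral {0..l} f"
  using lebesgue_integral_eq_integral[OF f] by (simp add: integral_open_interval_real)

lemma integrable_mult_continuous:
  fixes g :: "real \<Rightarrow> complex"
  assumes g: "integrable (leb l) g" and h: "continuous_on {0..l} h"
  shows "integrable (leb l) (\<lambda>x. g x * of_real (h x))"
proof -
  obtain B where B: "\<forall>x\<in>{0..l}. norm (h x) \<le> B"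
    using compact_imp_bounded[OF compact_continuous_image[OF h compact_Icc]] by (auto simp: bounded_iff)
  show ?thesis
  proof (rule Bochner_Integration.integrable_bound)
    show "integrable (leb l) (\<lambda>x. of_real B * g x)" using g by simp
    have "h \<in> borel_measurable (leb l)"
      by (rule continuous_imp_measurable_on_sets_lebesgue) (auto intro: continuous_on_subset[OF h])
    then show "(\<lambda>x. g x * of_real (h x)) \<in> borel_measurable (leb l)"
      using borel_measurable_integrable[OF g] by measurable
    have "norm (g x * of_real (h x)) \<le> norm (of_real B * g x)" if "x \<in> {0<..<l}" for x
    proof -
      have "\<bar>h x\<bar> \<le> \<bar>B\<bar>" using bspec[OF B, of x] that by simp
      then show ?thesis by (simp add: norm_mult mult.commute mult_right_mono)
    qed
    then show "AE x in leb l. norm (g x * of_real (h x)) \<le> norm (of_real B * g x)"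
      by (intro AE_I2) (auto simp: space_restrict_space)
  qed
qed

text \<open>
  Plateaus that get steeper converge boundedly to the indicator function of \<open>{x<..y}\<close>.
\<close>

lemma plateau_limit:
  fixes g :: "real \<Rightarrow> complex"
  assumes g: "integrable (leb l) g" and xy: "0 < x" "x \<le> y" "y < l"
  shows "(\<lambda>n. LINT t|leb l. g t * of_real (plateau x y ((l - y) / real (n + 2)) t))
    \<longlonglongrightarrow> integral {x..y} g"
proof -
  define \<epsilon> where "\<epsilon> n = (l - y) / real (n + 2)" for n
  have \<epsilon>0: "\<epsilon> n > 0" for n using xy by (simp add: \<epsilon>_def)
  have "(\<lambda>n. (l - y) * inverse (real (Suc (Suc n)))) \<longlonglongrightarrow> (l - y) * 0"
    by (intro tendsto_mult tendsto_const LIMSEQ_Suc[OF LIMSEQ_inverse_real_of_nat])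
  then have \<epsilon>: "\<epsilon> \<longlonglongrightarrow> 0" by (simp add: \<epsilon>_def[abs_def] divide_inverse add.commute)
  define h where "h t = (if t \<in> {x<..y} then g t else 0)" for t
  have meas: "h \<in> borel_measurable (leb l)"
  proof -
    have "{x<..y} \<in> sets (leb l)"
      by (subst sets_restrict_space_iff) (use xy in auto)
    then show ?thesis
      unfolding h_def[abs_def] using borel_measurable_integrable[OF g] by measurable
  qed
  have int: "integrable (leb l) h"
    by (rule Bochner_Integration.integrable_bound[OF g meas]) (auto simp: h_def)
  have "(\<lambda>n. LINT t|leb l. g t * of_real (plateau x y (\<epsilon> n) t))
    \<longlonglongrightarrow> (LINT t|leb l. h t)"
  proof (rule integral_dominated_convergence)
    show "integrable (leb l) (\<lambda>t. norm (g t))" using g by simp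
    show "(\<lambda>t. g t * of_real (plateau x y (\<epsilon> n) t)) \<in> borel_measurable (leb l)" for n
      by (rule borel_measurable_integrable[OF integrable_mult_continuous[OF g continuous_plateau]])
    show "AE t in leb l. norm (g t * of_real (plateau x y (\<epsilon> n) t)) \<le> norm (g t)" for n
      using plateau_bounds[OF \<epsilon>0 xy(2), of n]
      by (intro always_eventually allI) (auto simp: norm_mult intro!: mult_left_le)
    have "(\<lambda>n. g t * of_real (plateau x y (\<epsilon> n) t)) \<longlonglongrightarrow> h t" for t
    proof (rule tendsto_eventually)
      consider "t \<le> x" | "x < t" "t \<le> y" | "y < t" by linarith
      then show "\<forall>\<^sub>F n in sequentially. g t * of_real (plateau x y (\<epsilon> n) t) = h t"
      proof cases
        case 1
        then show ?thesis
          by (intro always_eventually allI) (simp add: plateau_outside[OF \<epsilon>0 xy(2)] h_def)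
      next
        case 2
        have "\<forall>\<^sub>F n in sequentially. \<epsilon> n < t - x"
          using order_tendstoD(2)[OF \<epsilon>, of "t - x"] 2 by simp
        then show ?thesis
          by eventually_elim (use 2 plateau_eq_1[OF \<epsilon>0] in \<open>simp add: h_def\<close>)
      next
        case 3
        have "\<forall>\<^sub>F n in sequentially. \<epsilon> n < t - y"
          using order_tendstoD(2)[OF \<epsilon>, of "t - y"] 3 by simp
        then show ?thesis
          by eventually_elim (use 3 plateau_outside[OF \<epsilon>0 xy(2)] in \<open>simp add: h_def\<close>)
      qed
    qed
    then show "AE t in leb l. (\<lambda>n. g t * of_real (plateau x y (\<epsilon> n) t)) \<longlonglongrightarrow> h t"
      by simp
  qed (rule meas)
  also have "(LINT t|leb l. h t) = integral {x<..y} g"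
  proof -
    have "(LINT t|leb l. h t) = integral {0..l} h"
      by (rule LINT_interval_eq_integral[OF int])
    also have "\<dots> = integral ({0..l} \<inter> {x<..y}) g"
      unfolding h_def[abs_def] by (subst integral_restrict_Int) (simp add: Int_commute)
    also have "{0..l} \<inter> {x<..y} = {x<..y}" using xy by auto
    finally show ?thesis .
  qed
  also have "integral {x<..y} g = integral {x..y} g"
    by (rule integral_subset_negligible) (auto intro: negligible_subset[of "{x}"])
  finally show ?thesis unfolding \<epsilon>_def .
qed

text \<open>
  The derivative of a steep step is a probability density on \<open>[x, x + \<epsilon>]\<close>.
\<close>

lemma scaled_step'_approximates_evaluation:
  fixes F :: "real \<Rightarrow> complex"
  assumes F: "continuous_on {0..l} F" and x: "0 < x" "0 < \<epsilon>" "x + \<epsilon> \<le> l"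
    and \<eta>: "\<And>t. x \<le> t \<Longrightarrow> t \<le> x + \<epsilon> \<Longrightarrow> cmod (F t - F x) \<le> \<eta>"
  shows "cmod ((LINT t|leb l. F t * of_real (step' ((t - x) / \<epsilon>) / \<epsilon>)) - F x) \<le> \<eta>"
proof -
  define \<psi> where "\<psi> t = step' ((t - x) / \<epsilon>) / \<epsilon>" for t
  have \<psi>c: "continuous_on A \<psi>" for A unfolding \<psi>_def[abs_def] by (rule continuous_scaled_step')
  have \<psi>0: "0 \<le> \<psi> t" for t using x step'_nonneg by (simp add: \<psi>_def)
  have \<psi>zero: "\<psi> t = 0" if "\<not> (x \<le> t \<and> t \<le> x + \<epsilon>)" for t
  proof -
    have "(t - x) / \<epsilon> \<le> 0 \<or> 1 \<le> (t - x) / \<epsilon>"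
      using that x by (auto simp: divide_le_0_iff le_divide_eq)
    then show ?thesis by (simp add: \<psi>_def step'_eq_0)
  qed
  have cint: "integrable (leb l) (\<lambda>t. c t * of_real (\<psi> t))" if "continuous_on {0..l} c" for c :: "real \<Rightarrow> complex"
    by (intro integrable_mult_continuous \<psi>c L2_on_integrable continuous_on_L2_on that)
  have rint: "integrable (leb l) \<psi>"
    using integrable_Re[OF cint[of "\<lambda>_. 1"]] by simp
  have one: "(LINT t|leb l. \<psi> t) = 1"
  proof -
    have "(\<psi> has_integral step ((l - x) / \<epsilon>) - step ((0 - x) / \<epsilon>)) {0..l}"
      unfolding \<psi>_def[abs_def] using x
      by (intro fundamental_theorem_of_calculus)
        (auto intro: has_field_derivative_at_within[OF scaled_step_derivative]
          simp: has_real_derivative_iff_has_vector_derivative[symmetric])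
    moreover have "step ((l - x) / \<epsilon>) = 1" "step ((0 - x) / \<epsilon>) = 0"
      using x by (auto intro!: step_ge_1 step_le_0 simp: le_divide_eq divide_le_0_iff)
    ultimately show ?thesis
      using LINT_interval_eq_integral[OF rint] by (simp add: integral_unique)
  qed
  have "(LINT t|leb l. of_real (\<psi> t)) = (1 :: complex)"
    using one by (simp add: integral_complex_of_real)
  then have "(LINT t|leb l. F t * of_real (\<psi> t)) - F x =
      (LINT t|leb l. F t * of_real (\<psi> t)) - (LINT t|leb l. F x * of_real (\<psi> t))"
    by simp
  also have "\<dots> = (LINT t|leb l. F t * of_real (\<psi> t) - F x * of_real (\<psi> t))"
    by (rule Bochner_Integration.integral_diff[symmetric]) (intro cint F continuous_on_const)+
  also have "cmod \<dots> \<le> (LINT t|leb l. cmod (F t * of_real (\<psi> t) - F x * of_real (\<psi> t)))"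
    by (rule integral_norm_bound)
  also have "\<dots> \<le> (LINT t|leb l. \<eta> * \<psi> t)"
  proof (rule integral_mono)
    show "integrable (leb l) (\<lambda>t. cmod (F t * of_real (\<psi> t) - F x * of_real (\<psi> t)))"
      by (intro integrable_norm Bochner_Integration.integrable_diff cint F continuous_on_const)
    show "integrable (leb l) (\<lambda>t. \<eta> * \<psi> t)" using rint by simp
    fix t
    show "cmod (F t * of_real (\<psi> t) - F x * of_real (\<psi> t)) \<le> \<eta> * \<psi> t"
    proof (cases "x \<le> t \<and> t \<le> x + \<epsilon>")
      case True
      have "cmod (F t * of_real (\<psi> t) - F x * of_real (\<psi> t)) = cmod (F t - F x) * \<psi> t"
        by (simp add: left_diff_distrib[symmetric] norm_mult \<psi>0)
      then show ?thesis using \<eta>[of t] True \<psi>0[of t] by (simp add: mult_right_mono)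
    qed (simp add: \<psi>zero)
  qed
  also have "\<dots> = \<eta>" using one by simp
  finally show ?thesis unfolding \<psi>_def .
qed

text \<open>
  The lemma of du Bois-Reymond: tested against a steep plateau, the derivative of which is close to the
  difference of the point masses at \<open>x\<close> and \<open>y\<close>, the weak derivative gives back the increment.
\<close>

lemma weak_derivative_FTC_interior:
  fixes F g :: "real \<Rightarrow> complex"
  assumes F: "continuous_on {0..l} F" and g: "g \<in> L2_on {0<..<l}" and w: "weak_derivative {0<..<l} F g"
    and xy: "0 < x" "x \<le> y" "y < l"
  shows "F y - F x = integral {x..y} g"
proof -
  define \<epsilon> where "\<epsilon> n = (l - y) / real (n + 2)" for n
  have \<epsilon>0: "\<epsilon> n > 0" for n using xy by (simp add: \<epsilon>_def)
  have \<epsilon>l: "y + \<epsilon> n < l" for n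
  proof -
    have "(l - y) / real (n + 2) < (l - y) / 1"
      by (rule divide_strict_left_mono) (use xy in auto)
    then show ?thesis by (simp add: \<epsilon>_def)
  qed
  have "(\<lambda>n. (l - y) * inverse (real (Suc (Suc n)))) \<longlonglongrightarrow> (l - y) * 0"
    by (intro tendsto_mult tendsto_const LIMSEQ_Suc[OF LIMSEQ_inverse_real_of_nat])
  then have \<epsilon>: "\<epsilon> \<longlonglongrightarrow> 0" by (simp add: \<epsilon>_def[abs_def] divide_inverse add.commute)
  define J where "J z n = (LINT t|leb l. F t * of_real (step' ((t - z) / \<epsilon> n) / \<epsilon> n))" for z n
  have J: "J z \<longlonglongrightarrow> F z" if z: "0 < z" "z \<le> y" for z
    unfolding LIMSEQ_def
  proof (intro allI impI)
    fix r :: real assume r: "r > 0"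
    have "continuous_on {0<..<l} F" by (rule continuous_on_subset[OF F]) auto
    then have "isCont F z" using z xy by (auto simp: continuous_on_eq_continuous_at)
    then obtain d where d: "d > 0" "\<And>t. dist t z < d \<Longrightarrow> dist (F t) (F z) < r / 2"
      unfolding continuous_at_eps_delta using half_gt_zero[OF r] by blast
    have "\<forall>\<^sub>F n in sequentially. \<epsilon> n < d" using order_tendstoD(2)[OF \<epsilon>] d(1) by simp
    then obtain N where N: "\<And>n. n \<ge> N \<Longrightarrow> \<epsilon> n < d" by (auto simp: eventually_sequentially)
    have "dist (J z n) (F z) < r" if "n \<ge> N" for n
    proof -
      have "cmod (J z n - F z) \<le> r / 2"
        unfolding J_def
      proof (rule scaled_step'_approximates_evaluation[OF F z(1) \<epsilon>0])
        show "z + \<epsilon> n \<le> l" using \<epsilon>l[of n] z by linarith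
        show "cmod (F t - F z) \<le> r / 2" if "z \<le> t" "t \<le> z + \<epsilon> n" for t
          using d(2)[of t] N[OF \<open>n \<ge> N\<close>] that by (simp add: dist_norm dist_real_def)
      qed
      then show ?thesis using r by (simp add: dist_norm)
    qed
    then show "\<exists>N. \<forall>n\<ge>N. dist (J z n) (F z) < r" by blast
  qed
  have eq: "J x n - J y n = - (LINT t|leb l. g t * of_real (plateau x y (\<epsilon> n) t))" for n
  proof -
    have "(LINT t|leb l. F t * of_real (plateau' x y (\<epsilon> n) t)) =
        - (LINT t|leb l. g t * of_real (plateau x y (\<epsilon> n) t))"
      using bspec[OF w[unfolded weak_derivative_def] plateau_test_function[OF \<epsilon>0 xy(2,1) \<epsilon>l, of n]]
      unfolding deriv_plateau .
    moreover have "(LINT t|leb l. F t * of_real (plateau' x y (\<epsilon> n) t)) = J x n - J y n"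
      unfolding J_def plateau'_def of_real_diff right_diff_distrib
      by (rule Bochner_Integration.integral_diff)
        (intro integrable_mult_continuous continuous_scaled_step' L2_on_integrable continuous_on_L2_on F)+
    ultimately show ?thesis by simp
  qed
  have "(\<lambda>n. - (J x n - J y n)) \<longlonglongrightarrow> - (F x - F y)"
    by (intro tendsto_intros J) (use xy in auto)
  moreover have "(\<lambda>n. - (J x n - J y n)) \<longlonglongrightarrow> integral {x..y} g"
    using plateau_limit[OF L2_on_integrable[OF g] xy] unfolding eq by (simp add: \<epsilon>_def)
  ultimately have "- (F x - F y) = integral {x..y} g" by (rule LIMSEQ_unique)
  then show ?thesis by simp
qed

lemma weak_derivative_FTC:
  fixes F g :: "real \<Rightarrow> complex"
  assumes F: "continuous_on {0..l} F" and g: "g \<in> L2_on {0<..<l}" and w: "weak_derivative {0<..<l} F g"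
    and xy: "0 \<le> x" "x \<le> y" "y \<le> l" and l: "0 < l"
  shows "F y - F x = integral {x..y} g"
proof -
  have gi: "g integrable_on {s..t}" if "0 \<le> s" "t \<le> l" for s t
    using integrable_lebesgue_on_subinterval[OF L2_on_integrable[OF g] that]
    by (rule set_lebesgue_integral_eq_integral(1))
  \<comment> \<open>\<open>H\<close> is constant in the interior, hence by continuity up to the end points.\<close>
  define H where "H t = F t - integral {0..t} g" for t
  have H: "continuous_on {0..l} H"
    unfolding H_def[abs_def] by (intro continuous_intros F indefinite_integral_continuous_1 gi) auto
  have "H t = H (l / 2)" if "t \<in> {0<..<l}" for t
  proof -
    have *: "H v = H u" if "0 < u" "u \<le> v" "v < l" for u v
    proof -
      have comb: "integral {0..u} g + integral {u..v} g = integral {0..v} g"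
        by (rule Henstock_Kurzweil_Integration.integral_combine) (use that gi in auto)
      have Fv: "F v = F u + integral {u..v} g"
        using weak_derivative_FTC_interior[OF F g w that] by (simp only: diff_eq_eq add.commute)
      show ?thesis unfolding H_def Fv comb[symmetric] by simp
    qed
    show ?thesis
    proof (cases "t \<le> l / 2")
      case True
      show ?thesis by (rule *[of t "l / 2", symmetric]) (use True that l in auto)
    next
      case False
      show ?thesis by (rule *[of "l / 2" t]) (use False that l in auto)
    qed
  qed
  then have const: "H t = H (l / 2)" if "t \<in> {0..l}" for t
    using continuous_constant_on_closure[of "{0<..<l}" H "H (l / 2)" t] H that l
    unfolding closure_greaterThanLessThan[OF l] by blast
  have "H x = H y" using const[of x] const[of y] xy by auto
  moreover have comb: "integral {0..x} g + integral {x..y} g = integral {0..y} g"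
    by (rule Henstock_Kurzweil_Integration.integral_combine) (use xy gi in auto)
  moreover have Fe: "F t = H t + integral {0..t} g" for t by (simp add: H_def)
  ultimately show ?thesis by (simp only: Fe[of x] Fe[of y] comb[symmetric]) simp
qed

text \<open>
  By Henstock's lemma the Riemann sums of \<open>|g|\<close> are close to the sums of \<open>|\<integral> g|\<close> over the pieces of the
  division, and those vanish. So \<open>|g|\<close> has integral zero.
\<close>

lemma AE_zero_of_interval_integrals:
  fixes g :: "real \<Rightarrow> complex"
  assumes g: "integrable (leb l) g" and l: "0 < l"
    and zero: "\<And>x y. 0 \<le> x \<Longrightarrow> x \<le> y \<Longrightarrow> y \<le> l \<Longrightarrow> integral {x..y} g = 0"
  shows "AE x in leb l. g x = 0"
proof -
  have gi: "g integrable_on cbox 0 l"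
    using integrable_lebesgue_on_subinterval[OF g, of 0 l] by (simp add: set_lebesgue_integral_eq_integral(1))
  have "((\<lambda>x. norm (g x)) has_integral 0) (cbox 0 l)"
    unfolding has_integral
  proof (intro allI impI)
    fix e :: real assume e: "e > 0"
    obtain \<gamma> where \<gamma>: "gauge \<gamma>"
      and small: "\<And>p. p tagged_partial_division_of (cbox 0 l) \<Longrightarrow> \<gamma> fine p \<Longrightarrow>
        (\<Sum>(x,k)\<in>p. norm (measure lborel k *\<^sub>R g x - integral k g)) < e"
      by (rule Henstock_lemma[OF gi e]) (rule that)
    show "\<exists>\<gamma>. gauge \<gamma> \<and> (\<forall>\<D>. \<D> tagged_division_of cbox 0 l \<and> \<gamma> fine \<D> \<longrightarrow>
        norm ((\<Sum>(x, k)\<in>\<D>. measure lborel k *\<^sub>R norm (g x)) - 0) < e)"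
    proof (intro exI conjI allI impI, rule \<gamma>, elim conjE)
      fix p assume p: "p tagged_division_of cbox 0 l" "\<gamma> fine p"
      have "measure lborel k *\<^sub>R norm (g x) = norm (measure lborel k *\<^sub>R g x - integral k g)"
        if xk: "(x, k) \<in> p" for x k
      proof -
        obtain u v where k: "k = cbox u v" using tagged_division_ofD(4)[OF p(1) xk] by blast
        have "x \<in> k" "k \<subseteq> cbox 0 l" using tagged_division_ofD(2,3)[OF p(1) xk] by auto
        then have "integral k g = 0" using zero[of u v] k by auto
        then show ?thesis by simp
      qed
      then have "(\<Sum>(x, k)\<in>p. measure lborel k *\<^sub>R norm (g x)) = (\<Sum>(x,k)\<in>p. norm (measure lborel k *\<^sub>R g x - integral k g))"
        by (intro sum.cong) auto
      moreover have "0 \<le> (\<Sum>(x, k)\<in>p. measure lborel k *\<^sub>R norm (g x))" by (intro sum_nonneg) auto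
      ultimately show "norm ((\<Sum>(x, k)\<in>p. measure lborel k *\<^sub>R norm (g x)) - 0) < e"
        using small[OF _ p(2)] p(1) by (simp add: tagged_division_of_def)
    qed
  qed
  then have "integral {0..l} (\<lambda>x. norm (g x)) = 0" by (simp add: integral_unique)
  then have "(LINT x|leb l. norm (g x)) = 0"
    by (simp only: LINT_interval_eq_integral[OF integrable_norm[OF g]])
  then have "AE x in leb l. norm (g x) = 0"
    by (subst (asm) integral_nonneg_eq_0_iff_AE[OF integrable_norm[OF g]]) auto
  then show ?thesis by simp
qed

lemma test_functionD:
  assumes "\<phi> \<in> test_functions I"
  shows "(\<phi> has_real_derivative deriv \<phi> x) (at x)" "continuous_on A (deriv \<phi>)" "continuous_on A \<phi>"
    "x \<notin> I \<Longrightarrow> \<phi> x = 0"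
proof -
  obtain D where D: "\<And>x. (\<phi> has_real_derivative D x) (at x)" "continuous_on UNIV D"
    using assms unfolding test_functions_def C1_differentiable_on_def
    by (auto simp: has_real_derivative_iff_has_vector_derivative)
  have "deriv \<phi> = D" by (intro ext DERIV_imp_deriv D)
  then show "(\<phi> has_real_derivative deriv \<phi> x) (at x)" "continuous_on A (deriv \<phi>)"
    using D(1) continuous_on_subset[OF D(2), of A] by auto
  show "continuous_on A \<phi>" by (intro continuous_at_imp_continuous_on ballI DERIV_isCont[OF D(1)])
  show "\<phi> x = 0" if "x \<notin> I"
  proof (rule ccontr)
    assume "\<phi> x \<noteq> 0"
    then have "x \<in> {x. \<phi> x \<noteq> 0}" by simp
    then have "x \<in> closure {x. \<phi> x \<noteq> 0}" by (rule subsetD[OF closure_subset])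
    then show False using assms that by (auto simp: test_functions_def)
  qed
qed

lemma continuous_real_L2_on: "continuous_on {0..l} \<phi> \<Longrightarrow> (\<lambda>x. of_real (\<phi> x)) \<in> L2_on {0<..<l}"
  by (rule continuous_on_L2_on) (rule continuous_on_of_real)

lemma weak_derivative_iff_L2_inner:
  "weak_derivative I f g \<longleftrightarrow> (\<forall>\<phi>\<in>test_functions I.
     (LINT x|lebesgue_on I. f x * cnj (of_real (deriv \<phi> x))) = - (LINT x|lebesgue_on I. g x * cnj (of_real (\<phi> x))))"
  by (simp add: weak_derivative_def)

lemma weak_derivative_add:
  assumes "f1 \<in> L2_on {0<..<l}" "g1 \<in> L2_on {0<..<l}" "f2 \<in> L2_on {0<..<l}" "g2 \<in> L2_on {0<..<l}"
    and w: "weak_derivative {0<..<l} f1 g1" "weak_derivative {0<..<l} f2 g2"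
  shows "weak_derivative {0<..<l} (\<lambda>x. f1 x + f2 x) (\<lambda>x. g1 x + g2 x)"
  unfolding weak_derivative_iff_L2_inner
proof
  fix \<phi> assume \<phi>: "\<phi> \<in> test_functions {0<..<l}"
  have c: "(\<lambda>x. of_real (\<phi> x)) \<in> L2_on {0<..<l}" "(\<lambda>x. of_real (deriv \<phi> x)) \<in> L2_on {0<..<l}"
    by (intro continuous_real_L2_on test_functionD[OF \<phi>])+
  show "(LINT x|leb l. (f1 x + f2 x) * cnj (of_real (deriv \<phi> x))) =
      - (LINT x|leb l. (g1 x + g2 x) * cnj (of_real (\<phi> x)))"
    using L2.add_left[OF assms(1,3) c(2)] L2.add_left[OF assms(2,4) c(1)] \<phi> w
    unfolding weak_derivative_iff_L2_inner by (simp add: plus_fun_def)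
qed

lemma weak_derivative_scale:
  "weak_derivative I f g \<Longrightarrow> weak_derivative I (\<lambda>x. c * f x) (\<lambda>x. c * g x)"
  unfolding weak_derivative_def by (simp add: mult.assoc)

text \<open>
  The difference of two weak derivatives is a weak derivative of the zero function, so by the
  fundamental theorem its integral over each interval vanishes.
\<close>

lemma weak_derivative_unique:
  assumes g: "g1 \<in> L2_on {0<..<l}" "g2 \<in> L2_on {0<..<l}" and f: "f \<in> L2_on {0<..<l}" and l: "0 < l"
    and w: "weak_derivative {0<..<l} f g1" "weak_derivative {0<..<l} f g2"
  shows "AE x in leb l. g1 x = g2 x"
proof -
  have d: "(\<lambda>x. g1 x + - 1 * g2 x) \<in> L2_on {0<..<l}" by (intro L2_on_add L2_on_scale g)
  have "weak_derivative {0<..<l} (\<lambda>x. f x + - 1 * f x) (\<lambda>x. g1 x + - 1 * g2 x)"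
    by (intro weak_derivative_add weak_derivative_scale w f g L2_on_scale)
  then have wd: "weak_derivative {0<..<l} (\<lambda>x. 0) (\<lambda>x. g1 x + - 1 * g2 x)" by simp
  have "AE x in leb l. g1 x + - 1 * g2 x = 0"
  proof (rule AE_zero_of_interval_integrals[OF L2_on_integrable[OF d] l])
    fix x y :: real assume "0 \<le> x" "x \<le> y" "y \<le> l"
    from weak_derivative_FTC[OF continuous_on_const d wd this l]
    show "integral {x..y} (\<lambda>x. g1 x + - 1 * g2 x) = 0" by simp
  qed
  then show ?thesis by simp
qed

lemma weak_deriv_spec:
  assumes "f \<in> H1_on I"
  shows "weak_deriv I f \<in> L2_on I" "weak_derivative I f (weak_deriv I f)"
proof -
  have "\<exists>g. g \<in> L2_on I \<and> weak_derivative I f g" using assms by (auto simp: H1_on_def)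
  from someI_ex[OF this] show "weak_deriv I f \<in> L2_on I" "weak_derivative I f (weak_deriv I f)"
    by (auto simp: weak_deriv_def)
qed

lemma weak_deriv_AE_eq:
  assumes "f \<in> L2_on {0<..<l}" "g \<in> L2_on {0<..<l}" "weak_derivative {0<..<l} f g" "0 < l"
  shows "AE x in leb l. weak_deriv {0<..<l} f x = g x"
proof -
  have "f \<in> H1_on {0<..<l}" using assms by (auto simp: H1_on_def)
  from weak_derivative_unique[OF weak_deriv_spec(1)[OF this] assms(2,1,4) weak_deriv_spec(2)[OF this] assms(3)]
  show ?thesis .
qed

text \<open>
  Integration by parts; test functions vanish at both end points.
\<close>

lemma weak_derivative_of_C1:
  fixes f :: "real \<Rightarrow> real"
  assumes f: "\<And>x. (f has_real_derivative f' x) (at x)" "continuous_on UNIV f'" and l: "0 < l"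
  shows "weak_derivative {0<..<l} (\<lambda>x. of_real (f x)) (\<lambda>x. of_real (f' x))"
  unfolding weak_derivative_def
proof
  fix \<phi> assume \<phi>: "\<phi> \<in> test_functions {0<..<l}"
  note t = test_functionD[OF \<phi>]
  have cf: "continuous_on A f" for A by (intro continuous_at_imp_continuous_on ballI DERIV_isCont[OF f(1)])
  have cf': "continuous_on A f'" for A using f(2) continuous_on_subset by blast
  have "((\<lambda>x. f' x * \<phi> x + f x * deriv \<phi> x) has_integral f l * \<phi> l - f 0 * \<phi> 0) {0..l}"
  proof (rule fundamental_theorem_of_calculus)
    fix x
    have "((\<lambda>x. f x * \<phi> x) has_real_derivative f' x * \<phi> x + f x * deriv \<phi> x) (at x)"
      using DERIV_mult[OF f(1)[of x] t(1)[of x]] by (simp add: algebra_simps)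
    then show "((\<lambda>x. f x * \<phi> x) has_vector_derivative f' x * \<phi> x + f x * deriv \<phi> x) (at x within {0..l})"
      unfolding has_real_derivative_iff_has_vector_derivative[symmetric] by (rule has_field_derivative_at_within)
  qed (use l in simp)
  then have zero: "integral {0..l} (\<lambda>x. f' x * \<phi> x + f x * deriv \<phi> x) = 0"
    using t(4)[of 0] t(4)[of l] by (simp add: integral_unique)
  have int: "integrable (leb l) (\<lambda>x. h x)" if "continuous_on {0..l} h" for h :: "real \<Rightarrow> real"
  proof -
    have "integrable (leb l) (\<lambda>x. complex_of_real (h x))"
      by (rule L2_on_integrable[OF continuous_real_L2_on[OF that]])
    from integrable_Re[OF this] show ?thesis by simp
  qed
  have i: "integrable (leb l) (\<lambda>x. f' x * \<phi> x)" "integrable (leb l) (\<lambda>x. f x * deriv \<phi> x)"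
    by (intro int continuous_intros cf cf' t)+
  have "(LINT x|leb l. f' x * \<phi> x) + (LINT x|leb l. f x * deriv \<phi> x) = 0"
    using LINT_interval_eq_integral[OF Bochner_Integration.integrable_add[OF i]] zero
    by (simp add: Bochner_Integration.integral_add[OF i])
  then have "(LINT x|leb l. f x * deriv \<phi> x) = - (LINT x|leb l. f' x * \<phi> x)"
    by linarith
  then have "complex_of_real (LINT x|leb l. f x * deriv \<phi> x) = - of_real (LINT x|leb l. f' x * \<phi> x)"
    by simp
  then show "(LINT x|leb l. of_real (f x) * of_real (deriv \<phi> x)) =
      - (LINT x|leb l. complex_of_real (f' x) * of_real (\<phi> x))"
    by (simp only: of_real_mult[symmetric] integral_complex_of_real)
qed

text \<open>
  For a fixed test function both sides of the definition are inner products in \<open>L\<^sup>2\<close>.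
\<close>

lemma weak_derivative_limit:
  assumes "\<And>n. f n \<in> L2_on {0<..<l}" "\<And>n. g n \<in> L2_on {0<..<l}" "F \<in> L2_on {0<..<l}" "G \<in> L2_on {0<..<l}"
    and w: "\<And>n. weak_derivative {0<..<l} (f n) (g n)"
    and lim: "(\<lambda>n. L2.sq {0<..<l} (f n - F)) \<longlonglongrightarrow> 0" "(\<lambda>n. L2.sq {0<..<l} (g n - G)) \<longlonglongrightarrow> 0"
  shows "weak_derivative {0<..<l} F G"
  unfolding weak_derivative_iff_L2_inner
proof
  fix \<phi> assume \<phi>: "\<phi> \<in> test_functions {0<..<l}"
  have c: "(\<lambda>x. of_real (\<phi> x)) \<in> L2_on {0<..<l}" "(\<lambda>x. of_real (deriv \<phi> x)) \<in> L2_on {0<..<l}"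
    by (intro continuous_real_L2_on test_functionD[OF \<phi>])+
  have "(\<lambda>n. LINT x|leb l. f n x * cnj (of_real (deriv \<phi> x))) \<longlonglongrightarrow>
      (LINT x|leb l. F x * cnj (of_real (deriv \<phi> x)))"
    by (rule L2.continuous_left[OF assms(1,3) c(2) lim(1)])
  moreover have "(\<lambda>n. LINT x|leb l. f n x * cnj (of_real (deriv \<phi> x))) \<longlonglongrightarrow>
      - (LINT x|leb l. G x * cnj (of_real (\<phi> x)))"
    using tendsto_minus[OF L2.continuous_left[OF assms(2,4) c(1) lim(2)]] w \<phi>
    unfolding weak_derivative_iff_L2_inner by simp
  ultimately show "(LINT x|leb l. F x * cnj (of_real (deriv \<phi> x))) =
      - (LINT x|leb l. G x * cnj (of_real (\<phi> x)))"
    by (rule LIMSEQ_unique)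
qed

lemma weak_derivative_cong:
  assumes "\<And>x. x \<in> {0<..<l} \<Longrightarrow> f x = f' x"
  shows "weak_derivative {0<..<l :: real} f g \<longleftrightarrow> weak_derivative {0<..<l} f' g"
proof -
  have "(LINT x|leb l. f x * of_real (deriv \<phi> x)) = (LINT x|leb l. f' x * of_real (deriv \<phi> x))" for \<phi>
    by (rule Bochner_Integration.integral_cong) (use assms in \<open>auto simp: space_restrict_space\<close>)
  then show ?thesis by (simp add: weak_derivative_def)
qed

lemma LINT_square_le:
  fixes h :: "real \<Rightarrow> real"
  assumes c: "continuous_on UNIV h" and B: "\<And>x. \<bar>h x\<bar> \<le> B" and out: "\<And>x. x \<notin> {s..t} \<Longrightarrow> h x = 0"
    and st: "0 < s" "s \<le> t" "t < l"
  shows "sqnorm l (\<lambda>x. of_real (h x)) \<le> B\<^sup>2 * (t - s)"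
proof -
  interpret finite_measure "leb l" by (rule finite_measure_lebesgue_on_interval)
  have sets: "{s..t} \<in> sets (leb l)"
    by (subst sets_restrict_space_iff) (use st in auto)
  have "measure (leb l) {s..t} = t - s"
    using st by (subst measure_restrict_space) auto
  then have eq: "(LINT x|leb l. B\<^sup>2 * indicator {s..t} x) = B\<^sup>2 * (t - s)"
    using st by (simp add: Int_absorb2 space_restrict_space subset_eq)
  have "sqnorm l (\<lambda>x. of_real (h x)) \<le> (LINT x|leb l. B\<^sup>2 * indicator {s..t} x)"
  proof (rule integral_mono)
    show "integrable (leb l) (\<lambda>x. (cmod (of_real (h x)))\<^sup>2)"
      by (rule L2_on_square[OF continuous_real_L2_on[OF continuous_on_subset[OF c]]]) simp
    show "integrable (leb l) (\<lambda>x. B\<^sup>2 * indicator {s..t} x)"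
      using sets by (intro integrable_mult_right integrable_real_indicator) (auto simp: emeasure_eq_measure)
    show "(cmod (of_real (h x)))\<^sup>2 \<le> B\<^sup>2 * indicator {s..t} x" for x
      using out[of x] B[of x] by (cases "x \<in> {s..t}") (auto simp: abs_le_square_iff[symmetric])
  qed
  then show ?thesis by (simp only: eq)
qed

section \<open>Sobolev functions on an interval\<close>

text \<open>
  The integral of \<open>(|g| - m)\<^sup>2\<close>, where \<open>m\<close> is the mean of \<open>|g|\<close>, is non-negative.
\<close>

lemma square_integral_Cauchy_Schwarz:
  fixes g :: "real \<Rightarrow> complex"
  assumes g: "(\<lambda>t. (cmod (g t))\<^sup>2) integrable_on {x..y}" "g absolutely_integrable_on {x..y}" and xy: "x \<le> y"
  shows "(cmod (integral {x..y} g))\<^sup>2 \<le> (y - x) * integral {x..y} (\<lambda>t. (cmod (g t))\<^sup>2)"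
proof (cases "x = y")
  case False
  define A where "A = integral {x..y} (\<lambda>t. cmod (g t))"
  define B where "B = integral {x..y} (\<lambda>t. (cmod (g t))\<^sup>2)"
  define m where "m = A / (y - x)"
  have gn: "(\<lambda>t. cmod (g t)) integrable_on {x..y}" and gi: "g integrable_on {x..y}"
    using g(2) by (simp_all add: absolutely_integrable_on_def)
  have "((\<lambda>t. (cmod (g t))\<^sup>2 - 2 * m * cmod (g t) + m\<^sup>2) has_integral (B - 2 * m * A + (y - x) *\<^sub>R m\<^sup>2)) {x..y}"
    unfolding A_def B_def
    by (intro has_integral_add has_integral_diff has_integral_mult_right integrable_integral gn g(1)
        has_integral_const_real[of "m\<^sup>2" x y, unfolded content_real_if[of x y], simplified xy if_True])
  then have "0 \<le> B - 2 * m * A + (y - x) *\<^sub>R m\<^sup>2"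
  proof (rule has_integral_nonneg)
    fix t
    have "(cmod (g t))\<^sup>2 - 2 * m * cmod (g t) + m\<^sup>2 = (cmod (g t) - m)\<^sup>2"
      by (simp add: power2_diff)
    then show "0 \<le> (cmod (g t))\<^sup>2 - 2 * m * cmod (g t) + m\<^sup>2" by simp
  qed
  also have "B - 2 * m * A + (y - x) *\<^sub>R m\<^sup>2 = B - A\<^sup>2 / (y - x)"
  proof -
    have mA: "(y - x) * m = A" using False by (simp add: m_def)
    have "(y - x) *\<^sub>R m\<^sup>2 = m * A" by (simp add: power2_eq_square mult.left_commute flip: mA)
    moreover have "A\<^sup>2 / (y - x) = m * A" by (simp add: m_def power2_eq_square)
    ultimately show ?thesis by simp
  qed
  finally have "A\<^sup>2 \<le> (y - x) * B"
    using xy False by (simp add: field_simps)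
  moreover have "cmod (integral {x..y} g) \<le> A"
    unfolding A_def by (rule integral_norm_bound_integral[OF gi gn]) simp
  ultimately show ?thesis
    unfolding B_def by (meson norm_ge_zero order_trans power_mono)
qed simp

text \<open>
  An element of the Sobolev space \<open>H\<^sup>1(0,l)\<close>, given by its continuous representative on the closed
  interval and a weak derivative.
\<close>

locale sobolev =
  fixes l :: real and F g :: "real \<Rightarrow> complex"
  assumes l: "0 < l" and F: "continuous_on {0..l} F" and g: "g \<in> L2_on {0<..<l}"
    and w: "weak_derivative {0<..<l} F g"
begin

lemma square_integrable_on:
  assumes "0 \<le> x" "y \<le> l"
  shows "(\<lambda>t. (cmod (g t))\<^sup>2) integrable_on {x..y}"
  using integrable_lebesgue_on_subinterval[OF L2_on_square[OF g] assms]
  by (rule set_lebesgue_integral_eq_integral(1))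

lemma value_integrable_on:
  assumes "0 \<le> x" "y \<le> l"
  shows "(\<lambda>t. (cmod (F t))\<^sup>2) integrable_on {x..y}"
  by (intro integrable_continuous_real continuous_intros continuous_on_subset[OF F]) (use assms in auto)

lemma increment_bound:
  assumes "0 \<le> x" "x \<le> y" "y \<le> l"
  shows "(cmod (F y - F x))\<^sup>2 \<le> (y - x) * integral {x..y} (\<lambda>t. (cmod (g t))\<^sup>2)"
  unfolding weak_derivative_FTC[OF F g w assms l]
  by (rule square_integral_Cauchy_Schwarz)
    (use assms in \<open>auto intro: square_integrable_on integrable_lebesgue_on_subinterval[OF L2_on_integrable[OF g]]\<close>)

lemma integral_square_mono:
  assumes "0 \<le> u" "u \<le> x" "y \<le> v" "v \<le> l"
  shows "integral {x..y} (\<lambda>t. (cmod (g t))\<^sup>2) \<le> integral {u..v} (\<lambda>t. (cmod (g t))\<^sup>2)"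
  by (rule integral_subset_le) (use assms in \<open>auto intro: square_integrable_on\<close>)

lemma value_bound_in_window:
  assumes "0 \<le> s" "s \<le> x" "x \<le> s + r" "s \<le> y" "y \<le> s + r" "s + r \<le> l"
  shows "(cmod (F x))\<^sup>2 \<le> 2 * (cmod (F y))\<^sup>2 + 2 * r * integral {s..s + r} (\<lambda>t. (cmod (g t))\<^sup>2)"
proof -
  let ?G = "integral {s..s + r} (\<lambda>t. (cmod (g t))\<^sup>2)"
  have G: "0 \<le> ?G" by (rule integral_nonneg) (use assms in \<open>auto intro: square_integrable_on\<close>)
  have *: "(cmod (F v - F u))\<^sup>2 \<le> r * ?G" if "s \<le> u" "u \<le> v" "v \<le> s + r" for u v
  proof -
    have "(cmod (F v - F u))\<^sup>2 \<le> (v - u) * integral {u..v} (\<lambda>t. (cmod (g t))\<^sup>2)"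
      by (rule increment_bound) (use that assms in auto)
    also have "\<dots> \<le> r * ?G"
      by (intro mult_mono integral_square_mono integral_nonneg square_integrable_on) (use that assms in auto)
    finally show ?thesis .
  qed
  have "(cmod (F x - F y))\<^sup>2 \<le> r * ?G"
  proof (cases "y \<le> x")
    case True
    then show ?thesis using *[of y x] assms by simp
  next
    case False
    then show ?thesis using *[of x y] assms by (simp add: norm_minus_commute)
  qed
  moreover have "(cmod (F x))\<^sup>2 \<le> 2 * (cmod (F y))\<^sup>2 + 2 * (cmod (F x - F y))\<^sup>2"
    using cmod_add_square_le[of "F y" "F x - F y"] by simp
  ultimately show ?thesis by simp
qed

text \<open>
  The increment bound is averaged over a window of length \<open>r\<close> that contains \<open>x\<close>. The free choice of \<open>r\<close>
  balances the two terms: a function with energy of order \<open>N\<close> and mass of order \<open>1 / N\<close> is bounded, as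
  \<open>r = 1 / N\<close> shows.
\<close>

lemma sup_bound:
  assumes x: "0 \<le> x" "x \<le> l" and r: "0 < r" "r \<le> l"
  shows "(cmod (F x))\<^sup>2 \<le> 2 * r * sqnorm l g
    + 2 / r * sqnorm l F"
proof -
  \<comment> \<open>The window \<open>[s, s + r]\<close> starts at \<open>x\<close> unless it would leave the interval.\<close>
  define s where "s = min x (l - r)"
  have s: "0 \<le> s" "s \<le> x" "x \<le> s + r" "s + r \<le> l" using x r by (auto simp: s_def)
  let ?G = "integral {0..l} (\<lambda>t. (cmod (g t))\<^sup>2)" and ?A = "integral {0..l} (\<lambda>t. (cmod (F t))\<^sup>2)"
  have "(cmod (F x))\<^sup>2 - 2 * r * ?G \<le> 2 * (cmod (F y))\<^sup>2" if "y \<in> {s..s + r}" for y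
  proof -
    have "r * integral {s..s + r} (\<lambda>t. (cmod (g t))\<^sup>2) \<le> r * ?G"
      using r s by (intro mult_left_mono integral_square_mono) auto
    then show ?thesis
      using value_bound_in_window[of s x r y] s that by simp
  qed
  then have "integral {s..s + r} (\<lambda>y. (cmod (F x))\<^sup>2 - 2 * r * ?G) \<le> integral {s..s + r} (\<lambda>y. 2 * (cmod (F y))\<^sup>2)"
    by (intro integral_le integrable_on_mult_right value_integrable_on) (use s in auto)
  also have "\<dots> = 2 * integral {s..s + r} (\<lambda>y. (cmod (F y))\<^sup>2)" by simp
  also have "\<dots> \<le> 2 * ?A"
    by (intro mult_left_mono integral_subset_le value_integrable_on) (use s in auto)
  finally have "r * ((cmod (F x))\<^sup>2 - 2 * r * ?G) \<le> 2 * ?A" using r by simp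
  then have "(cmod (F x))\<^sup>2 - 2 * r * ?G \<le> 2 * ?A / r"
    using r by (simp add: le_divide_eq mult.commute)
  then show ?thesis
    unfolding LINT_interval_eq_integral[OF L2_on_square[OF g]]
      LINT_interval_eq_integral[OF L2_on_square[OF continuous_on_L2_on[OF F]]]
    by simp
qed

text \<open>
  On each piece of the grid the function is compared with its value at the left end point. In
  particular a function that vanishes on the grid satisfies a Poincare inequality with constant
  of order \<open>h\<^sup>2\<close>.
\<close>

lemma grid_bound_partial:
  assumes h: "0 < h" and "real m * h \<le> l"
  shows "integral {0..real m * h} (\<lambda>t. (cmod (F t))\<^sup>2) \<le>
    2 * h * (\<Sum>i<m. (cmod (F (real i * h)))\<^sup>2) + 2 * h\<^sup>2 * integral {0..real m * h} (\<lambda>t. (cmod (g t))\<^sup>2)"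
  using assms(2)
proof (induction m)
  case (Suc m)
  let ?u = "real m * h" and ?v = "real (Suc m) * h"
  have uv: "?v = ?u + h" by (simp add: algebra_simps)
  have u0: "0 \<le> ?u" using h by simp
  have ul: "?u + h \<le> l" using Suc.prems uv by simp
  let ?F = "\<lambda>t. (cmod (F t))\<^sup>2" and ?G = "\<lambda>t. (cmod (g t))\<^sup>2"
  have "integral {?u..?u + h} ?F \<le> integral {?u..?u + h} (\<lambda>t. 2 * ?F ?u + 2 * h * integral {?u..?u + h} ?G)"
  proof (rule integral_le)
    show "?F integrable_on {?u..?u + h}" by (rule value_integrable_on) (use u0 ul in auto)
    fix y assume "y \<in> {?u..?u + h}"
    then show "?F y \<le> 2 * ?F ?u + 2 * h * integral {?u..?u + h} ?G"
      by (intro value_bound_in_window) (use u0 ul h in auto)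
  qed (rule integrable_const_ivl)
  also have "\<dots> = 2 * h * ?F ?u + 2 * h\<^sup>2 * integral {?u..?u + h} ?G"
    using h by (simp add: power2_eq_square distrib_left)
  finally have piece: "integral {?u..?u + h} ?F \<le> 2 * h * ?F ?u + 2 * h\<^sup>2 * integral {?u..?u + h} ?G" .
  have IH: "integral {0..?u} ?F \<le> 2 * h * (\<Sum>i<m. ?F (real i * h)) + 2 * h\<^sup>2 * integral {0..?u} ?G"
    by (rule Suc.IH) (use ul h in simp)
  have "integral {0..?u} ?F + integral {?u..?u + h} ?F = integral {0..?u + h} ?F"
    by (rule Henstock_Kurzweil_Integration.integral_combine) (use u0 h ul in \<open>auto intro: value_integrable_on\<close>)
  moreover have "integral {0..?u} ?G + integral {?u..?u + h} ?G = integral {0..?u + h} ?G"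
    by (rule Henstock_Kurzweil_Integration.integral_combine) (use u0 h ul in \<open>auto intro: square_integrable_on\<close>)
  ultimately show ?case
    using IH piece unfolding uv
    by (simp add: distrib_left flip: \<open>integral {0..?u} ?G + integral {?u..?u + h} ?G = integral {0..?u + h} ?G\<close>)
qed simp

lemma grid_bound:
  assumes m: "0 < m"
  shows "sqnorm l F \<le>
    2 * (l / real m) * (\<Sum>i<m. (cmod (F (real i * (l / real m))))\<^sup>2)
    + 2 * (l / real m)\<^sup>2 * sqnorm l g"
proof -
  have "real m * (l / real m) = l" using m by simp
  then show ?thesis
    using grid_bound_partial[of "l / real m" m] m l
    unfolding LINT_interval_eq_integral[OF L2_on_square[OF g]]
      LINT_interval_eq_integral[OF L2_on_square[OF continuous_on_L2_on[OF F]]]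
    by simp
qed

end

lemma sobolev_cong:
  assumes "\<And>x. x \<in> {0..l} \<Longrightarrow> F x = F' x"
  shows "sobolev l F g \<longleftrightarrow> sobolev l F' g"
proof -
  have "continuous_on {0..l} F \<longleftrightarrow> continuous_on {0..l} F'"
    by (rule continuous_on_cong) (use assms in auto)
  moreover have "weak_derivative {0<..<l} F g \<longleftrightarrow> weak_derivative {0<..<l} F' g"
    by (rule weak_derivative_cong) (use assms in auto)
  ultimately show ?thesis by (simp add: sobolev_def)
qed

lemma sobolev_add: "sobolev l F1 g1 \<Longrightarrow> sobolev l F2 g2 \<Longrightarrow> sobolev l (\<lambda>x. F1 x + F2 x) (\<lambda>x. g1 x + g2 x)"
  unfolding sobolev_def
  by (auto intro!: continuous_on_add L2_on_add weak_derivative_add continuous_on_L2_on[of l F1] continuous_on_L2_on[of l F2])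

lemma sobolev_scale: "sobolev l F1 g1 \<Longrightarrow> sobolev l (\<lambda>x. c * F1 x) (\<lambda>x. c * g1 x)"
  unfolding sobolev_def
  by (auto intro!: continuous_on_mult continuous_on_const L2_on_scale weak_derivative_scale)

section \<open>Sobolev functions on a metric graph\<close>

lemma edge_point_inner: "0 < x \<Longrightarrow> x < len e \<Longrightarrow> edge_point G len e x = Inner e x"
  by (simp add: edge_point_def)

locale finite_metric_graph =
  fixes G :: "('v, 'e) pre_digraph" and len :: "'e \<Rightarrow> real"
  assumes metric_graph: "metric_graph G len"
begin

abbreviation "X \<equiv> graph_topology G len"

abbreviation "edge e \<equiv> edge_point G len e"

lemma finite_arcs: "finite (arcs G)" and finite_verts: "finite (verts G)"
  and len_pos: "e \<in> arcs G \<Longrightarrow> 0 < len e"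
  and connected: "connected_space X"
  and ends_in_verts: "e \<in> arcs G \<Longrightarrow> tail G e \<in> verts G" "e \<in> arcs G \<Longrightarrow> head G e \<in> verts G"
  and arcs_nonempty: "arcs G \<noteq> {}"
proof -
  have fin: "fin_digraph G" and *: "\<forall>e\<in>arcs G. 0 < len e" "connected_space X" "0 < (\<Sum>e\<in>arcs G. len e)"
    using metric_graph by (auto simp: metric_graph_def)
  interpret fin_digraph G by (rule fin)
  show "finite (arcs G)" "finite (verts G)" by simp_all
  show "e \<in> arcs G \<Longrightarrow> 0 < len e" "connected_space X" using * by auto
  show "e \<in> arcs G \<Longrightarrow> tail G e \<in> verts G" "e \<in> arcs G \<Longrightarrow> head G e \<in> verts G" by auto
  show "arcs G \<noteq> {}" using *(3) by auto
qed

lemma edge_in_points: "e \<in> arcs G \<Longrightarrow> edge e x \<in> points G len"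
  using ends_in_verts len_pos by (auto simp: edge_point_def points_def)

lemma topspace_X: "topspace X = points G len"
proof
  show "topspace X \<subseteq> points G len"
    using openin_topspace[of X] openin_graph_topology[of G len "topspace X"] by blast
  have "{x \<in> {0..len e}. edge e x \<in> points G len} = {0..len e}" if "e \<in> arcs G" for e
    using edge_in_points[OF that] by auto
  then have "openin X (points G len)"
    by (auto simp: openin_graph_topology)
  then show "points G len \<subseteq> topspace X" by (rule openin_subset)
qed

text \<open>
  The topology is the quotient topology of the edges, so continuity is tested on each of them.
\<close>

lemma continuous_map_graph_iff:
  fixes f :: "('v, 'e) point \<Rightarrow> complex"
  shows "continuous_map X euclidean f \<longleftrightarrow> (\<forall>e\<in>arcs G. continuous_on {0..len e} (\<lambda>x. f (edge e x)))"
proof -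
  have "continuous_map X euclidean f \<longleftrightarrow> (\<forall>U. open U \<longrightarrow> openin X {p \<in> points G len. f p \<in> U})"
    by (auto simp: continuous_map_def topspace_X)
  also have "\<dots> \<longleftrightarrow> (\<forall>U. open U \<longrightarrow> (\<forall>e\<in>arcs G. openin (top_of_set {0..len e}) {x \<in> {0..len e}. f (edge e x) \<in> U}))"
    using edge_in_points by (simp add: openin_graph_topology)
  also have "\<dots> \<longleftrightarrow> (\<forall>e\<in>arcs G. continuous_map (top_of_set {0..len e}) euclidean (\<lambda>x. f (edge e x)))"
    by (auto simp: continuous_map_def)
  finally show ?thesis by simp
qed

text \<open>
  A vertex at which no edge ends would be a connected component of its own.
\<close>

lemma point_on_edge:
  assumes "p \<in> points G len"
  shows "\<exists>e\<in>arcs G. \<exists>x\<in>{0..len e}. p = edge e x"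
proof (cases p)
  case (Inner e x)
  then have "e \<in> arcs G" "0 < x" "x < len e" using assms by (auto simp: points_def)
  then show ?thesis using Inner by (intro bexI[of _ e] bexI[of _ x]) (auto simp: edge_point_inner)
next
  case (Vertex v)
  show ?thesis
  proof (rule ccontr)
    assume none: "\<not> ?thesis"
    then have ne: "edge e x \<noteq> p" if "e \<in> arcs G" "x \<in> {0..len e}" for e x using that by blast
    have empty: "{x \<in> {0..len e}. edge e x \<in> {p}} = {}" if "e \<in> arcs G" for e
      using ne[OF that] by blast
    have "openin X {p}"
      unfolding openin_graph_topology using assms by (intro conjI ballI) (simp, simp only: empty openin_empty)
    moreover have "{x \<in> {0..len e}. edge e x \<in> points G len - {p}} = {0..len e}" if "e \<in> arcs G" for e
      using ne[OF that] edge_in_points[OF that] by blast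
    then have "openin X (points G len - {p})" by (auto simp: openin_graph_topology)
    ultimately have "points G len - {p} = {}"
      using connected unfolding connected_space_def topspace_X using assms by blast
    moreover obtain e where e: "e \<in> arcs G" using arcs_nonempty by blast
    then have "edge e 0 \<in> points G len - {p}"
      using edge_in_points[OF e] ne[OF e, of 0] len_pos[OF e] by simp
    ultimately show False by blast
  qed
qed

abbreviation "H \<equiv> H1_graph G len"

lemma H1_graph_sobolev:
  assumes f: "f \<in> H" and e: "e \<in> arcs G"
  shows "sobolev (len e) (\<lambda>x. f (edge e x)) (edge_deriv len f e)"
proof
  have H1: "(\<lambda>x. f (Inner e x)) \<in> H1_on {0<..<len e}" using f e by (auto simp: H1_graph_def)
  show "edge_deriv len f e \<in> L2_on {0<..<len e}"
    unfolding edge_deriv_def by (rule weak_deriv_spec[OF H1])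
  have "weak_derivative {0<..<len e} (\<lambda>x. f (Inner e x)) (edge_deriv len f e)"
    unfolding edge_deriv_def by (rule weak_deriv_spec[OF H1])
  then show "weak_derivative {0<..<len e} (\<lambda>x. f (edge e x)) (edge_deriv len f e)"
    by (subst (asm) weak_derivative_cong[of "len e" _ "\<lambda>x. f (edge e x)"]) (auto simp: edge_point_inner)
  show "continuous_on {0..len e} (\<lambda>x. f (edge e x))"
    using f e continuous_map_graph_iff[of f] by (auto simp: H1_graph_def)
qed (rule len_pos[OF e])

lemma H1_graphI:
  assumes cont: "\<And>e. e \<in> arcs G \<Longrightarrow> continuous_on {0..len e} (\<lambda>x. f (edge e x))"
    and der: "\<And>e. e \<in> arcs G \<Longrightarrow> \<exists>g\<in>L2_on {0<..<len e}. weak_derivative {0<..<len e} (\<lambda>x. f (edge e x)) g"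
    and out: "\<And>p. p \<notin> points G len \<Longrightarrow> f p = 0"
  shows "f \<in> H"
proof -
  have "(\<lambda>x. f (Inner e x)) \<in> H1_on {0<..<len e}" if e: "e \<in> arcs G" for e
  proof -
    have "(\<lambda>x. f (Inner e x)) \<in> L2_on {0<..<len e}"
      using continuous_on_L2_on[OF cont[OF e]]
      by (subst L2_on_cong[of "len e" _ "\<lambda>x. f (edge e x)"]) (auto simp: edge_point_inner)
    moreover obtain g where "g \<in> L2_on {0<..<len e}" "weak_derivative {0<..<len e} (\<lambda>x. f (edge e x)) g"
      using der[OF e] by blast
    then have "weak_derivative {0<..<len e} (\<lambda>x. f (Inner e x)) g"
      by (subst weak_derivative_cong[of "len e" _ "\<lambda>x. f (edge e x)"]) (auto simp: edge_point_inner)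
    ultimately show ?thesis using \<open>g \<in> L2_on {0<..<len e}\<close> by (auto simp: H1_on_def)
  qed
  then show ?thesis using cont out by (auto simp: H1_graph_def continuous_map_graph_iff)
qed

lemma edge_deriv_AE_eq:
  assumes f: "f \<in> H" and e: "e \<in> arcs G"
    and g: "g \<in> L2_on {0<..<len e}" "weak_derivative {0<..<len e} (\<lambda>x. f (edge e x)) g"
  shows "AE x in leb (len e). edge_deriv len f e x = g x"
  unfolding edge_deriv_def
proof (rule weak_deriv_AE_eq[OF _ g(1) _ len_pos[OF e]])
  show "(\<lambda>x. f (Inner e x)) \<in> L2_on {0<..<len e}"
    using f e by (auto simp: H1_graph_def H1_on_def)
  show "weak_derivative {0<..<len e} (\<lambda>x. f (Inner e x)) g"
    using g(2) by (subst weak_derivative_cong[of "len e" _ "\<lambda>x. f (edge e x)"]) (auto simp: edge_point_inner)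
qed

lemma H1_graph_of_sobolev:
  assumes "\<And>e. e \<in> arcs G \<Longrightarrow> sobolev (len e) (\<lambda>x. f (edge e x)) (g e)"
    and "\<And>p. p \<notin> points G len \<Longrightarrow> f p = 0"
  shows "f \<in> H" "e \<in> arcs G \<Longrightarrow> AE x in leb (len e). edge_deriv len f e x = g e x"
proof -
  show f: "f \<in> H"
    using assms by (intro H1_graphI) (auto simp: sobolev_def)
  assume e: "e \<in> arcs G"
  show "AE x in leb (len e). edge_deriv len f e x = g e x"
    using assms(1)[OF e] by (intro edge_deriv_AE_eq f e) (auto simp: sobolev_def)
qed

lemma H1_graph_zero_outside: "f \<in> H \<Longrightarrow> p \<notin> points G len \<Longrightarrow> f p = 0"
  by (auto simp: H1_graph_def)

text \<open>
  Since \<^const>\<open>edge_deriv\<close> is an arbitrary choice among the weak derivatives, it is additive and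
  homogeneous only up to null sets.
\<close>

lemma H1_graph_add:
  assumes f: "f \<in> H" and g: "g \<in> H"
  shows "f + g \<in> H"
    "e \<in> arcs G \<Longrightarrow> AE x in leb (len e). edge_deriv len (f + g) e x = edge_deriv len f e x + edge_deriv len g e x"
  using H1_graph_of_sobolev[of "f + g" "\<lambda>e x. edge_deriv len f e x + edge_deriv len g e x"]
    sobolev_add[OF H1_graph_sobolev[OF f] H1_graph_sobolev[OF g]]
    H1_graph_zero_outside[OF f] H1_graph_zero_outside[OF g]
  by auto

lemma H1_graph_scale:
  assumes f: "f \<in> H"
  shows "(\<lambda>x. c * f x) \<in> H"
    "e \<in> arcs G \<Longrightarrow> AE x in leb (len e). edge_deriv len (\<lambda>x. c * f x) e x = c * edge_deriv len f e x"
  using H1_graph_of_sobolev[of "\<lambda>x. c * f x" "\<lambda>e x. c * edge_deriv len f e x"]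
    sobolev_scale[OF H1_graph_sobolev[OF f]] H1_graph_zero_outside[OF f]
  by auto

lemma H1_graph_subspace: "cfun.subspace H"
proof -
  have "(0 :: ('v, 'e) point \<Rightarrow> complex) \<in> H"
  proof (rule H1_graph_of_sobolev(1)[where g = "\<lambda>_ _. 0"])
    fix e assume "e \<in> arcs G"
    from len_pos[OF this] show "sobolev (len e) (\<lambda>x. (0 :: ('v, 'e) point \<Rightarrow> complex) (edge e x)) (\<lambda>_. 0)"
      by unfold_locales (auto intro!: continuous_on_L2_on simp: weak_derivative_def)
  qed auto
  then show ?thesis
    unfolding cfun.subspace_def using H1_graph_add(1) H1_graph_scale(1) by blast
qed

lemma edge_deriv_L2: "f \<in> H \<Longrightarrow> e \<in> arcs G \<Longrightarrow> edge_deriv len f e \<in> L2_on {0<..<len e}"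
  using H1_graph_sobolev sobolev.g by blast

lemma inner_L2: "f \<in> H \<Longrightarrow> e \<in> arcs G \<Longrightarrow> (\<lambda>x. f (Inner e x)) \<in> L2_on {0<..<len e}"
  by (auto simp: H1_graph_def H1_on_def)

lemma LINT_inner_eq_edge:
  "sqnorm (len e) (\<lambda>x. f (Inner e x)) = sqnorm (len e) (\<lambda>x. f (edge e x))"
  by (rule Bochner_Integration.integral_cong) (auto simp: space_restrict_space edge_point_inner)

section \<open>The energy form\<close>

abbreviation kinetic :: "(('v, 'e) point \<Rightarrow> complex) \<Rightarrow> real" where
  "kinetic f \<equiv> \<Sum>e\<in>arcs G. sqnorm (len e) (edge_deriv len f e)"

lemma hermitian_form_derivative:
  assumes e: "e \<in> arcs G"
  shows "hermitian_form H (\<lambda>f g. LINT x|leb (len e). edge_deriv len f e x * cnj (edge_deriv len g e x))"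
proof
  fix f g h :: "('v, 'e) point \<Rightarrow> complex" and c
  assume f: "f \<in> H" and h: "h \<in> H"
  note d = edge_deriv_L2[OF _ e]
  have "(LINT x|leb (len e). edge_deriv len (\<lambda>x. c * f x) e x * cnj (edge_deriv len h e x))
      = (LINT x|leb (len e). c * edge_deriv len f e x * cnj (edge_deriv len h e x))"
    by (rule L2_inner_cong_AE) (intro d H1_graph_scale f h e L2_on_scale)+
  also have "\<dots> = c * (LINT x|leb (len e). edge_deriv len f e x * cnj (edge_deriv len h e x))"
    by (rule L2.scale_left) (intro d f h)+
  finally show "(LINT x|leb (len e). edge_deriv len (\<lambda>x. c * f x) e x * cnj (edge_deriv len h e x))
      = c * (LINT x|leb (len e). edge_deriv len f e x * cnj (edge_deriv len h e x))" .
  assume g: "g \<in> H"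
  have "(LINT x|leb (len e). edge_deriv len (f + g) e x * cnj (edge_deriv len h e x))
      = (LINT x|leb (len e). (edge_deriv len f e x + edge_deriv len g e x) * cnj (edge_deriv len h e x))"
    by (rule L2_inner_cong_AE) (intro d H1_graph_add f g h e L2_on_add)+
  also have "\<dots> = (LINT x|leb (len e). edge_deriv len f e x * cnj (edge_deriv len h e x))
      + (LINT x|leb (len e). edge_deriv len g e x * cnj (edge_deriv len h e x))"
    using L2.add_left[OF d[OF f] d[OF g] d[OF h]] by (simp add: plus_fun_def)
  finally show "(LINT x|leb (len e). edge_deriv len (f + g) e x * cnj (edge_deriv len h e x))
      = (LINT x|leb (len e). edge_deriv len f e x * cnj (edge_deriv len h e x))
      + (LINT x|leb (len e). edge_deriv len g e x * cnj (edge_deriv len h e x))" .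
next
  fix f g :: "('v, 'e) point \<Rightarrow> complex"
  assume f: "f \<in> H" and g: "g \<in> H"
  show "(LINT x|leb (len e). edge_deriv len g e x * cnj (edge_deriv len f e x))
      = cnj (LINT x|leb (len e). edge_deriv len f e x * cnj (edge_deriv len g e x))"
    by (rule L2.hermitian) (intro edge_deriv_L2 e f g)+
next
  fix f :: "('v, 'e) point \<Rightarrow> complex"
  assume f: "f \<in> H"
  show "0 \<le> Re (LINT x|leb (len e). edge_deriv len f e x * cnj (edge_deriv len f e x))"
    by (rule L2.nonneg) (intro edge_deriv_L2 e f)
qed (rule H1_graph_subspace)

lemma hermitian_form_L2_inner: "hermitian_form H (L2_inner G len)"
  unfolding L2_inner_def[abs_def]
proof (rule hermitian_form_sum[OF _ H1_graph_subspace])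
  fix e assume e: "e \<in> arcs G"
  show "hermitian_form H (\<lambda>f g. LINT x|leb (len e). f (Inner e x) * cnj (g (Inner e x)))"
    by (rule hermitian_form_pullback[OF hermitian_form_L2 H1_graph_subspace, where T = "\<lambda>f x. f (Inner e x)"])
      (auto intro: inner_L2[OF _ e])
qed

end

lemma ennreal_infsum_finite_iff:
  fixes h :: "'c \<Rightarrow> real"
  assumes "\<And>p. p \<in> A \<Longrightarrow> 0 \<le> h p"
  shows "(\<Sum>\<^sub>\<infinity>p\<in>A. ennreal (h p)) < \<infinity> \<longleftrightarrow> h summable_on A"
proof
  assume fin: "(\<Sum>\<^sub>\<infinity>p\<in>A. ennreal (h p)) < \<infinity>"
  define c where "c = enn2real (\<Sum>\<^sub>\<infinity>p\<in>A. ennreal (h p))"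
  have "sum h F \<le> c" if F: "finite F" "F \<subseteq> A" for F
  proof -
    have "ennreal (sum h F) = (\<Sum>p\<in>F. ennreal (h p))"
      using F assms by (intro sum_ennreal[symmetric]) auto
    also have "\<dots> \<le> (\<Sum>\<^sub>\<infinity>p\<in>A. ennreal (h p))"
      unfolding nonneg_infsum_complete[OF zero_le] using F by (intro SUP_upper) auto
    also have "\<dots> = ennreal c" using fin by (simp add: c_def)
    finally show ?thesis by (subst (asm) ennreal_le_iff) (simp_all add: c_def)
  qed
  then show "h summable_on A"
    using assms by (intro nonneg_bdd_above_summable_on bdd_aboveI2) auto
next
  assume sum: "h summable_on A"
  have "(\<Sum>\<^sub>\<infinity>p\<in>A. ennreal (h p)) \<le> ennreal (infsum h A)"
    unfolding nonneg_infsum_complete[OF zero_le]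
  proof (rule SUP_least)
    fix F assume F: "F \<in> {F. finite F \<and> F \<subseteq> A}"
    then have "(\<Sum>p\<in>F. ennreal (h p)) = ennreal (sum h F)"
      using assms by (intro sum_ennreal) auto
    also have "\<dots> \<le> ennreal (infsum h A)"
      using F assms by (intro ennreal_leI finite_sum_le_infsum sum) auto
    finally show "(\<Sum>p\<in>F. ennreal (h p)) \<le> ennreal (infsum h A)" .
  qed
  then show "(\<Sum>\<^sub>\<infinity>p\<in>A. ennreal (h p)) < \<infinity>" by (simp add: le_less_trans)
qed

text \<open>
  The data of the form, where \<open>V\<close> is the set of the point interactions. It is isolated in the sense that
  each of its points has an interval on its edge which contains no other point of \<open>V\<close>.
\<close>

locale graph_form = finite_metric_graph G len
  for G :: "('v, 'e) pre_digraph" and len +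
  fixes V :: "('v, 'e) point set" and q :: "('v, 'e) point \<Rightarrow> real"
    and \<gamma> :: "'v \<Rightarrow> real" and \<sigma> :: "('v, 'e) point \<Rightarrow> real"
  assumes q_nonneg: "e \<in> arcs G \<Longrightarrow> x \<in> {0<..<len e} \<Longrightarrow> 0 \<le> q (Inner e x)"
    and q_measurable: "e \<in> arcs G \<Longrightarrow> (\<lambda>x. q (Inner e x)) \<in> borel_measurable (leb (len e))"
    and q_bounded: "e \<in> arcs G \<Longrightarrow> \<exists>C. AE x in leb (len e). \<bar>q (Inner e x)\<bar> \<le> C"
    and \<gamma>_nonneg: "v \<in> verts G \<Longrightarrow> 0 \<le> \<gamma> v"
    and \<sigma>_nonneg: "p \<in> V \<Longrightarrow> 0 \<le> \<sigma> p"
    and V_inner: "p \<in> V \<Longrightarrow> \<exists>e x. e \<in> arcs G \<and> 0 < x \<and> x < len e \<and> p = Inner e x"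
    and V_isolated: "Inner e x \<in> V \<Longrightarrow> \<exists>\<delta>>0. \<forall>y. \<bar>y - x\<bar> < \<delta> \<longrightarrow> Inner e y \<in> V \<longrightarrow> y = x"
    and V_infinite: "infinite V"
begin

definition q_bound :: real where
  "q_bound = (SOME C. 0 \<le> C \<and> (\<forall>e\<in>arcs G. AE x in leb (len e). q (Inner e x) \<le> C))"

lemma q_bound: "0 \<le> q_bound" "e \<in> arcs G \<Longrightarrow> AE x in leb (len e). q (Inner e x) \<le> q_bound"
proof -
  have "\<forall>e\<in>arcs G. \<exists>C. AE x in leb (len e). \<bar>q (Inner e x)\<bar> \<le> C" using q_bounded by blast
  from bchoice[OF this] obtain C where C: "\<forall>e\<in>arcs G. AE x in leb (len e). \<bar>q (Inner e x)\<bar> \<le> C e"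
    by blast
  define B where "B = (\<Sum>e\<in>arcs G. \<bar>C e\<bar>)"
  have "AE x in leb (len e). q (Inner e x) \<le> B" if e: "e \<in> arcs G" for e
  proof -
    have "C e \<le> B"
      using member_le_sum[of e "arcs G" "\<lambda>e. \<bar>C e\<bar>"] e finite_arcs by (simp add: B_def)
    moreover have "AE x in leb (len e). \<bar>q (Inner e x)\<bar> \<le> C e" using C e by blast
    ultimately show ?thesis by (auto elim!: eventually_mono)
  qed
  moreover have "0 \<le> B" by (simp add: B_def sum_nonneg)
  ultimately have "\<exists>C. 0 \<le> C \<and> (\<forall>e\<in>arcs G. AE x in leb (len e). q (Inner e x) \<le> C)" by blast
  from someI_ex[OF this] show "0 \<le> q_bound"
    "e \<in> arcs G \<Longrightarrow> AE x in leb (len e). q (Inner e x) \<le> q_bound"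
    unfolding q_bound_def[symmetric] by auto
qed

abbreviation "D \<equiv> form_domain G len V q \<gamma> \<sigma>"

abbreviation "a \<equiv> energy_form G len V q \<gamma> \<sigma>"

abbreviation "b \<equiv> L2_inner G len"

text \<open>
  The potential term of the energy form is the \<open>L\<^sup>2\<close> product of \<open>root_q e f\<close> and \<open>root_q e g\<close>, and so
  inherits the properties of a positive semidefinite form.
\<close>

definition root_q :: "'e \<Rightarrow> (('v, 'e) point \<Rightarrow> complex) \<Rightarrow> real \<Rightarrow> complex" where
  "root_q e f = (\<lambda>x. of_real (sqrt (q (Inner e x))) * f (Inner e x))"

abbreviation potential :: "(('v, 'e) point \<Rightarrow> complex) \<Rightarrow> real" where
  "potential f \<equiv> \<Sum>e\<in>arcs G. sqnorm (len e) (root_q e f)"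

abbreviation vertex_energy :: "(('v, 'e) point \<Rightarrow> complex) \<Rightarrow> real" where
  "vertex_energy f \<equiv> \<Sum>v\<in>verts G. \<gamma> v * (cmod (f (Vertex v)))\<^sup>2"

abbreviation point_energy :: "(('v, 'e) point \<Rightarrow> complex) \<Rightarrow> real" where
  "point_energy f \<equiv> \<Sum>\<^sub>\<infinity>p\<in>V. \<sigma> p * (cmod (f p))\<^sup>2"

lemma root_q_L2:
  assumes f: "f \<in> H" and e: "e \<in> arcs G"
  shows "root_q e f \<in> L2_on {0<..<len e}"
    "sqnorm (len e) (root_q e f) \<le>
      q_bound * sqnorm (len e) (\<lambda>x. f (Inner e x))"
proof -
  note [measurable] = q_measurable[OF e] L2_on_measurable[OF inner_L2[OF f e]]
  have sp: "space (leb (len e)) = {0<..<len e}" by (simp add: space_restrict_space)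
  have eq: "(cmod (root_q e f x))\<^sup>2 = q (Inner e x) * (cmod (f (Inner e x)))\<^sup>2" if "x \<in> {0<..<len e}" for x
    using q_nonneg[OF e that] by (simp add: root_q_def norm_mult power_mult_distrib)
  have le: "AE x in leb (len e). (cmod (root_q e f x))\<^sup>2 \<le> q_bound * (cmod (f (Inner e x)))\<^sup>2"
  proof -
    have "AE x in leb (len e). x \<in> {0<..<len e}" using AE_space[of "leb (len e)"] by (simp only: sp)
    with q_bound(2)[OF e] show ?thesis
      by eventually_elim (auto simp only: eq intro!: mult_right_mono zero_le_power2)
  qed
  have meas: "root_q e f \<in> borel_measurable (leb (len e))"
    unfolding root_q_def by measurable
  have bnd: "integrable (leb (len e)) (\<lambda>x. q_bound * (cmod (f (Inner e x)))\<^sup>2)"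
    using L2_on_square[OF inner_L2[OF f e]] by simp
  have int: "integrable (leb (len e)) (\<lambda>x. (cmod (root_q e f x))\<^sup>2)"
  proof (rule Bochner_Integration.integrable_bound[OF bnd])
    show "(\<lambda>x. (cmod (root_q e f x))\<^sup>2) \<in> borel_measurable (leb (len e))" using meas by measurable
    show "AE x in leb (len e). norm ((cmod (root_q e f x))\<^sup>2) \<le> norm (q_bound * (cmod (f (Inner e x)))\<^sup>2)"
      using le by eventually_elim (use q_bound(1) in simp)
  qed
  show "root_q e f \<in> L2_on {0<..<len e}" by (rule L2_onI[OF meas int])
  show "sqnorm (len e) (root_q e f) \<le>
      q_bound * sqnorm (len e) (\<lambda>x. f (Inner e x))"
    using integral_mono_AE[OF int bnd le] by simp
qed

lemma potential_eq_root_q: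
  assumes e: "e \<in> arcs G"
  shows "(LINT x|leb (len e). of_real (q (Inner e x)) * f (Inner e x) * cnj (g (Inner e x)))
    = (LINT x|leb (len e). root_q e f x * cnj (root_q e g x))"
proof (rule Bochner_Integration.integral_cong)
  fix x assume "x \<in> space (leb (len e))"
  then have "0 \<le> q (Inner e x)" using q_nonneg[OF e] by (simp add: space_restrict_space)
  then have "complex_of_real (q (Inner e x)) = of_real (sqrt (q (Inner e x))) * of_real (sqrt (q (Inner e x)))"
    by (simp flip: of_real_mult)
  then show "of_real (q (Inner e x)) * f (Inner e x) * cnj (g (Inner e x)) = root_q e f x * cnj (root_q e g x)"
    by (simp add: root_q_def)
qed simp

lemma hermitian_form_potential:
  assumes e: "e \<in> arcs G"
  shows "hermitian_form H (\<lambda>f g. LINT x|leb (len e). of_real (q (Inner e x)) * f (Inner e x) * cnj (g (Inner e x)))"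
  unfolding potential_eq_root_q[OF e]
  by (rule hermitian_form_pullback[OF hermitian_form_L2 H1_graph_subspace, where T = "root_q e"])
    (simp_all add: root_q_L2(1) e, auto simp: root_q_def algebra_simps)

text \<open>
  The form domain without extended reals: all terms of the energy but the last are finite on
  \<^term>\<open>H1_graph G len\<close>, since the potential is bounded and the graph is finite.
\<close>

definition summable_domain :: "(('v, 'e) point \<Rightarrow> complex) set" where
  "summable_domain = {f \<in> H. (\<lambda>p. \<sigma> p * (cmod (f p))\<^sup>2) summable_on V}"

lemma form_domain_eq: "D = summable_domain"
proof -
  have "energy G len V q \<gamma> \<sigma> f < \<infinity> \<longleftrightarrow> (\<lambda>p. \<sigma> p * (cmod (f p))\<^sup>2) summable_on V" if f: "f \<in> H" for f
  proof -
    have "(\<integral>\<^sup>+x. ennreal ((cmod (edge_deriv len f e x))\<^sup>2) \<partial>leb (len e)) < \<infinity>"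
      "(\<integral>\<^sup>+x. ennreal (q (Inner e x) * (cmod (f (Inner e x)))\<^sup>2) \<partial>leb (len e)) < \<infinity>"
      if e: "e \<in> arcs G" for e
    proof -
      show "(\<integral>\<^sup>+x. ennreal ((cmod (edge_deriv len f e x))\<^sup>2) \<partial>leb (len e)) < \<infinity>"
        using L2_on_square[OF edge_deriv_L2[OF f e]] by (simp add: nn_integral_eq_integral)
      have "(\<integral>\<^sup>+x. ennreal (q (Inner e x) * (cmod (f (Inner e x)))\<^sup>2) \<partial>leb (len e))
          = (\<integral>\<^sup>+x. ennreal ((cmod (root_q e f x))\<^sup>2) \<partial>leb (len e))"
        by (rule nn_integral_cong) (use q_nonneg[OF e] in
            \<open>auto simp: space_restrict_space root_q_def norm_mult power_mult_distrib\<close>)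
      also have "\<dots> < \<infinity>"
        using L2_on_square[OF root_q_L2(1)[OF f e]] by (simp add: nn_integral_eq_integral)
      finally show "(\<integral>\<^sup>+x. ennreal (q (Inner e x) * (cmod (f (Inner e x)))\<^sup>2) \<partial>leb (len e)) < \<infinity>" .
    qed
    then have "energy G len V q \<gamma> \<sigma> f < \<infinity> \<longleftrightarrow> (\<Sum>\<^sub>\<infinity>p\<in>V. ennreal (\<sigma> p * (cmod (f p))\<^sup>2)) < \<infinity>"
      unfolding energy_def using finite_arcs finite_verts
      by (simp add: less_top[symmetric] ennreal_sum_less_top)
    also have "\<dots> \<longleftrightarrow> (\<lambda>p. \<sigma> p * (cmod (f p))\<^sup>2) summable_on V"
      by (rule ennreal_infsum_finite_iff) (use \<sigma>_nonneg in simp)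
    finally show ?thesis .
  qed
  then show ?thesis by (auto simp: form_domain_def summable_domain_def)
qed

lemma D_subset_H: "D \<subseteq> H"
  by (auto simp: form_domain_eq summable_domain_def)

lemma D_H: "f \<in> D \<Longrightarrow> f \<in> H"
  using D_subset_H by blast

lemma point_interaction_summable:
  "f \<in> D \<Longrightarrow> (\<lambda>p. \<sigma> p * (cmod (f p))\<^sup>2) summable_on V"
  by (simp add: form_domain_eq summable_domain_def)

lemma D_subspace: "cfun.subspace D"
proof -
  have "f + g \<in> summable_domain" if f: "f \<in> summable_domain" and g: "g \<in> summable_domain" for f g
  proof -
    have "(\<lambda>p. \<sigma> p * (cmod ((f + g) p))\<^sup>2) summable_on V"
    proof (rule summable_on_comparison_test)
      show "(\<lambda>p. 2 * (\<sigma> p * (cmod (f p))\<^sup>2) + 2 * (\<sigma> p * (cmod (g p))\<^sup>2)) summable_on V"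
        using f g by (intro summable_on_add summable_on_cmult_right) (auto simp: summable_domain_def)
      show "\<sigma> p * (cmod ((f + g) p))\<^sup>2 \<le> 2 * (\<sigma> p * (cmod (f p))\<^sup>2) + 2 * (\<sigma> p * (cmod (g p))\<^sup>2)" if "p \<in> V" for p
        using mult_left_mono[OF cmod_add_square_le[of "f p" "g p"] \<sigma>_nonneg[OF that]] by (simp add: algebra_simps)
    qed (use \<sigma>_nonneg in auto)
    then show ?thesis using f g by (auto simp: summable_domain_def H1_graph_add)
  qed
  moreover have "(\<lambda>x. c * f x) \<in> summable_domain" if f: "f \<in> summable_domain" for f c
  proof -
    have "(\<lambda>p. (cmod c)\<^sup>2 * (\<sigma> p * (cmod (f p))\<^sup>2)) summable_on V"
      using f by (intro summable_on_cmult_right) (auto simp: summable_domain_def)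
    then have "(\<lambda>p. \<sigma> p * (cmod (c * f p))\<^sup>2) summable_on V"
      by (simp add: norm_mult power_mult_distrib mult.left_commute)
    then show ?thesis using f by (auto simp: summable_domain_def H1_graph_scale)
  qed
  moreover have "0 \<in> summable_domain" using cfun.subspace_0[OF H1_graph_subspace] by (simp add: summable_domain_def)
  ultimately show ?thesis unfolding form_domain_eq cfun.subspace_def by blast
qed

lemma hermitian_form_point_interactions:
  "hermitian_form D (\<lambda>f g. \<Sum>\<^sub>\<infinity>p\<in>V. of_real (\<sigma> p) * f p * cnj (g p))"
proof
  have sum: "(\<lambda>p. of_real (\<sigma> p) * f p * cnj (g p)) summable_on V" if f: "f \<in> D" and g: "g \<in> D" for f g
  proof (rule abs_summable_summable, rule summable_on_comparison_test)
    show "(\<lambda>p. \<sigma> p * (cmod (f p))\<^sup>2 + \<sigma> p * (cmod (g p))\<^sup>2) summable_on V"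
      by (intro summable_on_add point_interaction_summable f g)
    show "norm (of_real (\<sigma> p) * f p * cnj (g p)) \<le> \<sigma> p * (cmod (f p))\<^sup>2 + \<sigma> p * (cmod (g p))\<^sup>2" if "p \<in> V" for p
    proof -
      have "cmod (f p) * cmod (g p) \<le> (cmod (f p))\<^sup>2 + (cmod (g p))\<^sup>2"
        using sum_squares_bound[of "cmod (f p)" "cmod (g p)"]
          mult_nonneg_nonneg[OF norm_ge_zero[of "f p"] norm_ge_zero[of "g p"]]
        unfolding mult.assoc by linarith
      from mult_left_mono[OF this \<sigma>_nonneg[OF that]] show ?thesis
        using \<sigma>_nonneg[OF that] by (simp add: norm_mult distrib_left mult.assoc)
    qed
  qed simp
  fix f g h :: "('v, 'e) point \<Rightarrow> complex" and c :: complex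
  assume f: "f \<in> D" and h: "h \<in> D"
  show "(\<Sum>\<^sub>\<infinity>p\<in>V. of_real (\<sigma> p) * (c * f p) * cnj (h p)) = c * (\<Sum>\<^sub>\<infinity>p\<in>V. of_real (\<sigma> p) * f p * cnj (h p))"
    using infsum_cmult_right[of c "\<lambda>p. of_real (\<sigma> p) * f p * cnj (h p)" V] sum[OF f h]
    by (simp add: mult_ac)
  assume g: "g \<in> D"
  show "(\<Sum>\<^sub>\<infinity>p\<in>V. of_real (\<sigma> p) * (f + g) p * cnj (h p))
      = (\<Sum>\<^sub>\<infinity>p\<in>V. of_real (\<sigma> p) * f p * cnj (h p)) + (\<Sum>\<^sub>\<infinity>p\<in>V. of_real (\<sigma> p) * g p * cnj (h p))"
    using infsum_add[OF sum[OF f h] sum[OF g h]] by (simp add: distrib_left distrib_right)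
next
  fix f g :: "('v, 'e) point \<Rightarrow> complex"
  have "(\<Sum>\<^sub>\<infinity>p\<in>V. cnj (of_real (\<sigma> p) * f p * cnj (g p))) = cnj (\<Sum>\<^sub>\<infinity>p\<in>V. of_real (\<sigma> p) * f p * cnj (g p))"
    by (rule infsum_cnj)
  then show "(\<Sum>\<^sub>\<infinity>p\<in>V. of_real (\<sigma> p) * g p * cnj (f p)) = cnj (\<Sum>\<^sub>\<infinity>p\<in>V. of_real (\<sigma> p) * f p * cnj (g p))"
    by (simp add: mult_ac)
next
  fix f :: "('v, 'e) point \<Rightarrow> complex"
  assume f: "f \<in> D"
  have "(\<Sum>\<^sub>\<infinity>p\<in>V. of_real (\<sigma> p) * f p * cnj (f p)) = of_real (point_energy f)"
    unfolding weight_mult_cnj_self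
    by (rule infsumI[OF has_sum_of_real[OF has_sum_infsum[OF point_interaction_summable[OF f]]]])
  then show "0 \<le> Re (\<Sum>\<^sub>\<infinity>p\<in>V. of_real (\<sigma> p) * f p * cnj (f p))"
    using \<sigma>_nonneg by (simp only: Re_complex_of_real) (auto intro: infsum_nonneg)
qed (rule D_subspace)

lemma hermitian_form_energy: "hermitian_form D a"
  unfolding energy_form_def[abs_def]
  by (intro hermitian_form_add hermitian_form_sum hermitian_form_point_interactions hermitian_form_point
      hermitian_form_subset[OF hermitian_form_derivative] hermitian_form_subset[OF hermitian_form_potential]
      D_subspace D_subset_H \<gamma>_nonneg)

lemma hermitian_form_b: "hermitian_form D b"
  by (rule hermitian_form_subset[OF hermitian_form_L2_inner D_subspace D_subset_H])

sublocale a: hermitian_form D a by (rule hermitian_form_energy)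

sublocale b: hermitian_form D b by (rule hermitian_form_b)

lemma a_sq:
  assumes f: "f \<in> D"
  shows "a.sq f = kinetic f + potential f + vertex_energy f + point_energy f"
proof -
  have pot: "(\<Sum>e\<in>arcs G. LINT x|leb (len e). of_real (q (Inner e x)) * f (Inner e x) * cnj (f (Inner e x)))
    = of_real (potential f)"
    unfolding of_real_sum by (intro sum.cong refl) (simp only: potential_eq_root_q LINT_mult_cnj_self)
  have point: "(\<Sum>\<^sub>\<infinity>p\<in>V. of_real (\<sigma> p * (cmod (f p))\<^sup>2)) = complex_of_real (point_energy f)"
    by (rule infsumI[OF has_sum_of_real[OF has_sum_infsum[OF point_interaction_summable[OF f]]]])
  have "a f f = of_real (kinetic f + potential f + vertex_energy f + point_energy f)"
    unfolding energy_form_def pot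
    by (simp only: LINT_mult_cnj_self weight_mult_cnj_self point of_real_add of_real_sum)
  then show ?thesis by (simp only: a.sq_def Re_complex_of_real)
qed

lemma b_sq: "b.sq f = (\<Sum>e\<in>arcs G. sqnorm (len e) (\<lambda>x. f (Inner e x)))"
  by (simp only: b.sq_def L2_inner_def LINT_mult_cnj_self of_real_sum[symmetric] Re_complex_of_real)

section \<open>Compact embedding and closedness\<close>

lemma point_interaction_le:
  assumes f: "f \<in> D" and F: "finite F" "F \<subseteq> V"
  shows "(\<Sum>p\<in>F. \<sigma> p * (cmod (f p))\<^sup>2) \<le> point_energy f"
  using \<sigma>_nonneg by (intro finite_sum_le_infsum point_interaction_summable f F) auto

lemma energy_parts_nonneg:
  "0 \<le> kinetic f"
  "0 \<le> potential f"
  "0 \<le> vertex_energy f"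
  "0 \<le> point_energy f"
  using \<gamma>_nonneg \<sigma>_nonneg by (auto intro!: sum_nonneg infsum_nonneg integral_nonneg_AE)

lemma kinetic_le_energy:
  assumes f: "f \<in> D" and e: "e \<in> arcs G"
  shows "sqnorm (len e) (edge_deriv len f e) \<le> a.sq f"
proof -
  have "sqnorm (len e) (edge_deriv len f e)
      \<le> kinetic f"
    by (rule member_le_sum[OF e]) (auto intro: finite_arcs integral_nonneg_AE)
  then show ?thesis using energy_parts_nonneg[of f] a_sq[OF f] by linarith
qed

lemma edge_mass_le:
  assumes e: "e \<in> arcs G"
  shows "sqnorm (len e) (\<lambda>x. f (edge e x)) \<le> b.sq f"
  unfolding LINT_inner_eq_edge[symmetric] b_sq
  by (rule member_le_sum[OF e]) (auto intro: finite_arcs integral_nonneg_AE)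

lemma value_bound:
  assumes f: "f \<in> D" and e: "e \<in> arcs G" and x: "x \<in> {0..len e}" and r: "0 < r" "r \<le> len e"
  shows "(cmod (f (edge e x)))\<^sup>2 \<le> 2 * r * a.sq f + 2 / r * b.sq f"
proof -
  interpret s: sobolev "len e" "\<lambda>x. f (edge e x)" "edge_deriv len f e"
    by (rule H1_graph_sobolev[OF D_H[OF f] e])
  have "(cmod (f (edge e x)))\<^sup>2 \<le> 2 * r * sqnorm (len e) (edge_deriv len f e)
      + 2 / r * sqnorm (len e) (\<lambda>t. f (edge e t))"
    by (rule s.sup_bound) (use x r in auto)
  also have "\<dots> \<le> 2 * r * a.sq f + 2 / r * b.sq f"
    by (intro add_mono mult_left_mono kinetic_le_energy edge_mass_le f e) (use r in auto)
  finally show ?thesis .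
qed

definition value_const :: real where
  "value_const = (\<Sum>e\<in>arcs G. 2 * len e + 2 / len e)"

lemma value_const_nonneg: "0 \<le> value_const"
  unfolding value_const_def using len_pos by (intro sum_nonneg add_nonneg_nonneg) (auto simp: less_imp_le)

lemma value_const_bound:
  assumes f: "f \<in> D"
  shows "(cmod (f p))\<^sup>2 \<le> value_const * (a.sq f + b.sq f)"
proof (cases "p \<in> points G len")
  case True
  then obtain e x where e: "e \<in> arcs G" "x \<in> {0..len e}" "p = edge e x" using point_on_edge by blast
  have l: "0 < len e" by (rule len_pos[OF e(1)])
  have pos: "0 \<le> a.sq f" "0 \<le> b.sq f" using f by (auto intro: a.sq_nonneg b.sq_nonneg)
  have "2 * len e + 2 / len e \<le> value_const"
    unfolding value_const_def
    by (rule member_le_sum[OF e(1)]) (use len_pos finite_arcs in \<open>auto intro!: add_nonneg_nonneg simp: less_imp_le\<close>)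
  then have c: "2 * len e \<le> value_const" "2 / len e \<le> value_const" using l by (auto intro: order_trans[rotated])
  have "(cmod (f p))\<^sup>2 \<le> 2 * len e * a.sq f + 2 / len e * b.sq f"
    unfolding e(3) by (rule value_bound[OF f e(1,2) l]) simp
  also have "\<dots> \<le> value_const * a.sq f + value_const * b.sq f"
    by (intro add_mono mult_right_mono c pos)
  finally show ?thesis by (simp add: distrib_left)
next
  case False
  show ?thesis
    using value_const_nonneg False H1_graph_zero_outside[OF D_H[OF f]] a.sq_nonneg[OF f] b.sq_nonneg[OF f] by simp
qed

text \<open>
  With mass zero, the bound on the values tends to zero with the length \<open>r\<close> of the window. This also
  covers the vertices, each of which is the end of an edge.
\<close>

lemma b_definite:
  assumes f: "f \<in> D" and zero: "b.sq f = 0"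
  shows "f = 0"
proof
  fix p
  show "f p = 0 p"
  proof (cases "p \<in> points G len")
    case True
    then obtain e x where e: "e \<in> arcs G" "x \<in> {0..len e}" "p = edge e x" using point_on_edge by blast
    define A where "A = a.sq f + 1"
    have A: "0 < A" unfolding A_def using a.sq_nonneg[OF f] by simp
    show ?thesis
    proof (rule ccontr)
      assume "f p \<noteq> 0 p"
      define c where "c = (cmod (f p))\<^sup>2"
      have c: "c > 0" using \<open>f p \<noteq> 0 p\<close> by (simp add: c_def)
      define r where "r = min (len e) (c / (4 * A))"
      have r: "0 < r" "r \<le> len e" using len_pos[OF e(1)] c A by (auto simp: r_def)
      have "c \<le> 2 * r * a.sq f" using value_bound[OF f e(1,2) r] zero by (simp add: c_def e(3))
      also have "\<dots> \<le> 2 * r * A" using r by (simp add: A_def)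
      also have "\<dots> \<le> 2 * (c / (4 * A)) * A"
        using A c by (intro mult_mono mult_left_mono) (auto simp: r_def less_imp_le)
      also have "\<dots> = c / 2" using A by simp
      finally show False using c by simp
    qed
  qed (simp add: H1_graph_zero_outside[OF D_H[OF f]])
qed

definition total_length :: real where
  "total_length = (\<Sum>e\<in>arcs G. len e)"

lemma len_le_total: "e \<in> arcs G \<Longrightarrow> len e \<le> total_length"
  unfolding total_length_def by (rule member_le_sum) (auto intro: finite_arcs less_imp_le len_pos)

lemma total_length_pos: "0 < total_length"
  using arcs_nonempty len_le_total len_pos by (meson all_not_in_conv less_le_trans)

definition grid_point :: "nat \<Rightarrow> 'e \<Rightarrow> nat \<Rightarrow> ('v, 'e) point" where
  "grid_point m e i = edge e (real i * (len e / real m))"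

text \<open>
  This estimate yields both the compactness of the embedding, because finitely many point values
  control the mass up to a small multiple of the energy, and the quadratic growth of the eigenvalues,
  because that multiple decreases like \<open>1 / m\<^sup>2\<close>.
\<close>

lemma grid_estimate:
  assumes f: "f \<in> D" and m: "0 < m"
  shows "b.sq f \<le> 2 * (total_length / real m) * (\<Sum>e\<in>arcs G. \<Sum>i<m. (cmod (f (grid_point m e i)))\<^sup>2)
    + 2 * (total_length / real m)\<^sup>2 * a.sq f"
proof -
  have le: "len e / real m \<le> total_length / real m" "0 \<le> len e / real m" if "e \<in> arcs G" for e
    using len_le_total[OF that] len_pos[OF that] by (auto intro: divide_right_mono)
  have "b.sq f \<le> (\<Sum>e\<in>arcs G. 2 * (total_length / real m) * (\<Sum>i<m. (cmod (f (grid_point m e i)))\<^sup>2)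
      + 2 * (total_length / real m)\<^sup>2 * sqnorm (len e) (edge_deriv len f e))"
    unfolding b_sq
  proof (rule sum_mono)
    fix e assume e: "e \<in> arcs G"
    interpret s: sobolev "len e" "\<lambda>x. f (edge e x)" "edge_deriv len f e"
      by (rule H1_graph_sobolev[OF D_H[OF f] e])
    have "sqnorm (len e) (\<lambda>t. f (Inner e t)) \<le>
      2 * (len e / real m) * (\<Sum>i<m. (cmod (f (grid_point m e i)))\<^sup>2)
      + 2 * (len e / real m)\<^sup>2 * sqnorm (len e) (edge_deriv len f e)"
      unfolding LINT_inner_eq_edge grid_point_def by (rule s.grid_bound[OF m])
    also have "\<dots> \<le> 2 * (total_length / real m) * (\<Sum>i<m. (cmod (f (grid_point m e i)))\<^sup>2)
      + 2 * (total_length / real m)\<^sup>2 * sqnorm (len e) (edge_deriv len f e)"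
      by (intro add_mono mult_right_mono mult_left_mono power_mono le e) (auto intro!: sum_nonneg integral_nonneg_AE)
    finally show "sqnorm (len e) (\<lambda>t. f (Inner e t)) \<le> \<dots>" .
  qed
  also have "\<dots> = 2 * (total_length / real m) * (\<Sum>e\<in>arcs G. \<Sum>i<m. (cmod (f (grid_point m e i)))\<^sup>2)
      + 2 * (total_length / real m)\<^sup>2 * kinetic f"
    by (simp only: sum.distrib sum_distrib_left)
  also have "\<dots> \<le> 2 * (total_length / real m) * (\<Sum>e\<in>arcs G. \<Sum>i<m. (cmod (f (grid_point m e i)))\<^sup>2)
    + 2 * (total_length / real m)\<^sup>2 * a.sq f"
    using energy_parts_nonneg[of f] a_sq[OF f] by (intro add_left_mono mult_left_mono) auto
  finally show ?thesis .
qed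

text \<open>
  Point values are bounded along the sequence, so a diagonal subsequence converges at the countably
  many points of all grids. For its differences the second term of the grid estimate is small when the
  grid is fine, and on a fixed grid the first term tends to zero.
\<close>

lemma compact_embedding:
  assumes f: "\<And>n. f n \<in> D" and M: "\<And>n. a.sq (f n) + b.sq (f n) \<le> M"
  shows "\<exists>r. strict_mono (r :: nat \<Rightarrow> nat) \<and>
    (\<forall>\<epsilon>>0. \<exists>N. \<forall>m\<ge>N. \<forall>n\<ge>N. b.sq (f (r m) - f (r n)) < \<epsilon>)"
proof -
  define S where "S = (\<lambda>(m, e, i). grid_point m e i) ` (UNIV \<times> arcs G \<times> UNIV)"
  have S: "countable S" unfolding S_def by (auto intro!: countable_image countable_SIGMA countable_finite[OF finite_arcs])
  note vc = value_const_nonneg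
  have bound: "norm (f n p) \<le> sqrt (value_const * M)" for n p
    using order_trans[OF value_const_bound[OF f] mult_left_mono[OF M vc]] by (intro real_le_rsqrt)
  obtain r :: "nat \<Rightarrow> nat" where r: "strict_mono r" and conv: "\<And>p. p \<in> S \<Longrightarrow> \<exists>l. (\<lambda>n. f (r n) p) \<longlonglongrightarrow> l"
    using function_convergent_subsequence[OF S, of f] bound by blast
  define g where "g p = lim (\<lambda>n. f (r n) p)" for p
  have lim: "(\<lambda>n. f (r n) (grid_point m e i)) \<longlonglongrightarrow> g (grid_point m e i)" if "e \<in> arcs G" for m e i
    using conv[of "grid_point m e i"] that unfolding g_def convergent_def[symmetric] convergent_LIMSEQ_iff
    by (force simp: S_def)
  have "\<exists>N. \<forall>m\<ge>N. \<forall>n\<ge>N. b.sq (f (r m) - f (r n)) < \<epsilon>" if \<epsilon>: "\<epsilon> > 0" for \<epsilon>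
  proof -
    have "(\<lambda>k. 8 * M * (total_length * inverse (real (Suc k)))\<^sup>2) \<longlonglongrightarrow> 8 * M * (total_length * 0)\<^sup>2"
      by (intro tendsto_intros LIMSEQ_inverse_real_of_nat)
    then have "\<forall>\<^sub>F k in sequentially. 8 * M * (total_length * inverse (real (Suc k)))\<^sup>2 < \<epsilon> / 2"
      by (rule order_tendstoD(2)) (use \<epsilon> in simp)
    then obtain k where k: "8 * M * (total_length * inverse (real (Suc k)))\<^sup>2 < \<epsilon> / 2"
      using eventually_happens by force
    define m where "m = Suc k"
    have m: "0 < m" "8 * M * (total_length / real m)\<^sup>2 < \<epsilon> / 2" using k by (simp_all only: m_def zero_less_Suc divide_inverse)
    define T where "T n = (\<Sum>e\<in>arcs G. \<Sum>i<m. (cmod (f (r n) (grid_point m e i) - g (grid_point m e i)))\<^sup>2)" for n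
    have "(\<lambda>n. 8 * (total_length / real m) * T n) \<longlonglongrightarrow>
        8 * (total_length / real m) * (\<Sum>e\<in>arcs G. \<Sum>i<m. (cmod (g (grid_point m e i) - g (grid_point m e i)))\<^sup>2)"
      unfolding T_def by (intro tendsto_mult tendsto_const tendsto_sum tendsto_power tendsto_norm tendsto_diff lim)
    then have "\<forall>\<^sub>F n in sequentially. 8 * (total_length / real m) * T n < \<epsilon> / 2"
      by (rule order_tendstoD(2)) (use \<epsilon> in simp)
    then obtain N where N: "\<And>n. n \<ge> N \<Longrightarrow> 8 * (total_length / real m) * T n < \<epsilon> / 2"
      by (auto simp: eventually_sequentially)
    have "b.sq (f (r i) - f (r j)) < \<epsilon>" if ij: "i \<ge> N" "j \<ge> N" for i j
    proof -
      have "(\<Sum>e\<in>arcs G. \<Sum>k<m. (cmod ((f (r i) - f (r j)) (grid_point m e k)))\<^sup>2) \<le> 2 * T i + 2 * T j"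
      proof -
        have "(cmod ((f (r i) - f (r j)) p))\<^sup>2 \<le> 2 * (cmod (f (r i) p - g p))\<^sup>2 + 2 * (cmod (f (r j) p - g p))\<^sup>2" for p
          using cmod_add_square_le[of "f (r i) p - g p" "g p - f (r j) p"] by (simp add: norm_minus_commute)
        then have "(\<Sum>e\<in>arcs G. \<Sum>k<m. (cmod ((f (r i) - f (r j)) (grid_point m e k)))\<^sup>2)
            \<le> (\<Sum>e\<in>arcs G. \<Sum>k<m. 2 * (cmod (f (r i) (grid_point m e k) - g (grid_point m e k)))\<^sup>2
              + 2 * (cmod (f (r j) (grid_point m e k) - g (grid_point m e k)))\<^sup>2)"
          by (intro sum_mono)
        then show ?thesis by (simp only: T_def sum.distrib sum_distrib_left)
      qed
      moreover have "a.sq (f (r i) - f (r j)) \<le> 4 * M"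
        using a.sq_diff_le[OF f f, of "r i" "r j"] M[of "r i"] M[of "r j"]
          b.sq_nonneg[OF f, of "r i"] b.sq_nonneg[OF f, of "r j"] by linarith
      ultimately have "2 * (total_length / real m) * (\<Sum>e\<in>arcs G. \<Sum>k<m. (cmod ((f (r i) - f (r j)) (grid_point m e k)))\<^sup>2)
          + 2 * (total_length / real m)\<^sup>2 * a.sq (f (r i) - f (r j))
          \<le> 2 * (total_length / real m) * (2 * T i + 2 * T j) + 2 * (total_length / real m)\<^sup>2 * (4 * M)"
        using total_length_pos by (intro add_mono mult_left_mono) auto
      then have "b.sq (f (r i) - f (r j)) \<le> 2 * (total_length / real m) * (2 * T i + 2 * T j) + 2 * (total_length / real m)\<^sup>2 * (4 * M)"
        by (rule order_trans[OF grid_estimate[OF a.mem_diff[OF f f] m(1)]])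
      also have "\<dots> = (8 * (total_length / real m) * T i + 8 * (total_length / real m) * T j) / 2
          + 8 * M * (total_length / real m)\<^sup>2" by (simp add: distrib_left)
      also have "\<dots> < \<epsilon>"
      proof -
        have "(u + v) / 2 + w < \<epsilon>" if "u < \<epsilon> / 2" "v < \<epsilon> / 2" "w < \<epsilon> / 2" for u v w :: real
          using that by (simp add: field_simps)
        from this[OF N[OF ij(1)] N[OF ij(2)] m(2)] show ?thesis .
      qed
      finally show ?thesis .
    qed
    then show ?thesis by blast
  qed
  then show ?thesis using r by blast
qed

text \<open>
  The function \<open>g\<close> is any weak derivative of \<open>k\<close>; in the proof of closedness it is a limit in \<open>L\<^sup>2\<close>.
\<close>

lemma edge_deriv_diff_sq:
  assumes e: "e \<in> arcs G" and h: "h \<in> H" and k: "k \<in> H" and g: "g \<in> L2_on {0<..<len e}"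
    and AE: "AE x in leb (len e). edge_deriv len k e x = g x"
  shows "L2.sq {0<..<len e} (edge_deriv len (h - k) e) = L2.sq {0<..<len e} (edge_deriv len h e - g)"
proof -
  have hk: "h - k \<in> H" by (rule cfun.subspace_diff[OF H1_graph_subspace h k])
  have "AE x in leb (len e). edge_deriv len h e x = edge_deriv len (h - k) e x + edge_deriv len k e x"
    using H1_graph_add(2)[OF hk k e] by simp
  with AE have "AE x in leb (len e). (cmod (edge_deriv len (h - k) e x))\<^sup>2 = (cmod (edge_deriv len h e x - g x))\<^sup>2"
    by eventually_elim simp
  then show ?thesis
    unfolding L2_sq fun_diff_def
    by (intro integral_cong_AE borel_measurable_integrable L2_on_square edge_deriv_L2[OF _ e] hk[unfolded fun_diff_def]
        L2_on_diff g h)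
qed

lemma form_Cauchy_uniform_limit:
  assumes f: "\<And>n :: nat. f n \<in> D"
    and cauchy: "\<forall>\<epsilon>>0. \<exists>N. \<forall>m\<ge>N. \<forall>n\<ge>N. a.sq (f m - f n) + b.sq (f m - f n) < \<epsilon>"
  obtains F where "uniform_limit UNIV f F sequentially"
proof -
  have dD: "f m - f n \<in> D" for m n by (intro a.mem_diff f)
  have pos: "0 \<le> a.sq (f m - f n)" "0 \<le> b.sq (f m - f n)" for m n
    using a.sq_nonneg b.sq_nonneg dD by blast+
  note vc = value_const_nonneg
  have "\<forall>\<epsilon>>0. \<exists>N. \<forall>m n p. N \<le> m \<and> N \<le> n \<and> True \<longrightarrow> dist (f m p) (f n p) < \<epsilon>"
  proof (intro allI impI)
    fix \<epsilon> :: real assume \<epsilon>: "\<epsilon> > 0"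
    then have "\<epsilon>\<^sup>2 / (value_const + 1) > 0" using vc by simp
    with cauchy obtain N
      where N: "\<And>m n. m \<ge> N \<Longrightarrow> n \<ge> N \<Longrightarrow> a.sq (f m - f n) + b.sq (f m - f n) < \<epsilon>\<^sup>2 / (value_const + 1)" by blast
    have "dist (f m p) (f n p) < \<epsilon>" if "m \<ge> N" "n \<ge> N" for m n p
    proof -
      have "(cmod ((f m - f n) p))\<^sup>2 \<le> value_const * (a.sq (f m - f n) + b.sq (f m - f n))"
        by (rule value_const_bound[OF dD])
      also have "\<dots> \<le> (value_const + 1) * (a.sq (f m - f n) + b.sq (f m - f n))"
        using pos by (intro mult_right_mono add_nonneg_nonneg) auto
      also have "\<dots> < \<epsilon>\<^sup>2"
        using N[OF that] vc by (simp add: less_divide_eq mult.commute)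
      finally have "cmod ((f m - f n) p) < \<epsilon>" by (rule power2_less_imp_less) (use \<epsilon> in simp)
      then show ?thesis by (simp add: dist_norm)
    qed
    then show "\<exists>N. \<forall>m n p. N \<le> m \<and> N \<le> n \<and> True \<longrightarrow> dist (f m p) (f n p) < \<epsilon>" by blast
  qed
  from uniformly_convergent_eq_cauchy[of "\<lambda>_. True" f, THEN iffD2, OF this]
  obtain F where F: "\<forall>\<epsilon>>0. \<exists>N. \<forall>n p. N \<le> n \<and> True \<longrightarrow> dist (f n p) (F p) < \<epsilon>" by blast
  then show thesis
    by (intro that[of F]) (simp add: uniform_limit_iff eventually_sequentially)
qed

text \<open>
  A Cauchy sequence converges uniformly, because the form controls the values, and its edgewise
  derivatives converge in \<open>L\<^sup>2\<close> to weak derivatives of the limit. The infinite sum over \<open>V\<close> is treated by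
  lower semicontinuity: the bound on the differences of two terms holds for each finite partial sum,
  survives the passage to the limit in one of them, and then holds for the whole sum.
\<close>

lemma form_complete:
  assumes f: "\<And>n :: nat. f n \<in> D"
    and cauchy: "\<forall>\<epsilon>>0. \<exists>N. \<forall>m\<ge>N. \<forall>n\<ge>N. a.sq (f m - f n) + b.sq (f m - f n) < \<epsilon>"
  shows "\<exists>g\<in>D. (\<lambda>n. a.sq (f n - g) + b.sq (f n - g)) \<longlonglongrightarrow> 0"
proof -
  have dD: "f m - f n \<in> D" for m n by (intro a.mem_diff f)
  have pos: "0 \<le> a.sq (f m - f n)" "0 \<le> b.sq (f m - f n)" for m n
    using a.sq_nonneg b.sq_nonneg dD by blast+
  obtain F where unif: "uniform_limit UNIV f F sequentially"
    by (rule form_Cauchy_uniform_limit[OF f cauchy])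
  have pointwise: "(\<lambda>n. f n p) \<longlonglongrightarrow> F p" for p by (rule tendsto_uniform_limitI[OF unif]) simp
  have f_c: "continuous_on {0..len e} (\<lambda>x. f n (edge e x))" if "e \<in> arcs G" for n e
    using H1_graph_sobolev[OF D_H[OF f] that] by (simp add: sobolev_def)
  have edge_lim: "uniform_limit {0..len e} (\<lambda>n x. f n (edge e x)) (\<lambda>x. F (edge e x)) sequentially" for e
    by (rule uniform_limit_compose'[OF unif]) simp
  have edge_c: "continuous_on {0..len e} (\<lambda>x. F (edge e x))" if "e \<in> arcs G" for e
    by (rule uniform_limit_theorem[OF _ edge_lim]) (use f_c[OF that] in auto)
  have mass: "(\<lambda>n. sqnorm (len e) (\<lambda>x. f n (edge e x) - F (edge e x))) \<longlonglongrightarrow> 0" if e: "e \<in> arcs G" for e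
    by (rule uniform_limit_sqnorm[OF len_pos[OF e] f_c[OF e] edge_lim])
  have "\<exists>g\<in>L2_on {0<..<len e}. (\<lambda>n. L2.sq {0<..<len e} (edge_deriv len (f n) e - g)) \<longlonglongrightarrow> 0" if e: "e \<in> arcs G" for e
  proof (rule Riesz_Fischer)
    show "edge_deriv len (f n) e \<in> L2_on {0<..<len e}" for n by (rule edge_deriv_L2[OF D_H[OF f] e])
    fix \<epsilon> :: real assume "\<epsilon> > 0"
    with cauchy obtain N where N: "\<And>m n. m \<ge> N \<Longrightarrow> n \<ge> N \<Longrightarrow> a.sq (f m - f n) + b.sq (f m - f n) < \<epsilon>" by blast
    have "L2.sq {0<..<len e} (edge_deriv len (f m) e - edge_deriv len (f n) e) < \<epsilon>" if "m \<ge> N" "n \<ge> N" for m n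
    proof -
      have "L2.sq {0<..<len e} (edge_deriv len (f m) e - edge_deriv len (f n) e) = L2.sq {0<..<len e} (edge_deriv len (f m - f n) e)"
        by (rule edge_deriv_diff_sq[OF e D_H[OF f] D_H[OF f], symmetric]) (auto intro: edge_deriv_L2[OF D_H[OF f] e])
      also have "\<dots> \<le> a.sq (f m - f n)" unfolding L2_sq by (rule kinetic_le_energy[OF dD e])
      finally show ?thesis using N[OF that] pos(2)[of m n] by linarith
    qed
    then show "\<exists>N. \<forall>m\<ge>N. \<forall>n\<ge>N. L2.sq {0<..<len e} (edge_deriv len (f m) e - edge_deriv len (f n) e) < \<epsilon>" by blast
  qed
  then have "\<forall>e\<in>arcs G. \<exists>g. g \<in> L2_on {0<..<len e} \<and> (\<lambda>n. L2.sq {0<..<len e} (edge_deriv len (f n) e - g)) \<longlonglongrightarrow> 0" by blast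
  from bchoice[OF this] obtain g where g: "\<And>e. e \<in> arcs G \<Longrightarrow> g e \<in> L2_on {0<..<len e}"
    and g_lim: "\<And>e. e \<in> arcs G \<Longrightarrow> (\<lambda>n. L2.sq {0<..<len e} (edge_deriv len (f n) e - g e)) \<longlonglongrightarrow> 0" by blast
  have sob: "sobolev (len e) (\<lambda>x. F (edge e x)) (g e)" if e: "e \<in> arcs G" for e
  proof
    show "weak_derivative {0<..<len e} (\<lambda>x. F (edge e x)) (g e)"
    proof (rule weak_derivative_limit[where f = "\<lambda>n x. f n (edge e x)" and g = "\<lambda>n. edge_deriv len (f n) e"])
      show "(\<lambda>x. f n (edge e x)) \<in> L2_on {0<..<len e}" "weak_derivative {0<..<len e} (\<lambda>x. f n (edge e x)) (edge_deriv len (f n) e)" for n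
        using H1_graph_sobolev[OF D_H[OF f] e, of n] continuous_on_L2_on by (auto simp: sobolev_def)
      show "(\<lambda>n. L2.sq {0<..<len e} ((\<lambda>x. f n (edge e x)) - (\<lambda>x. F (edge e x)))) \<longlonglongrightarrow> 0"
        unfolding L2_sq fun_diff_def by (rule mass[OF e])
    qed (intro edge_deriv_L2 D_H f e g g_lim continuous_on_L2_on edge_c)+
  qed (intro len_pos edge_c g e)+
  have F0: "F p = 0" if "p \<notin> points G len" for p
    using pointwise[of p] H1_graph_zero_outside[OF D_H[OF f] that] by (simp add: LIMSEQ_const_iff)
  have FH: "F \<in> H" and Fd: "\<And>e. e \<in> arcs G \<Longrightarrow> AE x in leb (len e). edge_deriv len F e x = g e x"
    using H1_graph_of_sobolev[of F g] sob F0 by auto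
  have dH: "f n - F \<in> H" for n by (rule cfun.subspace_diff[OF H1_graph_subspace D_H[OF f] FH])
  have part: "(\<Sum>p\<in>A. \<sigma> p * (cmod ((f n - F) p))\<^sup>2) \<le> \<epsilon>"
    if N: "\<And>m. m \<ge> N \<Longrightarrow> a.sq (f n - f m) + b.sq (f n - f m) < \<epsilon>" and A: "finite A" "A \<subseteq> V" for n N \<epsilon> A
  proof (rule LIMSEQ_le_const2)
    show "(\<lambda>m. \<Sum>p\<in>A. \<sigma> p * (cmod ((f n - f m) p))\<^sup>2) \<longlonglongrightarrow> (\<Sum>p\<in>A. \<sigma> p * (cmod ((f n - F) p))\<^sup>2)"
      unfolding fun_diff_def by (intro tendsto_intros pointwise)
    have "(\<Sum>p\<in>A. \<sigma> p * (cmod ((f n - f m) p))\<^sup>2) \<le> \<epsilon>" if "m \<ge> N" for m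
      using point_interaction_le[OF dD A, of n m] a_sq[OF dD, of n m] energy_parts_nonneg[of "f n - f m"]
        pos(2)[of n m] N[OF that] by linarith
    then show "\<exists>N. \<forall>m\<ge>N. (\<Sum>p\<in>A. \<sigma> p * (cmod ((f n - f m) p))\<^sup>2) \<le> \<epsilon>" by blast
  qed
  have point: "(\<lambda>p. \<sigma> p * (cmod ((f n - F) p))\<^sup>2) summable_on V \<and> point_energy (f n - F) \<le> \<epsilon>"
    if N: "\<And>m. m \<ge> N \<Longrightarrow> a.sq (f n - f m) + b.sq (f n - f m) < \<epsilon>" for n N \<epsilon>
  proof
    show s: "(\<lambda>p. \<sigma> p * (cmod ((f n - F) p))\<^sup>2) summable_on V"
      using \<sigma>_nonneg part[OF N]
      by (intro nonneg_bdd_above_summable_on bdd_aboveI2[where M = \<epsilon>]) auto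
    show "point_energy (f n - F) \<le> \<epsilon>"
      by (rule infsum_le_finite_sums[OF s]) (rule part[OF N])
  qed
  obtain N1 where N1: "\<And>m n. m \<ge> N1 \<Longrightarrow> n \<ge> N1 \<Longrightarrow> a.sq (f m - f n) + b.sq (f m - f n) < 1"
    using cauchy by (metis zero_less_one)
  then have "f N1 - F \<in> D"
    using dH[of N1] point[of N1 N1 1] by (simp add: form_domain_eq summable_domain_def)
  from a.mem_diff[OF f[of N1] this] have FD: "F \<in> D" by simp
  have dD': "f n - F \<in> D" for n by (rule a.mem_diff[OF f FD])
  have pointL: "(\<lambda>n. point_energy (f n - F)) \<longlonglongrightarrow> 0"
    unfolding LIMSEQ_def
  proof (intro allI impI)
    fix \<epsilon> :: real assume "\<epsilon> > 0"
    then have "\<epsilon> / 2 > 0" by simp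
    with cauchy obtain N where N: "\<And>m n. m \<ge> N \<Longrightarrow> n \<ge> N \<Longrightarrow> a.sq (f m - f n) + b.sq (f m - f n) < \<epsilon> / 2" by blast
    have "dist (point_energy (f n - F)) 0 < \<epsilon>" if "n \<ge> N" for n
      using point[of N n "\<epsilon> / 2"] N[OF that] energy_parts_nonneg(4)[of "f n - F"] \<open>\<epsilon> > 0\<close> by simp
    then show "\<exists>N. \<forall>n\<ge>N. dist (point_energy (f n - F)) 0 < \<epsilon>" by blast
  qed
  have "(\<lambda>n. vertex_energy (f n - F)) \<longlonglongrightarrow> (\<Sum>v\<in>verts G. \<gamma> v * (cmod (F (Vertex v) - F (Vertex v)))\<^sup>2)"
    unfolding fun_diff_def by (intro tendsto_intros pointwise)
  then have vertL: "(\<lambda>n. vertex_energy (f n - F)) \<longlonglongrightarrow> 0" by simp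
  have mass': "(\<lambda>n. sqnorm (len e) (\<lambda>x. (f n - F) (Inner e x))) \<longlonglongrightarrow> 0" if "e \<in> arcs G" for e
    using mass[OF that] unfolding LINT_inner_eq_edge by (simp add: fun_diff_def)
  have "(\<lambda>n. sqnorm (len e) (root_q e (f n - F))) \<longlonglongrightarrow> 0" if e: "e \<in> arcs G" for e
  proof (rule tendsto_sandwich[OF _ _ tendsto_const])
    show "(\<lambda>n. q_bound * sqnorm (len e) (\<lambda>x. (f n - F) (Inner e x))) \<longlonglongrightarrow> 0"
      using tendsto_mult_right_zero[OF mass'[OF e], of q_bound] by simp
    show "\<forall>\<^sub>F n in sequentially. 0 \<le> sqnorm (len e) (root_q e (f n - F))"
      by (intro always_eventually allI integral_nonneg_AE) auto
    show "\<forall>\<^sub>F n in sequentially. (sqnorm (len e) (root_q e (f n - F)))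
        \<le> q_bound * sqnorm (len e) (\<lambda>x. (f n - F) (Inner e x))"
      by (intro always_eventually allI root_q_L2(2) dH e)
  qed
  then have potL: "(\<lambda>n. potential (f n - F)) \<longlonglongrightarrow> 0"
    by (rule tendsto_null_sum)
  have "(\<lambda>n. sqnorm (len e) (edge_deriv len (f n - F) e)) \<longlonglongrightarrow> 0" if e: "e \<in> arcs G" for e
    using g_lim[OF e] edge_deriv_diff_sq[OF e D_H[OF f] FH g[OF e] Fd[OF e]] unfolding L2_sq by simp
  then have kinL: "(\<lambda>n. kinetic (f n - F)) \<longlonglongrightarrow> 0"
    by (rule tendsto_null_sum)
  have "(\<lambda>n. a.sq (f n - F)) \<longlonglongrightarrow> 0 + 0 + 0 + 0"
    unfolding a_sq[OF dD'] by (intro tendsto_add kinL potL vertL pointL)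
  moreover have "(\<lambda>n. b.sq (f n - F)) \<longlonglongrightarrow> 0"
    unfolding b_sq by (rule tendsto_null_sum) (rule mass')
  ultimately have "(\<lambda>n. a.sq (f n - F) + b.sq (f n - F)) \<longlonglongrightarrow> 0"
    using tendsto_add by fastforce
  then show ?thesis using FD by blast
qed

end

section \<open>Bump functions\<close>

context finite_metric_graph begin

text \<open>
  The condition \<open>0 < x < len e\<close> makes the function vanish off the graph, as elements of
  \<^const>\<open>H1_graph\<close> do.
\<close>

definition bump :: "'e \<Rightarrow> real \<Rightarrow> real \<Rightarrow> ('v, 'e) point \<Rightarrow> complex" where
  "bump e v \<epsilon> p = (case p of Vertex _ \<Rightarrow> 0
     | Inner e' x \<Rightarrow> if e' = e \<and> 0 < x \<and> x < len e then of_real (plateau (v - \<epsilon>) v \<epsilon> x) else 0)"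

context
  fixes e v \<epsilon>
  assumes e: "e \<in> arcs G" and \<epsilon>: "0 < \<epsilon>" "0 < v - \<epsilon>" "v + \<epsilon> < len e"
begin

lemma bump_edge:
  assumes "e' \<in> arcs G" "x \<in> {0..len e'}"
  shows "bump e v \<epsilon> (edge e' x) = (if e' = e then of_real (plateau (v - \<epsilon>) v \<epsilon> x) else 0)"
  using plateau_outside[of \<epsilon> "v - \<epsilon>" v x] \<epsilon> assms len_pos[OF assms(1)]
  by (auto simp: bump_def edge_point_def)

lemma bump_center: "bump e v \<epsilon> (Inner e v) = 1"
  using \<epsilon> plateau_eq_1[of \<epsilon> "v - \<epsilon>" v v] by (simp add: bump_def)

lemma bump_away: "x \<le> v - \<epsilon> \<or> v + \<epsilon> \<le> x \<Longrightarrow> bump e v \<epsilon> (Inner e' x) = 0"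
  using plateau_outside[of \<epsilon> "v - \<epsilon>" v x] \<epsilon> by (auto simp: bump_def)

lemma bump_sobolev:
  assumes "e' \<in> arcs G"
  shows "sobolev (len e') (\<lambda>x. bump e v \<epsilon> (edge e' x)) (\<lambda>x. if e' = e then of_real (plateau' (v - \<epsilon>) v \<epsilon> x) else 0)"
proof (cases "e' = e")
  case True
  have "sobolev (len e) (\<lambda>x. of_real (plateau (v - \<epsilon>) v \<epsilon> x)) (\<lambda>x. of_real (plateau' (v - \<epsilon>) v \<epsilon> x))"
    by unfold_locales
      (intro len_pos e continuous_on_of_real continuous_plateau continuous_real_L2_on continuous_plateau'
        weak_derivative_of_C1 plateau_has_derivative)+
  then show ?thesis
    using True by (subst sobolev_cong[OF bump_edge[OF assms]]) auto
next
  case False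
  have "sobolev (len e') (\<lambda>x. 0) (\<lambda>x. 0)"
    using len_pos[OF assms] by unfold_locales (auto intro!: continuous_on_L2_on simp: weak_derivative_def)
  then show ?thesis
    using False by (subst sobolev_cong[OF bump_edge[OF assms]]) auto
qed

lemma bump_H1: "bump e v \<epsilon> \<in> H"
  and bump_deriv: "e' \<in> arcs G \<Longrightarrow> AE x in leb (len e').
    edge_deriv len (bump e v \<epsilon>) e' x = (if e' = e then of_real (plateau' (v - \<epsilon>) v \<epsilon> x) else 0)"
proof -
  have out: "bump e v \<epsilon> p = 0" if "p \<notin> points G len" for p
    using that e by (cases p) (auto simp: bump_def points_def)
  show "bump e v \<epsilon> \<in> H"
    by (rule H1_graph_of_sobolev(1)[OF bump_sobolev out])
  show "e' \<in> arcs G \<Longrightarrow> AE x in leb (len e').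
    edge_deriv len (bump e v \<epsilon>) e' x = (if e' = e then of_real (plateau' (v - \<epsilon>) v \<epsilon> x) else 0)"
    by (rule H1_graph_of_sobolev(2)[OF bump_sobolev out])
qed

lemma bump_mass:
  "(\<Sum>e'\<in>arcs G. sqnorm (len e') (\<lambda>x. bump e v \<epsilon> (Inner e' x))) \<le> 2 * \<epsilon>"
proof -
  have "sqnorm (len e') (\<lambda>x. bump e v \<epsilon> (Inner e' x))
      = (if e' = e then LINT x|leb (len e). (cmod (of_real (plateau (v - \<epsilon>) v \<epsilon> x)))\<^sup>2 else 0)" for e'
  proof (cases "e' = e")
    case True
    then show ?thesis
      by simp (rule Bochner_Integration.integral_cong, auto simp: space_restrict_space bump_def)
  qed (simp add: bump_def)
  then have "(\<Sum>e'\<in>arcs G. sqnorm (len e') (\<lambda>x. bump e v \<epsilon> (Inner e' x)))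
      = sqnorm (len e) (\<lambda>x. of_real (plateau (v - \<epsilon>) v \<epsilon> x))"
    using finite_arcs e by simp
  also have "\<dots> \<le> 1\<^sup>2 * ((v + \<epsilon>) - (v - \<epsilon>))"
    by (rule LINT_square_le) (use \<epsilon> plateau_bounds[of \<epsilon> "v - \<epsilon>" v] plateau_outside[of \<epsilon> "v - \<epsilon>" v] in
        \<open>auto intro: continuous_plateau simp: abs_le_iff intro: order_trans[of _ 0]\<close>)
  finally show ?thesis by simp
qed

lemma plateau'_outside: "x \<notin> {v - \<epsilon>..v + \<epsilon>} \<Longrightarrow> plateau' (v - \<epsilon>) v \<epsilon> x = 0"
  unfolding plateau'_def using \<epsilon>
  by (subst step'_eq_0, force simp: divide_le_0_iff le_divide_eq)
    (subst step'_eq_0, auto simp: divide_le_0_iff le_divide_eq)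

lemma bump_kinetic:
  "kinetic (bump e v \<epsilon>) \<le> 8 / \<epsilon>"
proof -
  have "sqnorm (len e') (edge_deriv len (bump e v \<epsilon>) e')
      = (if e' = e then LINT x|leb (len e). (cmod (of_real (plateau' (v - \<epsilon>) v \<epsilon> x)))\<^sup>2 else 0)"
    if e': "e' \<in> arcs G" for e'
  proof -
    have "sqnorm (len e') (edge_deriv len (bump e v \<epsilon>) e')
        = sqnorm (len e') (\<lambda>x. if e' = e then of_real (plateau' (v - \<epsilon>) v \<epsilon> x) else 0)"
    proof (rule integral_cong_AE)
      show "AE x in leb (len e'). (cmod (edge_deriv len (bump e v \<epsilon>) e' x))\<^sup>2
          = (cmod (if e' = e then of_real (plateau' (v - \<epsilon>) v \<epsilon> x) else 0))\<^sup>2"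
        using bump_deriv[OF e'] by eventually_elim simp
      have "(\<lambda>x. if e' = e then of_real (plateau' (v - \<epsilon>) v \<epsilon> x) else 0) \<in> L2_on {0<..<len e'}"
        using bump_sobolev[OF e'] by (simp add: sobolev_def)
      from borel_measurable_integrable[OF L2_on_square[OF this]]
      show "(\<lambda>x. (cmod (if e' = e then of_real (plateau' (v - \<epsilon>) v \<epsilon> x) else 0))\<^sup>2) \<in> borel_measurable (leb (len e'))" .
      show "(\<lambda>x. (cmod (edge_deriv len (bump e v \<epsilon>) e' x))\<^sup>2) \<in> borel_measurable (leb (len e'))"
        by (rule borel_measurable_integrable[OF L2_on_square[OF edge_deriv_L2[OF bump_H1 e']]])
    qed
    then show ?thesis by simp
  qed
  then have "kinetic (bump e v \<epsilon>)
      = sqnorm (len e) (\<lambda>x. of_real (plateau' (v - \<epsilon>) v \<epsilon> x))"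
    using finite_arcs e by simp
  also have "\<dots> \<le> (2 / \<epsilon>)\<^sup>2 * ((v + \<epsilon>) - (v - \<epsilon>))"
    by (rule LINT_square_le[OF continuous_plateau' plateau'_bound[OF \<epsilon>(1)] plateau'_outside]) (use \<epsilon> in auto)
  also have "\<dots> = 8 / \<epsilon>" using \<epsilon> by (simp add: power2_eq_square)
  finally show ?thesis .
qed

end

end

context graph_form begin

text \<open>
  The bump meets \<open>V\<close> only in its centre, so \<open>\<sigma>\<close> contributes to its energy with a single value.
\<close>

lemma bump_form:
  assumes p: "Inner e v \<in> V" and e: "e \<in> arcs G" and \<epsilon>: "0 < \<epsilon>" "0 < v - \<epsilon>" "v + \<epsilon> < len e"
    and isolated: "\<And>y. \<bar>y - v\<bar> < \<epsilon> \<Longrightarrow> Inner e y \<in> V \<Longrightarrow> y = v"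
  shows "bump e v \<epsilon> \<in> D" "b.sq (bump e v \<epsilon>) \<le> 2 * \<epsilon>"
    "a.sq (bump e v \<epsilon>) \<le> 8 / \<epsilon> + q_bound * (2 * \<epsilon>) + \<sigma> (Inner e v)"
    "p' \<in> V \<Longrightarrow> p' \<noteq> Inner e v \<Longrightarrow> bump e v \<epsilon> p' = 0"
proof -
  let ?f = "bump e v \<epsilon>"
  have off: "?f p' = 0" if "p' \<in> V" "p' \<noteq> Inner e v" for p'
  proof -
    obtain e' y where p': "p' = Inner e' y" using V_inner[OF \<open>p' \<in> V\<close>] by blast
    show ?thesis
    proof (cases "e' = e")
      case True
      then have "\<not> \<bar>y - v\<bar> < \<epsilon>" using isolated[of y] that p' by blast
      then have "y \<le> v - \<epsilon> \<or> v + \<epsilon> \<le> y" by linarith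
      then show ?thesis unfolding p' by (rule bump_away[OF e \<epsilon>])
    qed (simp add: p' bump_def)
  qed
  show "p' \<in> V \<Longrightarrow> p' \<noteq> Inner e v \<Longrightarrow> ?f p' = 0" by (rule off)
  have "(\<lambda>p. \<sigma> p * (cmod (?f p))\<^sup>2) summable_on V \<longleftrightarrow> (\<lambda>p. \<sigma> p * (cmod (?f p))\<^sup>2) summable_on {Inner e v}"
    by (rule summable_on_cong_neutral) (use off p in auto)
  then show D: "?f \<in> D" using bump_H1[OF e \<epsilon>] by (simp add: form_domain_eq summable_domain_def)
  show b: "b.sq ?f \<le> 2 * \<epsilon>" unfolding b_sq by (rule bump_mass[OF e \<epsilon>])
  have "point_energy ?f = (\<Sum>\<^sub>\<infinity>p\<in>{Inner e v}. \<sigma> p * (cmod (?f p))\<^sup>2)"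
    by (rule infsum_cong_neutral) (use off p in auto)
  also have "\<dots> = \<sigma> (Inner e v)" by (simp add: bump_center[OF e \<epsilon>])
  finally have point: "point_energy ?f = \<sigma> (Inner e v)" .
  have vert: "vertex_energy ?f = 0" by (simp add: bump_def)
  have "potential ?f
      \<le> (\<Sum>e'\<in>arcs G. q_bound * sqnorm (len e') (\<lambda>x. ?f (Inner e' x)))"
    by (intro sum_mono root_q_L2(2) bump_H1[OF e \<epsilon>])
  also have "\<dots> = q_bound * b.sq ?f" unfolding b_sq by (simp add: sum_distrib_left)
  also have "\<dots> \<le> q_bound * (2 * \<epsilon>)" by (intro mult_left_mono b q_bound(1))
  finally show "a.sq ?f \<le> 8 / \<epsilon> + q_bound * (2 * \<epsilon>) + \<sigma> (Inner e v)"
    unfolding a_sq[OF D] point vert using bump_kinetic[OF e \<epsilon>] by linarith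
qed

lemma small_bump:
  assumes "p \<in> V"
  obtains e v \<delta> where "e \<in> arcs G" "p = Inner e v" "v \<in> {0..len e}" "\<delta> > 0"
    "\<And>\<epsilon>. 0 < \<epsilon> \<Longrightarrow> \<epsilon> < \<delta> \<Longrightarrow> 0 < v - \<epsilon> \<and> v + \<epsilon> < len e \<and> (\<forall>y. \<bar>y - v\<bar> < \<epsilon> \<longrightarrow> Inner e y \<in> V \<longrightarrow> y = v)"
proof -
  obtain e v where e: "e \<in> arcs G" "0 < v" "v < len e" "p = Inner e v" using V_inner[OF assms] by blast
  obtain \<delta> where \<delta>: "\<delta> > 0" "\<And>y. \<bar>y - v\<bar> < \<delta> \<Longrightarrow> Inner e y \<in> V \<Longrightarrow> y = v"
    using V_isolated[of e v] assms e(4) by blast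
  show thesis
    by (rule that[of e v "min \<delta> (min v (len e - v))"]) (use e \<delta> in auto)
qed

text \<open>
  Bumps around different points of the infinite set \<open>V\<close> are linearly independent.
\<close>

lemma form_domain_infinite_dimensional: "finite B \<Longrightarrow> \<not> D \<subseteq> cfun.span B"
proof
  assume B: "finite B" and sub: "D \<subseteq> cfun.span B"
  have "\<exists>\<phi>\<in>D. \<phi> p = 1 \<and> (\<forall>p'\<in>V. p' \<noteq> p \<longrightarrow> \<phi> p' = 0)" if p: "p \<in> V" for p
  proof -
    obtain e v \<delta> where e: "e \<in> arcs G" "p = Inner e v" "v \<in> {0..len e}" "\<delta> > 0"
      and \<delta>: "\<And>\<epsilon>. 0 < \<epsilon> \<Longrightarrow> \<epsilon> < \<delta> \<Longrightarrow> 0 < v - \<epsilon> \<and> v + \<epsilon> < len e \<and> (\<forall>y. \<bar>y - v\<bar> < \<epsilon> \<longrightarrow> Inner e y \<in> V \<longrightarrow> y = v)"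
      using small_bump[OF p] by metis
    have h: "0 < \<delta> / 2" "\<delta> / 2 < \<delta>" using e(4) by auto
    note d = \<delta>[OF h]
    show ?thesis
      using bump_form(1,4)[of e v "\<delta> / 2"] bump_center[OF e(1) h(1)] d p e h by (intro bexI[of _ "bump e v (\<delta> / 2)"]) auto
  qed
  then have "\<forall>p\<in>V. \<exists>\<phi>. \<phi> \<in> D \<and> \<phi> p = 1 \<and> (\<forall>p'\<in>V. p' \<noteq> p \<longrightarrow> \<phi> p' = 0)" by blast
  from bchoice[OF this] obtain \<phi> where \<phi>: "\<And>p. p \<in> V \<Longrightarrow> \<phi> p \<in> D" "\<And>p. p \<in> V \<Longrightarrow> \<phi> p p = 1"
    "\<And>p p'. p \<in> V \<Longrightarrow> p' \<in> V \<Longrightarrow> p' \<noteq> p \<Longrightarrow> \<phi> p p' = 0" by blast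
  obtain W where W: "finite W" "card W = Suc (card B)" "W \<subseteq> V"
    using infinite_arbitrarily_large[OF V_infinite] by blast
  have inj: "inj_on \<phi> W"
    by (rule inj_onI) (metis W(3) \<phi>(2,3) subsetD zero_neq_one)
  have "cfun.independent (\<phi> ` W)"
    unfolding cfun.dependent_finite[OF finite_imageI[OF W(1)]]
  proof safe
    fix c :: "(('v, 'e) point \<Rightarrow> complex) \<Rightarrow> complex" and p
    assume p: "p \<in> W" "c (\<phi> p) \<noteq> 0" and zero: "(\<Sum>v\<in>\<phi> ` W. (\<lambda>x. c v * v x)) = 0"
    have "0 = (\<Sum>v\<in>\<phi> ` W. (\<lambda>x. c v * v x)) p" using zero by simp
    also have "\<dots> = (\<Sum>v\<in>\<phi> ` W. c v * v p)" by (rule sum_fun_apply)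
    also have "\<dots> = (\<Sum>p'\<in>W. c (\<phi> p') * \<phi> p' p)" by (rule sum.reindex_cong[OF inj]) auto
    also have "\<dots> = (\<Sum>p'\<in>W. if p' = p then c (\<phi> p) else 0)"
      using \<phi>(2,3) W(3) p(1) by (intro sum.cong refl) (metis mult.right_neutral mult_zero_right subsetD)
    also have "\<dots> = c (\<phi> p)" using p(1) W(1) by simp
    finally show False using p(2) by simp
  qed
  moreover have "\<phi> ` W \<subseteq> cfun.span B" using sub \<phi>(1) W(3) by blast
  ultimately have "card (\<phi> ` W) \<le> card B" using cfun.independent_span_bound[OF B] by blast
  then show False using card_image[OF inj] W(2) by simp
qed

sublocale compact_form_pair D a b
proof
  show "f \<in> D \<Longrightarrow> b.sq f = 0 \<Longrightarrow> f = 0" for f by (rule b_definite)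
qed (rule compact_embedding form_complete form_domain_infinite_dimensional; assumption)+

lemma eigenspace_eq:
  "eigenspace G len V q \<gamma> \<sigma> \<mu> = {f \<in> D. \<forall>\<phi>\<in>D. a f \<phi> = of_real \<mu> * b f \<phi>}"
proof -
  have "(\<lambda>p. of_real \<mu> * f p) \<in> L2_graph G len" if "f \<in> D" for f
    using inner_L2[OF D_H[OF that]] by (auto simp: L2_graph_def intro!: L2_on_scale)
  then show ?thesis
    unfolding eigenspace_def schroedinger_operator_def using b.scale_left[of _ _ "of_real \<mu>"] by auto
qed

lemma nth_eigenvalue_eq:
  assumes n: "1 \<le> n"
  shows "nth_eigenvalue G len V q \<gamma> \<sigma> n = eigval (n - 1)"
proof -
  define lam where "lam n = eigval (n - 1)" for n
  have shift: "{n \<in> {1..}. P (lam n)} = Suc ` {n. P (eigval n)}" for P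
  proof (rule set_eqI)
    show "n \<in> {n \<in> {1..}. P (lam n)} \<longleftrightarrow> n \<in> Suc ` {n. P (eigval n)}" for n
      by (cases n) (auto simp: lam_def)
  qed
  have fin: "finite {n \<in> {1..}. lam n \<le> \<mu>}" for \<mu>
    unfolding shift[of "\<lambda>t. t \<le> \<mu>"] by (intro finite_imageI finite_eigval_le)
  have mono: "mono_on {1..} lam"
    by (auto simp: mono_on_def lam_def intro: eigval_mono)
  have card: "card {n \<in> {1..}. lam n = \<mu>} = card {n. eigval n = \<mu>}" for \<mu>
    unfolding shift[of "\<lambda>t. t = \<mu>"] by (rule card_image) simp
  have dim: "has_dimension (eigenspace G len V q \<gamma> \<sigma> \<mu>) (card {n \<in> {1..}. lam n = \<mu>})" for \<mu>
    unfolding card eigenspace_eq by (rule eigenspace_dimension)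
  have fin': "finite {n \<in> {1..}. lam n = \<mu>}" for \<mu>
    by (rule finite_subset[OF _ fin[of \<mu>]]) auto
  have enum: "eigenvalue_enumeration G len V q \<gamma> \<sigma> lam"
    unfolding eigenvalue_enumeration_def using mono fin' dim by blast
  have unique: "lam' n = lam n" if "eigenvalue_enumeration G len V q \<gamma> \<sigma> lam'" for lam'
  proof (rule mono_nat_sequence_unique[symmetric, OF mono _ fin _ _ n])
    show "mono_on {1..} lam'" "finite {n \<in> {1..}. lam' n = \<mu>}" for \<mu>
      using that by (auto simp: eigenvalue_enumeration_def)
    show "card {n \<in> {1..}. lam n = \<mu>} = card {n \<in> {1..}. lam' n = \<mu>}" for \<mu>
      by (rule has_dimension_unique[OF dim]) (use that in \<open>simp add: eigenvalue_enumeration_def\<close>)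
  qed
  show ?thesis
    unfolding nth_eigenvalue_def
  proof (rule the_equality)
    show "\<exists>lam. eigenvalue_enumeration G len V q \<gamma> \<sigma> lam \<and> lam n = eigval (n - 1)"
      by (intro exI[of _ lam] conjI enum) (rule lam_def)
    fix x assume "\<exists>lam. eigenvalue_enumeration G len V q \<gamma> \<sigma> lam \<and> lam n = x"
    then obtain lam' where "eigenvalue_enumeration G len V q \<gamma> \<sigma> lam'" and x: "lam' n = x" by blast
    from unique[OF this(1)] show "x = eigval (n - 1)" unfolding x lam_def .
  qed
qed

section \<open>Growth of the eigenvalues and local weights of the eigenfunctions\<close>

definition growth :: real where
  "growth = 1 / (8 * (real (card (arcs G)))\<^sup>2 * total_length\<^sup>2)"

lemma card_arcs_pos: "0 < card (arcs G)"
  using finite_arcs arcs_nonempty by (simp add: card_gt_0_iff)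

lemma growth_pos: "0 < growth"
  using card_arcs_pos total_length_pos by (simp add: growth_def)

text \<open>
  Take \<open>m\<close> grid points on each of the \<open>E\<close> edges, with \<open>E * m\<close> at most \<open>N\<close> but of the same order. A function
  that vanishes at these points satisfies \<open>b \<le> 2 (L / m)\<^sup>2 a\<close>, where \<open>L\<close> is the total length.
\<close>

lemma eigval_growth:
  assumes N: "card (arcs G) \<le> N"
  shows "growth * (real N)\<^sup>2 \<le> eigval N"
proof -
  define E where "E = card (arcs G)"
  define m where "m = N div E"
  have E: "0 < E" unfolding E_def by (rule card_arcs_pos)
  have m: "0 < m" using N E by (simp add: m_def E_def div_greater_zero_iff)
  let ?P = "(\<lambda>(e, i). grid_point m e i) ` (arcs G \<times> {..<m})"
  have fin: "finite ?P" using finite_arcs by simp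
  have "card ?P \<le> card (arcs G \<times> {..<m})" by (rule card_image_le) (simp add: finite_arcs)
  also have "\<dots> = E * m" by (simp add: E_def card_cartesian_product)
  also have "\<dots> \<le> N" unfolding m_def by (rule times_div_less_eq_dividend)
  finally have card: "card ?P \<le> N" .
  have "1 \<le> 2 * (total_length / real m)\<^sup>2 * eigval N"
  proof (rule eigval_lower_bound[OF fin _ card])
    fix f assume f: "f \<in> D" and zero: "\<And>p. p \<in> ?P \<Longrightarrow> f p = 0"
    have "f (grid_point m e i) = 0" if "e \<in> arcs G" "i < m" for e i
      by (rule zero) (use that in force)
    then have "(\<Sum>e\<in>arcs G. \<Sum>i<m. (cmod (f (grid_point m e i)))\<^sup>2) = 0" by (intro sum.neutral ballI) simp
    then show "b.sq f \<le> 2 * (total_length / real m)\<^sup>2 * a.sq f"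
      using grid_estimate[OF f m] by simp
  qed simp
  then have "(real m)\<^sup>2 \<le> 2 * total_length\<^sup>2 * eigval N"
    using m by (simp add: power_divide field_simps)
  moreover have "real N \<le> 2 * real E * real m"
  proof -
    have "N = E * m + N mod E" unfolding m_def by simp
    also have "\<dots> \<le> E * m + E * m"
      using mod_less_divisor[OF E, of N] m by (intro add_left_mono) (metis less_imp_le mult.right_neutral mult_le_mono2 order_trans Suc_leI One_nat_def)
    finally have "real N \<le> real (E * m + E * m)" by (simp only: of_nat_le_iff)
    then show ?thesis by simp
  qed
  then have "(real N)\<^sup>2 \<le> (2 * real E * real m)\<^sup>2" by (intro power_mono) auto
  moreover have "(2 * real E * real m)\<^sup>2 = 4 * (real E)\<^sup>2 * (real m)\<^sup>2" by (simp add: power_mult_distrib)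
  ultimately have "(real N)\<^sup>2 \<le> 4 * (real E)\<^sup>2 * (2 * total_length\<^sup>2 * eigval N)"
    using mult_left_mono[of "(real m)\<^sup>2" "2 * total_length\<^sup>2 * eigval N" "4 * (real E)\<^sup>2"] by simp
  then show ?thesis
    using E total_length_pos by (simp add: growth_def E_def[symmetric] field_simps)
qed

text \<open>
  This solves \<open>18 \<eta> (1 + 1 / growth) = 1 / 4\<close>, which is what the local estimate below asks of the
  ratio \<open>\<eta>\<close> between the steepness of the bump and \<open>N\<close>.
\<close>

definition weight_const :: real where
  "weight_const = 1 / (72 * (1 + 1 / growth))"

lemma weight_const_pos: "0 < weight_const"
  using growth_pos by (simp add: weight_const_def add_pos_pos)

text \<open>
  The lower half of a local Weyl law, with a constant that is the same at all points of \<open>V\<close>. Let \<open>\<phi>\<close> be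
  a bump of height \<open>1\<close> at \<open>p\<close> with half-width \<open>1 / (\<eta> N)\<close>. Its energy is of order \<open>\<eta> N\<close>, because the
  contributions of \<open>q\<close> and \<open>\<sigma> p\<close> stay bounded as \<open>N\<close> grows. The component \<open>Q\<close> of \<open>\<phi>\<close> orthogonal to the
  first \<open>N\<close> eigenfunctions has no more energy, and by the growth of the eigenvalues its mass is of order
  \<open>\<eta> / N\<close>. The bound on the values with \<open>r = 1 / N\<close> shows that \<open>|Q p|\<^sup>2\<close> is of order \<open>\<eta>\<close>, so for small \<open>\<eta>\<close>
  the projection of \<open>\<phi>\<close> has to be at least \<open>1 / 2\<close> at \<open>p\<close>. As the mass of \<open>\<phi>\<close> is at most \<open>2 / (\<eta> N)\<close>, this
  forces the eigenfunctions to carry the asserted weight at \<open>p\<close>.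
\<close>

lemma local_weight:
  assumes p: "p \<in> V"
  shows "\<forall>\<^sub>F N in sequentially. weight_const / 8 * real N \<le> (\<Sum>n<N. (cmod (eigvec n p))\<^sup>2)"
proof -
  define \<eta> where "\<eta> = weight_const"
  have \<eta>: "\<eta> > 0" unfolding \<eta>_def by (rule weight_const_pos)
  obtain e v \<delta> where e: "e \<in> arcs G" "p = Inner e v" "v \<in> {0..len e}" "\<delta> > 0"
    and \<delta>: "\<And>\<epsilon>. 0 < \<epsilon> \<Longrightarrow> \<epsilon> < \<delta> \<Longrightarrow> 0 < v - \<epsilon> \<and> v + \<epsilon> < len e \<and> (\<forall>y. \<bar>y - v\<bar> < \<epsilon> \<longrightarrow> Inner e y \<in> V \<longrightarrow> y = v)"
    using small_bump[OF p] by metis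
  have inv: "(\<lambda>N. 1 / real N) \<longlonglongrightarrow> 0" by (rule lim_1_over_n)
  have ev1: "\<forall>\<^sub>F N in sequentially. 1 / \<eta> * (1 / real N) < \<delta>"
    by (rule order_tendstoD(2)[OF tendsto_mult_right_zero[OF inv]]) (rule e(4))
  have ev2: "\<forall>\<^sub>F N in sequentially. 1 / real N < len e"
    by (rule order_tendstoD(2)[OF inv]) (rule len_pos[OF e(1)])
  have "(\<lambda>N. (q_bound * 2 / \<eta> * (1 / real N) + \<sigma> p) * (1 / real N)) \<longlonglongrightarrow> (q_bound * 2 / \<eta> * 0 + \<sigma> p) * 0"
    by (intro tendsto_mult tendsto_add tendsto_const inv)
  then have ev3: "\<forall>\<^sub>F N in sequentially. (q_bound * 2 / \<eta> * (1 / real N) + \<sigma> p) * (1 / real N) < \<eta>"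
    by (rule order_tendstoD(2)) (use \<eta> in simp)
  show ?thesis
    using ev1 ev2 ev3 eventually_ge_at_top[of "card (arcs G)"]
  proof eventually_elim
    case (elim N)
    have N: "0 < N" using elim(4) card_arcs_pos by simp
    define \<epsilon> where "\<epsilon> = 1 / (\<eta> * real N)"
    define \<phi> where "\<phi> = bump e v \<epsilon>"
    have \<epsilon>: "0 < \<epsilon>" "\<epsilon> < \<delta>" using \<eta> N elim(1) by (auto simp: \<epsilon>_def)
    note d = \<delta>[OF \<epsilon>]
    have \<phi>D: "\<phi> \<in> D" and \<phi>b: "b.sq \<phi> \<le> 2 * \<epsilon>" and \<phi>a: "a.sq \<phi> \<le> 8 / \<epsilon> + q_bound * (2 * \<epsilon>) + \<sigma> p"
      and \<phi>p: "\<phi> p = 1"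
      unfolding \<phi>_def e(2)
      using bump_form(1-3)[of e v \<epsilon>] bump_center[OF e(1) \<epsilon>(1)] d \<epsilon> p e by auto
    have "(q_bound * 2 / \<eta> * (1 / real N) + \<sigma> p) < \<eta> * real N"
      using elim(3) N by (simp add: divide_less_eq)
    then have h: "a.sq \<phi> \<le> 9 * \<eta> * real N"
      using \<phi>a N \<eta> by (simp add: \<epsilon>_def)
    define Q where "Q = \<phi> - b.proj eigvec N \<phi>"
    have QD: "Q \<in> D" unfolding Q_def by (intro b.mem_diff \<phi>D b.proj_mem orthonormal_eigvec)
    have Qa: "a.sq Q \<le> 9 * \<eta> * real N"
      using remainder_energy_le[OF \<phi>D, of N] h by (simp add: Q_def)
    have "growth * (real N)\<^sup>2 * b.sq Q \<le> 9 * \<eta> * real N"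
    proof -
      have "growth * (real N)\<^sup>2 * b.sq Q \<le> eigval N * b.sq Q"
        by (intro mult_right_mono eigval_growth elim(4) b.sq_nonneg QD)
      also have "\<dots> \<le> a.sq Q" unfolding Q_def by (rule Rayleigh_remainder[OF \<phi>D])
      finally show ?thesis using Qa by simp
    qed
    then have Qb: "real N * b.sq Q \<le> 9 * \<eta> / growth"
      using growth_pos N by (simp add: le_divide_eq power2_eq_square mult_ac)
    have "(cmod (Q p))\<^sup>2 \<le> 2 * (1 / real N) * a.sq Q + 2 / (1 / real N) * b.sq Q"
    proof -
      have "p = edge e v" using V_inner[OF p] by (auto simp: e(2) edge_point_inner)
      moreover have "(cmod (Q (edge e v)))\<^sup>2 \<le> 2 * (1 / real N) * a.sq Q + 2 / (1 / real N) * b.sq Q"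
        by (rule value_bound[OF QD e(1,3)]) (use N elim(2) in auto)
      ultimately show ?thesis by simp
    qed
    also have "\<dots> \<le> 2 * (9 * \<eta>) + 2 * (9 * \<eta> / growth)"
      using Qa Qb N by (intro add_mono) (auto simp: divide_le_eq)
    also have "\<dots> = 18 * (\<eta> * (1 + 1 / growth))" by (simp add: distrib_left)
    also have "\<eta> * (1 + 1 / growth) = 1 / 72"
    proof -
      have "1 + 1 / growth > 0" using growth_pos by (simp add: add_pos_pos)
      then show ?thesis by (simp add: \<eta>_def weight_const_def)
    qed
    finally have "(cmod (Q p))\<^sup>2 \<le> (1 / 2)\<^sup>2" by (simp add: power2_eq_square)
    then have "cmod (Q p) \<le> 1 / 2" by (rule power2_le_imp_le) simp
    moreover have "1 \<le> cmod (b.proj eigvec N \<phi> p) + cmod (Q p)"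
      using norm_triangle_ineq[of "b.proj eigvec N \<phi> p" "Q p"] \<phi>p by (simp add: Q_def)
    ultimately have "(1 / 2)\<^sup>2 \<le> (cmod (b.proj eigvec N \<phi> p))\<^sup>2" by (intro power_mono) auto
    also have "\<dots> \<le> b.sq \<phi> * (\<Sum>i<N. (cmod (eigvec i p))\<^sup>2)" by (rule proj_value_le[OF \<phi>D])
    also have "\<dots> \<le> 2 * \<epsilon> * (\<Sum>i<N. (cmod (eigvec i p))\<^sup>2)"
      by (intro mult_right_mono \<phi>b sum_nonneg) simp
    finally have "1 / 4 \<le> 2 * (\<Sum>i<N. (cmod (eigvec i p))\<^sup>2) / (\<eta> * real N)"
      by (simp add: \<epsilon>_def power2_eq_square)
    then show ?case using \<eta> N by (simp add: \<eta>_def[symmetric] le_divide_eq)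
  qed
qed

end

section \<open>Divergence of the mean eigenvalue shift\<close>

text \<open>
  The eigenfunctions of the operator with point interactions are trial functions for the other one.
  Ky Fan's inequality turns the part of their energy that is concentrated at a finite set \<open>F\<close> of
  points into a lower bound for the sum of the first \<open>N\<close> differences, and by the local estimate that part
  is at least a constant times \<open>N * (\<Sum>p\<in>F. \<sigma> p)\<close> as soon as \<open>N\<close> is large.
\<close>

theorem mean_gap_tendsto_infinity:
  assumes S: "graph_form G len V q \<gamma> \<sigma>" and Z: "graph_form G len V q0 \<gamma>0 (\<lambda>_. 0)"
    and q0: "\<And>e x. e \<in> arcs G \<Longrightarrow> x \<in> {0<..<len e} \<Longrightarrow> q0 (Inner e x) \<le> q (Inner e x)"
    and \<gamma>0: "\<And>v. v \<in> verts G \<Longrightarrow> \<gamma>0 v \<le> \<gamma> v"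
    and not_summable: "\<not> \<sigma> summable_on V"
  shows "filterlim (\<lambda>N. 1 / real N * (\<Sum>n=1..N.
    nth_eigenvalue G len V q \<gamma> \<sigma> n - nth_eigenvalue G len V q0 \<gamma>0 (\<lambda>_. 0) n)) at_top sequentially"
proof -
  interpret S: graph_form G len V q \<gamma> \<sigma> by (rule S)
  interpret Z: graph_form G len V q0 \<gamma>0 "\<lambda>_. 0" by (rule Z)
  have DZ: "f \<in> Z.D" if "f \<in> S.D" for f
    using S.D_H[OF that] by (simp add: Z.form_domain_eq Z.summable_domain_def)
  have compare: "Z.a.sq f + (\<Sum>p\<in>F. \<sigma> p * (cmod (f p))\<^sup>2) \<le> S.a.sq f"
    if f: "f \<in> S.D" and F: "finite F" "F \<subseteq> V" for f F
  proof -
    have "Z.potential f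
        \<le> S.potential f"
    proof (rule sum_mono, rule integral_mono)
      fix e x assume e: "e \<in> arcs G" and x: "x \<in> space (leb (len e))"
      have x: "x \<in> {0<..<len e}" using x by (simp add: space_restrict_space)
      show "(cmod (Z.root_q e f x))\<^sup>2 \<le> (cmod (S.root_q e f x))\<^sup>2"
        using q0[OF e x] Z.q_nonneg[OF e x]
        by (auto simp: Z.root_q_def S.root_q_def norm_mult power_mult_distrib intro!: mult_right_mono)
    qed (intro L2_on_square S.root_q_L2 Z.root_q_L2 S.D_H f; assumption)+
    moreover have "(\<Sum>v\<in>verts G. \<gamma>0 v * (cmod (f (Vertex v)))\<^sup>2) \<le> S.vertex_energy f"
      by (intro sum_mono mult_right_mono \<gamma>0) auto
    moreover note S.point_interaction_le[OF f F]
    ultimately show ?thesis unfolding S.a_sq[OF f] Z.a_sq[OF DZ[OF f]] by simp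
  qed
  have gap: "(\<Sum>p\<in>F. \<sigma> p * (\<Sum>n<N. (cmod (S.eigvec n p))\<^sup>2)) \<le>
      (\<Sum>n=1..N. nth_eigenvalue G len V q \<gamma> \<sigma> n - nth_eigenvalue G len V q0 \<gamma>0 (\<lambda>_. 0) n)"
    if F: "finite F" "F \<subseteq> V" for F N
  proof -
    have on: "Z.b.orthonormal S.eigvec N"
      using DZ S.eigvec_mem S.eigvec_orthonormal by (simp add: Z.b.orthonormal_def)
    have "(\<Sum>n<N. Z.eigval n) + (\<Sum>n<N. \<Sum>p\<in>F. \<sigma> p * (cmod (S.eigvec n p))\<^sup>2)
        \<le> (\<Sum>n<N. Z.a.sq (S.eigvec n)) + (\<Sum>n<N. \<Sum>p\<in>F. \<sigma> p * (cmod (S.eigvec n p))\<^sup>2)"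
      using Z.Ky_Fan[OF on] by simp
    also have "\<dots> \<le> (\<Sum>n<N. S.eigval n)"
      unfolding sum.distrib[symmetric] S.eigval_def by (intro sum_mono compare S.eigvec_mem F)
    finally have "(\<Sum>n<N. \<Sum>p\<in>F. \<sigma> p * (cmod (S.eigvec n p))\<^sup>2) \<le> (\<Sum>n<N. S.eigval n - Z.eigval n)"
      by (simp add: sum_subtractf)
    also have "(\<Sum>n<N. \<Sum>p\<in>F. \<sigma> p * (cmod (S.eigvec n p))\<^sup>2) = (\<Sum>p\<in>F. \<sigma> p * (\<Sum>n<N. (cmod (S.eigvec n p))\<^sup>2))"
      unfolding sum_distrib_left by (rule sum.swap)
    also have "(\<Sum>n<N. S.eigval n - Z.eigval n) =
        (\<Sum>n=1..N. nth_eigenvalue G len V q \<gamma> \<sigma> n - nth_eigenvalue G len V q0 \<gamma>0 (\<lambda>_. 0) n)"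
      by (rule sum.reindex_bij_witness[of _ "\<lambda>n. n - 1" Suc]) (auto simp: S.nth_eigenvalue_eq Z.nth_eigenvalue_eq)
    finally show ?thesis .
  qed
  show ?thesis
    unfolding filterlim_at_top
  proof
    fix C :: real
    define c where "c = S.weight_const / 8"
    have c: "c > 0" using S.weight_const_pos by (simp add: c_def)
    have "\<exists>F. finite F \<and> F \<subseteq> V \<and> C / c < (\<Sum>p\<in>F. \<sigma> p)"
    proof (rule ccontr)
      assume "\<not> ?thesis"
      then have "(\<Sum>p\<in>F. \<sigma> p) \<le> C / c" if "finite F" "F \<subseteq> V" for F using that not_less by blast
      then have "\<sigma> summable_on V"
        using S.\<sigma>_nonneg by (intro nonneg_bdd_above_summable_on bdd_aboveI2[where M = "C / c"]) auto
      then show False using not_summable by blast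
    qed
    then obtain F where F: "finite F" "F \<subseteq> V" "C / c < (\<Sum>p\<in>F. \<sigma> p)" by blast
    have "\<forall>\<^sub>F N in sequentially. \<forall>p\<in>F. c * real N \<le> (\<Sum>n<N. (cmod (S.eigvec n p))\<^sup>2)"
      unfolding c_def using F by (intro eventually_ball_finite ballI S.local_weight) auto
    then show "\<forall>\<^sub>F N in sequentially. C \<le> 1 / real N * (\<Sum>n=1..N.
        nth_eigenvalue G len V q \<gamma> \<sigma> n - nth_eigenvalue G len V q0 \<gamma>0 (\<lambda>_. 0) n)"
      using eventually_gt_at_top[of 0]
    proof eventually_elim
      case (elim N)
      have "C * real N \<le> (c * (\<Sum>p\<in>F. \<sigma> p)) * real N"
        using F(3) c elim(2) by (intro mult_right_mono) (auto simp: divide_less_eq mult.commute)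
      also have "\<dots> = (\<Sum>p\<in>F. \<sigma> p * (c * real N))"
        by (simp add: sum_distrib_left sum_distrib_right mult_ac)
      also have "\<dots> \<le> (\<Sum>p\<in>F. \<sigma> p * (\<Sum>n<N. (cmod (S.eigvec n p))\<^sup>2))"
        using elim(1) S.\<sigma>_nonneg F(2) by (intro sum_mono mult_left_mono) auto
      also note gap[OF F(1,2), of N]
      finally show ?case using elim(2) by (simp add: le_divide_eq)
    qed
  qed
qed

lemma added_vertices_isolated:
  assumes G: "finite_metric_graph G len" and V: "admissible_added_vertices G len \<gamma> V" and p: "Inner e x \<in> V"
  shows "\<exists>\<delta>>0. \<forall>y. \<bar>y - x\<bar> < \<delta> \<longrightarrow> Inner e y \<in> V \<longrightarrow> y = x"
proof -
  interpret finite_metric_graph G len by (rule G)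
  have e: "e \<in> arcs G" "0 < x" "x < len e" and nd: "Inner e x \<notin> X derived_set_of V"
    using V p by (auto simp: admissible_added_vertices_def)
  have "Inner e x \<in> points G len" using e by (auto simp: points_def)
  then obtain U where U: "openin X U" "Inner e x \<in> U" and only: "\<And>p. p \<in> U \<Longrightarrow> p \<in> V \<Longrightarrow> p = Inner e x"
    using nd unfolding derived_set_of_def topspace_X by blast
  have "openin (top_of_set {0..len e}) {y \<in> {0..len e}. edge e y \<in> U}"
    using U(1) e(1) by (simp add: openin_graph_topology)
  moreover have "x \<in> {y \<in> {0..len e}. edge e y \<in> U}" using e U(2) by (simp add: edge_point_inner)
  ultimately obtain \<delta> where \<delta>: "\<delta> > 0" "ball x \<delta> \<inter> {0..len e} \<subseteq> {y \<in> {0..len e}. edge e y \<in> U}"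
    unfolding openin_contains_ball by blast
  have "y = x" if "\<bar>y - x\<bar> < \<delta>" "Inner e y \<in> V" for y
  proof -
    have y: "0 < y" "y < len e" using V that(2) by (auto simp: admissible_added_vertices_def)
    then have "y \<in> ball x \<delta> \<inter> {0..len e}" using that(1) by (simp add: dist_real_def abs_minus_commute)
    then have "edge e y \<in> U" using \<delta>(2) by blast
    then show ?thesis using only[of "Inner e y"] that(2) y by (simp add: edge_point_inner)
  qed
  then show ?thesis using \<delta>(1) by blast
qed

theorem theorem12:
  fixes G :: "('v, 'e) pre_digraph" and len :: "'e \<Rightarrow> real"
    and V :: "('v, 'e) point set" and q :: "('v, 'e) point \<Rightarrow> real"
    and \<gamma> :: "'v \<Rightarrow> real" and \<sigma> :: "('v, 'e) point \<Rightarrow> real"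
  assumes "metric_graph G len"
    and "admissible_potential G len q"
    and "\<And>v. v \<in> verts G \<Longrightarrow> 0 \<le> \<gamma> v"
    and "admissible_added_vertices G len \<gamma> V"
    and "\<And>p. p \<in> V \<Longrightarrow> 0 \<le> \<sigma> p"
    and "\<not> \<sigma> summable_on V"
  shows "filterlim (\<lambda>N. 1 / real N * (\<Sum>n=1..N.
             nth_eigenvalue G len V q \<gamma> \<sigma> n - nth_eigenvalue G len V q \<gamma> (\<lambda>_. 0) n))
           at_top sequentially \<and>
         filterlim (\<lambda>N. 1 / real N * (\<Sum>n=1..N.
             nth_eigenvalue G len V q \<gamma> \<sigma> n - nth_eigenvalue G len V (\<lambda>_. 0) \<gamma> (\<lambda>_. 0) n))
           at_top sequentially \<and>
         filterlim (\<lambda>N. 1 / real N * (\<Sum>n=1..N.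
             nth_eigenvalue G len V q \<gamma> \<sigma> n - nth_eigenvalue G len V (\<lambda>_. 0) (\<lambda>_. 0) (\<lambda>_. 0) n))
           at_top sequentially"
proof -
  have graph: "finite_metric_graph G len" using assms(1) by unfold_locales
  have inf: "infinite V" using assms(6) by (auto intro: summable_on_finite)
  have form: "graph_form G len V q' \<gamma>' \<sigma>'"
    if "q' = q \<or> q' = (\<lambda>_. 0)" "\<gamma>' = \<gamma> \<or> \<gamma>' = (\<lambda>_. 0)" "\<sigma>' = \<sigma> \<or> \<sigma>' = (\<lambda>_. 0)" for q' \<gamma>' \<sigma>'
  proof (rule graph_form.intro[OF graph], unfold_locales)
    fix e assume e: "e \<in> arcs G"
    show "0 \<le> q' (Inner e x)" if "x \<in> {0<..<len e}" for x
      using assms(2) e that \<open>q' = q \<or> _\<close> by (auto simp: admissible_potential_def)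
    show "(\<lambda>x. q' (Inner e x)) \<in> borel_measurable (leb (len e))"
      using assms(2) e \<open>q' = q \<or> _\<close> by (auto simp: admissible_potential_def)
    show "\<exists>C. AE x in leb (len e). \<bar>q' (Inner e x)\<bar> \<le> C"
      using assms(2) e \<open>q' = q \<or> _\<close> by (auto simp: admissible_potential_def intro: exI[of _ 0])
  next
    show "\<exists>e x. e \<in> arcs G \<and> 0 < x \<and> x < len e \<and> p = Inner e x" if "p \<in> V" for p
      using assms(4) that by (auto simp: admissible_added_vertices_def)
    show "\<exists>\<delta>>0. \<forall>y. \<bar>y - x\<bar> < \<delta> \<longrightarrow> Inner e y \<in> V \<longrightarrow> y = x" if "Inner e x \<in> V" for e x
      by (rule added_vertices_isolated[OF graph assms(4) that])
  qed (use that assms(3,5) inf in auto)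
  have q_nonneg: "0 \<le> q (Inner e x)" if "e \<in> arcs G" "x \<in> {0<..<len e}" for e x
    using assms(2) that by (auto simp: admissible_potential_def)
  show ?thesis
    by (intro conjI mean_gap_tendsto_infinity form) (use assms(3,6) q_nonneg in auto)
qed

end
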